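(* Let $K\ge 1$, $p\ge 1$ and $L\ge 1$. Let $f:\mathbb{C}\to\mathbb{C}$ be a homeomorphism with $p$-integrable distortion which is $K$-quasiconformal in the unit disk $D$. Assume furthermore that the image $\Omega=f(D)$ of the unit disk is the image of a weak starlike domain $\Omega_L$ under an $L$-bi-Lipschitz mapping of the plane $\mathbb{C}\to\mathbb{C}$. Fix $0<s<2$ and $\epsilon>0$, and let $A\subset\mathbb{C}$ be a set such that for every point $z\in A$ there is a sequence $(\lambda_n)$ of nonzero complex numbers (depending on $z$) with $|\lambda_n|\to0$ as $n\to\infty$ and $z+\lambda_n\in\overline{D}$ for every $n$, for which $$|f(z)-f(z+\lambda_n)|\ \le\ |\lambda_n|^{2K+\frac{2-s+\epsilon}{p}}\qquad\text{for every } n.$$ Then $$\dim(A)\le s,$$ where $\dim$ denotes Hausdorff dimension.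
   Context: $D=\{z\in\mathbb{C}:|z|<1\}$ is the open unit disk and $\overline D$ its closure. Quasiconformality: an orientation-preserving homeomorphism $f:\Omega\to\Omega'$ between planar domains is $K$-quasiconformal if $f\in W^{1,2}_{loc}(\Omega)$ and $|Df(z)|^2\le K J_f(z)$ for almost every $z\in\Omega$, where $|Df(z)|=\sup\{|Df(z)v|:v\in\mathbb{C},|v|=1\}$ and $J_f$ is the Jacobian of $f$. "$f$ is $K$-quasiconformal in the unit disk" means that $f|_D:D\to f(D)$ is $K$-quasiconformal. Finite distortion: an orientation-preserving homeomorphism $f:\Omega\to\Omega'$ is a mapping of finite distortion if (1) $f\in W^{1,1}_{loc}(\Omega)$; (2) $J_f\in L^1_{loc}(\Omega)$; (3) there is a measurable function $K_f\ge1$, finite almost everywhere, with $|Df(z)|^2\le K_f(z)J_f(z)$ for (almost) every $z\in\Omega$. The smallest such function is denoted $K_f$ and called the distortion of $f$. A homeomorphism $f:\mathbb{C}\to\mathbb{C}$ has $p$-integrable distortion if it is a mapping of finite distortion with $K_f\in L^p_{loc}(\mathbb{C})$. Weak starlike: a domain $\Omega\subset\mathbb{C}$ is weak starlike if for any two points $z,x\in\partial\Omega$ there is a point $w\in\Omega$, possibly depending on $z,x$, such that the line segments satisfy $[w,z]\subset\overline\Omega$ and $[w,x]\subset\overline\Omega$. Bi-Lipschitz: $g:\mathbb{C}\to\mathbb{C}$ is a planar $L$-bi-Lipschitz mapping if it is a homeomorphism of $\mathbb{C}$ with $\frac1L|a-b|\le|g(a)-g(b)|\le L|a-b|$ for all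 $a,b\in\mathbb{C}$. *)

theory Defs
  imports "HOL-Complex_Analysis.Complex_Analysis"
begin

definition planar_domain :: "complex set \<Rightarrow> bool" where
  "planar_domain \<Omega> \<longleftrightarrow> open \<Omega> \<and> connected \<Omega> \<and> \<Omega> \<noteq> {}"


text \<open>Smooth functions: differentiable at every order with continuous partial derivatives.
  The argument \<open>v\<close> below runs over the two coordinate directions of the plane.\<close>

primrec C_k :: "nat \<Rightarrow> (complex \<Rightarrow> real) \<Rightarrow> bool" where
  "C_k 0 \<phi> \<longleftrightarrow> continuous_on UNIV \<phi>"
| "C_k (Suc n) \<phi> \<longleftrightarrow> (\<forall>z. \<phi> differentiable (at z)) \<and>
     (\<forall>v\<in>{1, \<i>}. C_k n (\<lambda>z. frechet_derivative \<phi> (at z) v))"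

definition test_function :: "complex set \<Rightarrow> (complex \<Rightarrow> real) \<Rightarrow> bool" where
  "test_function \<Omega> \<phi> \<longleftrightarrow> (\<forall>n. C_k n \<phi>) \<and>
     compact (closure {z. \<phi> z \<noteq> 0}) \<and> closure {z. \<phi> z \<noteq> 0} \<subseteq> \<Omega>"

definition Lp_loc :: "real \<Rightarrow> complex set \<Rightarrow> (complex \<Rightarrow> 'b::{banach, second_countable_topology}) \<Rightarrow> bool" where
  "Lp_loc p \<Omega> g \<longleftrightarrow> g \<in> borel_measurable (lebesgue_on \<Omega>) \<and>
     (\<forall>C. compact C \<and> C \<subseteq> \<Omega> \<longrightarrow> set_integrable lebesgue C (\<lambda>z. norm (g z) powr p))"

definition has_weak_deriv :: "complex \<Rightarrow> complex set \<Rightarrow> (complex \<Rightarrow> complex) \<Rightarrow> (complex \<Rightarrow> complex) \<Rightarrow> bool" where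
  "has_weak_deriv v \<Omega> f g \<longleftrightarrow> Lp_loc 1 \<Omega> f \<and> Lp_loc 1 \<Omega> g \<and>
     (\<forall>\<phi>. test_function \<Omega> \<phi> \<longrightarrow>
        (LINT z:\<Omega>|lebesgue. frechet_derivative \<phi> (at z) v *\<^sub>R f z) =
        - (LINT z:\<Omega>|lebesgue. \<phi> z *\<^sub>R g z))"

text \<open>Weak derivatives are unique up to a null set, and they only enter below through
  integrals and almost-everywhere statements, so the choice of representative is immaterial.\<close>

definition weak_deriv :: "complex \<Rightarrow> complex set \<Rightarrow> (complex \<Rightarrow> complex) \<Rightarrow> complex \<Rightarrow> complex" where
  "weak_deriv v \<Omega> f = (SOME g. has_weak_deriv v \<Omega> f g)"

definition sobolev_loc :: "real \<Rightarrow> complex set \<Rightarrow> (complex \<Rightarrow> complex) \<Rightarrow> bool" where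
  "sobolev_loc p \<Omega> f \<longleftrightarrow> Lp_loc p \<Omega> f \<and>
     (\<forall>v\<in>{1, \<i>}. (\<exists>g. has_weak_deriv v \<Omega> f g) \<and> Lp_loc p \<Omega> (weak_deriv v \<Omega> f))"

definition weak_D :: "complex set \<Rightarrow> (complex \<Rightarrow> complex) \<Rightarrow> complex \<Rightarrow> complex \<Rightarrow> complex" where
  "weak_D \<Omega> f z v = Re v *\<^sub>R weak_deriv 1 \<Omega> f z + Im v *\<^sub>R weak_deriv \<i> \<Omega> f z"

definition weak_jacobian :: "complex set \<Rightarrow> (complex \<Rightarrow> complex) \<Rightarrow> complex \<Rightarrow> real" where
  "weak_jacobian \<Omega> f z = Re (weak_D \<Omega> f z 1) * Im (weak_D \<Omega> f z \<i>) - Re (weak_D \<Omega> f z \<i>) * Im (weak_D \<Omega> f z 1)"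


text \<open>Orientation is expressed by the local degree: the image of every positively oriented
  circle bounding a disk in \<open>\<Omega>\<close> winds once, positively, around the image of the centre.\<close>

definition orientation_preserving :: "complex set \<Rightarrow> (complex \<Rightarrow> complex) \<Rightarrow> bool" where
  "orientation_preserving \<Omega> f \<longleftrightarrow>
     (\<forall>z r. 0 < r \<and> cball z r \<subseteq> \<Omega> \<longrightarrow> winding_number (f \<circ> circlepath z r) (f z) = 1)"

definition op_homeomorphism :: "complex set \<Rightarrow> complex set \<Rightarrow> (complex \<Rightarrow> complex) \<Rightarrow> bool" where
  "op_homeomorphism \<Omega> \<Omega>' f \<longleftrightarrow> planar_domain \<Omega> \<and> planar_domain \<Omega>' \<and>
     (\<exists>g. homeomorphism \<Omega> \<Omega>' f g) \<and> orientation_preserving \<Omega> f"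

definition quasiconformal :: "real \<Rightarrow> complex set \<Rightarrow> complex set \<Rightarrow> (complex \<Rightarrow> complex) \<Rightarrow> bool" where
  "quasiconformal K \<Omega> \<Omega>' f \<longleftrightarrow> op_homeomorphism \<Omega> \<Omega>' f \<and> sobolev_loc 2 \<Omega> f \<and>
     (AE z in lebesgue_on \<Omega>. (onorm (weak_D \<Omega> f z))\<^sup>2 \<le> K * weak_jacobian \<Omega> f z)"

definition distortion_bound :: "complex set \<Rightarrow> (complex \<Rightarrow> complex) \<Rightarrow> (complex \<Rightarrow> ereal) \<Rightarrow> bool" where
  "distortion_bound \<Omega> f k \<longleftrightarrow> k \<in> borel_measurable (lebesgue_on \<Omega>) \<and> (\<forall>z\<in>\<Omega>. 1 \<le> k z) \<and>
     (AE z in lebesgue_on \<Omega>. k z < \<infinity>) \<and>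
     (AE z in lebesgue_on \<Omega>. ereal ((onorm (weak_D \<Omega> f z))\<^sup>2) \<le> k z * ereal (weak_jacobian \<Omega> f z))"

definition finite_distortion :: "complex set \<Rightarrow> complex set \<Rightarrow> (complex \<Rightarrow> complex) \<Rightarrow> bool" where
  "finite_distortion \<Omega> \<Omega>' f \<longleftrightarrow> op_homeomorphism \<Omega> \<Omega>' f \<and> sobolev_loc 1 \<Omega> f \<and>
     Lp_loc 1 \<Omega> (weak_jacobian \<Omega> f) \<and> (\<exists>k. distortion_bound \<Omega> f k)"

text \<open>The distortion is the smallest bound; it is determined up to a null set.\<close>

definition is_distortion :: "complex set \<Rightarrow> (complex \<Rightarrow> complex) \<Rightarrow> (complex \<Rightarrow> ereal) \<Rightarrow> bool" where
  "is_distortion \<Omega> f k \<longleftrightarrow> distortion_bound \<Omega> f k \<and>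
     (\<forall>k'. distortion_bound \<Omega> f k' \<longrightarrow> (AE z in lebesgue_on \<Omega>. k z \<le> k' z))"

definition p_integrable_distortion :: "real \<Rightarrow> (complex \<Rightarrow> complex) \<Rightarrow> bool" where
  "p_integrable_distortion p f \<longleftrightarrow> finite_distortion UNIV UNIV f \<and>
     (\<exists>k. is_distortion UNIV f k \<and> Lp_loc p UNIV (\<lambda>z. real_of_ereal (k z)))"


definition weak_starlike :: "complex set \<Rightarrow> bool" where
  "weak_starlike \<Omega> \<longleftrightarrow> planar_domain \<Omega> \<and>
     (\<forall>z\<in>frontier \<Omega>. \<forall>x\<in>frontier \<Omega>. \<exists>w\<in>\<Omega>.
        closed_segment w z \<subseteq> closure \<Omega> \<and> closed_segment w x \<subseteq> closure \<Omega>)"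

definition bi_lipschitz :: "real \<Rightarrow> (complex \<Rightarrow> complex) \<Rightarrow> bool" where
  "bi_lipschitz L g \<longleftrightarrow> (\<exists>h. homeomorphism UNIV UNIV g h) \<and>
     (\<forall>a b. 1 / L * cmod (a - b) \<le> cmod (g a - g b) \<and> cmod (g a - g b) \<le> L * cmod (a - b))"


text \<open>\<open>diam(U)^t\<close> with the conventions \<open>diam(\<emptyset>)^t = 0\<close> and \<open>diam(U)^0 = 1\<close> for nonempty \<open>U\<close>
  (whereas \<open>0 powr 0 = 0\<close>), so that \<open>t = 0\<close> gives the counting measure.\<close>

definition diam_pow :: "real \<Rightarrow> 'a::metric_space set \<Rightarrow> ennreal" where
  "diam_pow t U = (if U = {} then 0 else if t = 0 then 1 else ennreal (diameter U powr t))"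

text \<open>Boundedness of the covering sets must be required: \<^const>\<open>diameter\<close> is real-valued
  and meaningless on unbounded sets.\<close>

definition hausdorff_content :: "real \<Rightarrow> real \<Rightarrow> 'a::metric_space set \<Rightarrow> ennreal" where
  "hausdorff_content \<delta> t A =
     (INF U \<in> {U :: nat \<Rightarrow> 'a set. A \<subseteq> (\<Union>i. U i) \<and> (\<forall>i. bounded (U i) \<and> diameter (U i) \<le> \<delta>)}.
        (\<Sum>i. diam_pow t (U i)))"

definition hausdorff_measure :: "real \<Rightarrow> 'a::metric_space set \<Rightarrow> ennreal" where
  "hausdorff_measure t A = (SUP \<delta>\<in>{0<..}. hausdorff_content \<delta> t A)"

definition hausdorff_dim :: "'a::metric_space set \<Rightarrow> ereal" where
  "hausdorff_dim A = (INF t \<in> {t. 0 \<le> t \<and> hausdorff_measure t A = 0}. ereal t)"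

end

theory Submission
  imports Defs
begin

text \<open>The exponent \<open>2K\<close> is a length-area estimate inside the disk: a connected subset of the closed disk
  of diameter \<open>r\<close> is joined to a fixed scale by circular arcs followed by radii filling almost a half
  plane, so its image has diameter at least \<open>r\<^sup>2\<^sup>K\<close> up to an arbitrarily small loss in the exponent.
  This excludes interior points of \<open>A\<close> and lets one replace the second point by a boundary point \<open>w\<close>.

  If \<open>f z\<close> and \<open>f w\<close> are at distance \<open>d\<close> much smaller than \<open>r\<^sup>2\<^sup>K\<close>, where \<open>r = |z - w|\<close>, the two segments
  from the common centre given by weak starlikeness run nearly parallel for a length about \<open>r\<^sup>2\<^sup>K\<close>.
  By the first estimate their initial pieces pull back to small neighbourhoods of \<open>z\<close> and \<open>w\<close>, so every
  circle about \<open>z\<close> of radius comparable to \<open>r\<close> is mapped across each of about \<open>r\<^sup>2\<^sup>K/d\<close> disjoint balls of radius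
  about \<open>d\<close> placed along the segments. Each crossing costs \<open>c r\<^sup>2\<close> of the integral of the distortion,
  whence the integral of \<open>K\<^sub>f\<^sup>p\<close> over the ball of radius \<open>r\<close> about \<open>z\<close> is much larger than \<open>r\<^sup>s\<close>, and a
  Vitali covering gives measure zero in dimension \<open>s\<close>.

  Both estimates use only mollification, Cauchy-Schwarz, and the inequality \<open>\<integral> \<rho>(f) |J| \<le> \<integral> \<rho>\<close>, which holds
  for Sobolev homeomorphisms because they are differentiable relative to countably many sets that
  exhaust the plane up to a null set.\<close>


subsection \<open>Smooth mollifiers\<close>

text \<open>The exponent 2K comes from comparing angles. The image side of the length-area estimate
  is charged with the full logarithmic energy, about 2 pi ln (1/\<delta>), since nothing restricts
  the angles seen from a boundary point of the image; the domain side has opening 2 \<Phi> < pi. A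
  compression exponent K' then needs \<Phi> <= pi K / K', which a choice of \<Phi> below pi/2
  contradicts as soon as K' > 2K.

  Outside the disk the map is only known to be a Sobolev homeomorphism with integrable distortion.
  Therefore lower bounds are proved for C1 functions near a composition S o f and handed on to the
  weak gradient, and the area formula appears as an inequality that ignores the image of a null set.

  Exponents: let a = 2K + (2 - s + \<epsilon>)/p and 2K < K' < a. About r^(K' - a) crossings at cost
  r^2 bound the integral of the distortion below by r^(2 - \<beta>) with \<beta> = a - K'. For p-th
  powers the exponent becomes 2 - \<beta> p, and K' is placed so that this is s - \<epsilon>/2. The
  gap \<epsilon>/2 below s makes the density of dimension s infinite.\<close>

definition flat_exp :: "nat \<Rightarrow> real \<Rightarrow> real" where
  "flat_exp m t = (if t > 0 then exp (- (1 / t)) / t ^ m else 0)"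

lemma flat_exp_nonneg [simp]: "0 \<le> flat_exp m t"
  by (simp add: flat_exp_def)

text \<open>A single term of the exponential series at 1/t already dominates, so the function
  vanishes to every order at 0.\<close>

lemma flat_exp_le:
  assumes "0 < t"
  shows "flat_exp m t \<le> fact (m + k) * t ^ k"
proof -
  have "(1 / t) ^ (m + k) / fact (m + k) \<le> exp (1 / t)"
  proof -
    have "(1 / t) ^ (m + k) /\<^sub>R fact (m + k) \<le> (\<Sum>n. (1 / t) ^ n /\<^sub>R fact n)"
      using sum_le_suminf[OF summable_exp_generic[of "1/t"], of "{m + k}"] assms
      by (simp add: divide_inverse)
    then show ?thesis
      by (simp add: exp_def divide_inverse mult.commute)
  qed
  then have "exp (- (1 / t)) \<le> fact (m + k) * t ^ (m + k)"
    using assms by (simp add: exp_minus field_simps)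
  then show ?thesis
    using assms by (simp add: flat_exp_def field_simps power_add)
qed

lemma flat_exp_has_derivative:
  "(flat_exp m has_real_derivative (flat_exp (m + 2) t - m * flat_exp (m + 1) t)) (at t)"
proof -
  consider "t > 0" | "t < 0" | "t = 0" by linarith
  then show ?thesis
  proof cases
    case 1
    have "((\<lambda>t. exp (- (1 / t)) / t ^ m) has_real_derivative (flat_exp (m + 2) t - m * flat_exp (m + 1) t)) (at t)"
    proof (cases m)
      case 0
      with 1 show ?thesis
        by (auto intro!: derivative_eq_intros simp: flat_exp_def power2_eq_square)
    next
      case (Suc k)
      have *: "exp (- (1/t)) * (1/(t*t)) * t ^ m - exp (- (1/t)) * (real m * t ^ (m - 1))
          = (exp (- (1/t)) / t ^ (m+2) - m * (exp (- (1/t)) / t ^ (m+1))) * (t ^ m * t ^ m)"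
        using 1 Suc by (simp add: field_simps)
      have "((\<lambda>t. exp (- (1 / t)) / t ^ m) has_real_derivative
          (exp (- (1/t)) * (1/(t*t)) * t ^ m - exp (- (1/t)) * (real m * t ^ (m - 1))) / (t ^ m * t ^ m)) (at t)"
        using 1 by (auto intro!: derivative_eq_intros)
      then show ?thesis
        unfolding * using 1 by (simp add: flat_exp_def)
    qed
    then show ?thesis
      by (rule has_field_derivative_transform_within[where d=t])
         (use 1 in \<open>auto simp: flat_exp_def dist_real_def\<close>)
  next
    case 2
    have "((\<lambda>t. 0) has_real_derivative (flat_exp (m + 2) t - m * flat_exp (m + 1) t)) (at t)"
      using 2 by (simp add: flat_exp_def)
    then show ?thesis
      by (rule has_field_derivative_transform_within[where d="-t"])
         (use 2 in \<open>auto simp: flat_exp_def dist_real_def\<close>)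
  next
    case 3
    have "((\<lambda>h. flat_exp m h / h) \<longlongrightarrow> 0) (at 0)"
    proof (rule Lim_null_comparison)
      \<comment> \<open>Decay of order two leaves one factor h after division, so the difference
        quotient at 0 tends to 0.\<close>
      have "norm (flat_exp m h / h) \<le> fact (m + 2) * \<bar>h\<bar>" for h :: real
      proof (cases "h > 0")
        case True
        then show ?thesis
          using flat_exp_le[of h m 2] by (simp add: divide_simps power2_eq_square mult.assoc)
      next
        case False
        then have "flat_exp m h = 0" by (simp add: flat_exp_def)
        then show ?thesis by simp
      qed
      then show "\<forall>\<^sub>F h in at 0. norm (flat_exp m h / h) \<le> fact (m + 2) * \<bar>h\<bar>"
        by simp
      show "((\<lambda>h::real. fact (m + 2) * \<bar>h\<bar>) \<longlongrightarrow> 0) (at 0)"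
        by (intro tendsto_mult_right_zero tendsto_rabs_zero) (rule tendsto_ident_at)
    qed
    then show ?thesis
      using 3 by (simp add: DERIV_def flat_exp_def)
  qed
qed

text \<open>\<open>C_k\<close> asks for continuous partial derivatives of every order. A class of
  functions closed under both coordinate partials reduces this to one induction;
  \<open>flat_exp\<close> carries an index because differentiation raises it.\<close>

inductive smooth_class :: "(complex \<Rightarrow> real) \<Rightarrow> bool" where
  const: "smooth_class (\<lambda>_. c)"
| Re: "smooth_class Re"
| Im: "smooth_class Im"
| add: "smooth_class u \<Longrightarrow> smooth_class v \<Longrightarrow> smooth_class (\<lambda>z. u z + v z)"
| mult: "smooth_class u \<Longrightarrow> smooth_class v \<Longrightarrow> smooth_class (\<lambda>z. u z * v z)"
| flat: "smooth_class u \<Longrightarrow> smooth_class (\<lambda>z. flat_exp m (u z))"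

lemma smooth_class_reflect:
  "smooth_class u \<Longrightarrow> smooth_class (\<lambda>z. u (x - z))"
proof (induction rule: smooth_class.induct)
  case Re
  show ?case
    using smooth_class.add[OF smooth_class.const[of "Re x"] smooth_class.mult[OF smooth_class.const[of "-1"] smooth_class.Re]]
    by simp
next
  case Im
  show ?case
    using smooth_class.add[OF smooth_class.const[of "Im x"] smooth_class.mult[OF smooth_class.const[of "-1"] smooth_class.Im]]
    by simp
qed (auto intro: smooth_class.intros)

lemma smooth_class_has_derivative:
  "smooth_class u \<Longrightarrow> \<exists>ux uy. smooth_class ux \<and> smooth_class uy \<and>
     (\<forall>z. (u has_derivative (\<lambda>v. Re v * ux z + Im v * uy z)) (at z))"
proof (induction rule: smooth_class.induct)
  case (const c)
  show ?case
    by (rule exI[of _ "\<lambda>_. 0"], rule exI[of _ "\<lambda>_. 0"]) (auto intro: smooth_class.const)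
next
  case Re
  show ?case
    by (rule exI[of _ "\<lambda>_. 1"], rule exI[of _ "\<lambda>_. 0"])
       (auto intro!: smooth_class.const derivative_eq_intros)
next
  case Im
  show ?case
    by (rule exI[of _ "\<lambda>_. 0"], rule exI[of _ "\<lambda>_. 1"])
       (auto intro!: smooth_class.const derivative_eq_intros)
next
  case (add u v)
  then obtain ux uy vx vy where *: "smooth_class ux" "smooth_class uy" "smooth_class vx" "smooth_class vy"
    "\<And>z. (u has_derivative (\<lambda>w. Re w * ux z + Im w * uy z)) (at z)"
    "\<And>z. (v has_derivative (\<lambda>w. Re w * vx z + Im w * vy z)) (at z)" by blast
  show ?case
    by (rule exI[of _ "\<lambda>z. ux z + vx z"], rule exI[of _ "\<lambda>z. uy z + vy z"])
       (auto intro!: smooth_class.add * derivative_eq_intros simp: algebra_simps)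
next
  case (mult u v)
  then obtain ux uy vx vy where *: "smooth_class ux" "smooth_class uy" "smooth_class vx" "smooth_class vy"
    "\<And>z. (u has_derivative (\<lambda>w. Re w * ux z + Im w * uy z)) (at z)"
    "\<And>z. (v has_derivative (\<lambda>w. Re w * vx z + Im w * vy z)) (at z)" by blast
  show ?case
    by (rule exI[of _ "\<lambda>z. u z * vx z + ux z * v z"], rule exI[of _ "\<lambda>z. u z * vy z + uy z * v z"])
       (auto intro!: smooth_class.add smooth_class.mult * mult.hyps derivative_eq_intros simp: algebra_simps)
next
  case (flat u m)
  then obtain ux uy where *: "smooth_class ux" "smooth_class uy"
    "\<And>z. (u has_derivative (\<lambda>w. Re w * ux z + Im w * uy z)) (at z)" by blast
  define e where "e z = flat_exp (m + 2) (u z) + (- real m) * flat_exp (m + 1) (u z)" for z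
  have e: "smooth_class e"
    unfolding e_def by (intro smooth_class.intros flat.hyps)
  have "((\<lambda>z. flat_exp m (u z)) has_derivative (\<lambda>v. Re v * (e z * ux z) + Im v * (e z * uy z))) (at z)" for z
    using has_derivative_compose[OF *(3)[of z] flat_exp_has_derivative[of m "u z", unfolded has_field_derivative_def]]
    by (rule has_derivative_eq_rhs) (auto simp: e_def algebra_simps fun_eq_iff)
  then show ?case
    using smooth_class.mult[OF e *(1)] smooth_class.mult[OF e *(2)] by blast
qed

lemma smooth_class_continuous: "smooth_class u \<Longrightarrow> continuous_on S u"
  using smooth_class_has_derivative[of u]
  by (meson continuous_at_imp_continuous_on has_derivative_continuous)

lemma smooth_class_C_k: "smooth_class u \<Longrightarrow> C_k n u"
proof (induction n arbitrary: u)
  case 0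
  then show ?case by (simp add: smooth_class_continuous)
next
  case (Suc n)
  obtain ux uy where *: "smooth_class ux" "smooth_class uy"
    "\<And>z. (u has_derivative (\<lambda>w. Re w * ux z + Im w * uy z)) (at z)"
    using smooth_class_has_derivative[OF Suc.prems] by blast
  have "frechet_derivative u (at z) = (\<lambda>w. Re w * ux z + Im w * uy z)" for z
    using frechet_derivative_at[OF *(3)] by metis
  then show ?case
    using * Suc.IH by (auto simp: differentiable_def intro: *(3))
qed

text \<open>The standard bump exp (-1 / (1 - |z|^2/h^2)) on the disk of radius h, extended by
  zero.\<close>

definition bump :: "real \<Rightarrow> complex \<Rightarrow> real" where
  "bump h z = flat_exp 0 (1 - (cmod z / h)\<^sup>2)"

definition mollifier :: "real \<Rightarrow> complex \<Rightarrow> real" where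
  "mollifier h z = bump h z / (\<integral>w. bump h w \<partial>lborel)"

lemma bump_eq:
  "bump h = (\<lambda>z. flat_exp 0 (1 + (- inverse (h\<^sup>2)) * (Re z * Re z + Im z * Im z)))"
proof
  fix z
  have "(cmod z / h)\<^sup>2 = inverse (h\<^sup>2) * (Re z * Re z + Im z * Im z)"
    unfolding power_divide cmod_power2 by (simp add: power2_eq_square divide_inverse)
  then show "bump h z = flat_exp 0 (1 + (- inverse (h\<^sup>2)) * (Re z * Re z + Im z * Im z))"
    by (simp add: bump_def)
qed

lemma smooth_class_mollifier: "smooth_class (mollifier h)"
proof -
  have "mollifier h = (\<lambda>z. inverse (\<integral>w. bump h w \<partial>lborel) *
      flat_exp 0 (1 + (- inverse (h\<^sup>2)) * (Re z * Re z + Im z * Im z)))"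
    unfolding mollifier_def bump_eq by (simp add: fun_eq_iff divide_inverse mult.commute)
  moreover have "smooth_class \<dots>"
    by (intro smooth_class.intros)
  ultimately show ?thesis by simp
qed

lemma bump_nonneg: "0 \<le> bump h z"
  by (simp add: bump_def)

lemma bump_eq_0: "0 < h \<Longrightarrow> h \<le> cmod z \<Longrightarrow> bump h z = 0"
  by (auto simp: bump_def flat_exp_def power_divide divide_simps power_mono not_less)

lemma bump_le: "bump h z \<le> exp (-1)"
proof -
  have "1 \<le> 1 / (1 - t)" if "0 < 1 - t" "0 \<le> t" for t :: real
    using that by (simp add: divide_simps)
  from this[of "(cmod z / h)\<^sup>2"] show ?thesis
    by (auto simp: bump_def flat_exp_def)
qed

lemma continuous_on_bump [continuous_intros]: "continuous_on S (bump h)"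
  unfolding bump_eq by (intro smooth_class_continuous smooth_class.intros)

lemma measure_lborel_ball_complex:
  "0 \<le> r \<Longrightarrow> measure lborel (ball (c::complex) r) = pi * r\<^sup>2"
  "0 \<le> r \<Longrightarrow> emeasure lborel (ball (c::complex) r) = ennreal (pi * r\<^sup>2)"
  using content_ball[of r c] emeasure_ball[of r c]
  by (simp_all add: unit_ball_vol_2 DIM_complex)

lemma integrable_compact_support:
  fixes f :: "complex \<Rightarrow> 'b::euclidean_space"
  assumes "continuous_on UNIV f" "\<And>z. z \<notin> cball c r \<Longrightarrow> f z = 0"
  shows "integrable lborel f"
proof -
  have "set_integrable lborel (cball c r) f"
    unfolding set_integrable_def
    by (rule borel_integrable_compact) (use assms in \<open>auto intro: continuous_on_subset\<close>)
  moreover have "(\<lambda>x. indicator (cball c r) x *\<^sub>R f x) = f"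
    using assms(2) by (auto simp: indicator_def fun_eq_iff)
  ultimately show ?thesis by (simp add: set_integrable_def)
qed

lemma integrable_bump: "0 < h \<Longrightarrow> integrable lborel (bump h)"
  by (rule integrable_compact_support[where c=0 and r=h])
     (auto intro: continuous_on_bump bump_eq_0)

text \<open>On the disk of radius h/2 the bump is at least exp (-4/3), so its integral is at least
  exp (-4/3) pi h^2/4. The constant 3e is chosen so that, together with the maximum exp (-1), the
  normalised kernel is at most 3/h^2.\<close>

lemma integral_bump_ge:
  assumes "0 < h"
  shows "h\<^sup>2 / (3 * exp 1) \<le> (\<integral>w. bump h w \<partial>lborel)"
proof -
  have "bump h z \<ge> exp (- (4/3))" if "cmod z < h / 2" for z
  proof -
    have "(cmod z / h)\<^sup>2 \<le> (1/2)\<^sup>2"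
      using that assms by (intro power_mono) (auto simp: divide_simps)
    then have *: "1 - (cmod z / h)\<^sup>2 \<ge> 3/4"
      by (simp add: power2_eq_square)
    then have "1 / (1 - (cmod z / h)\<^sup>2) \<le> 4/3"
      by (simp add: divide_simps)
    with * show ?thesis
      by (simp add: bump_def flat_exp_def)
  qed
  then have le: "exp (-(4/3)) * indicator (ball 0 (h/2)) z \<le> bump h z" for z
    by (auto simp: indicator_def bump_nonneg)
  have "(\<integral>w. exp (-(4/3)) * indicator (ball (0::complex) (h/2)) w \<partial>lborel) \<le> (\<integral>w. bump h w \<partial>lborel)"
    by (rule integral_mono[OF _ integrable_bump[OF assms] le])
       (auto intro!: integrable_mult_right integrable_real_indicator simp: measure_lborel_ball_complex assms less_imp_le)
  moreover have "(\<integral>w. exp (-(4/3)) * indicator (ball (0::complex) (h/2)) w \<partial>lborel) = exp (-(4/3)) * (pi * (h/2)\<^sup>2)"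
    using assms by (simp add: measure_lborel_ball_complex)
  moreover have "exp (-(4/3)) * (pi * (h/2)\<^sup>2) \<ge> h\<^sup>2 / (3 * exp 1)"
  proof -
    have "exp (4/3::real) = exp 1 * exp (1/3)"
      by (simp add: exp_add[symmetric])
    moreover have "exp (1/3::real) \<le> 2"
      using exp_bound_half[of "1/3::real"] by simp
    ultimately have "4 * exp (4/3::real) \<le> 3 * exp 1 * pi"
      using pi_gt3 mult_mono[of "4 * exp (1/3::real)" "3 * pi" "exp (1::real)" "exp 1"] by (simp add: algebra_simps)
    then have "1 / (3 * exp 1) \<le> exp (-(4/3)) * pi / 4"
      by (simp add: exp_minus divide_simps mult.commute)
    from mult_left_mono[OF this, of "h\<^sup>2"] show ?thesis
      by (simp add: power_divide algebra_simps)
  qed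
  ultimately show ?thesis by linarith
qed

lemma mollifier_nonneg: "0 < h \<Longrightarrow> 0 \<le> mollifier h z"
  by (simp add: mollifier_def bump_nonneg)

lemma mollifier_eq_0: "0 < h \<Longrightarrow> h \<le> cmod z \<Longrightarrow> mollifier h z = 0"
  by (simp add: mollifier_def bump_eq_0)

lemma integral_mollifier: "0 < h \<Longrightarrow> (\<integral>w. mollifier h w \<partial>lborel) = 1"
  using integral_bump_ge[of h] by (auto simp: mollifier_def field_simps)

lemma mollifier_le:
  assumes "0 < h" shows "mollifier h z \<le> 3 / h\<^sup>2"
proof -
  have "mollifier h z \<le> exp (-1) / (h\<^sup>2 / (3 * exp 1))"
    unfolding mollifier_def
    by (rule frac_le) (use bump_le[of h z] integral_bump_ge[OF assms] assms in auto)
  also have "\<dots> = 3 / h\<^sup>2"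
    using assms by (simp add: exp_minus field_simps)
  finally show ?thesis .
qed

lemma continuous_on_mollifier: "continuous_on S (mollifier h)"
  by (rule smooth_class_continuous[OF smooth_class_mollifier])

lemma mollifier_measurable [measurable]: "mollifier h \<in> borel_measurable borel"
  by (rule borel_measurable_continuous_onI[OF continuous_on_mollifier])

lemma mollifier_even: "mollifier h (- z) = mollifier h z"
  by (simp add: mollifier_def bump_def)

lemma test_function_mollifier:
  assumes "0 < h" "cball x h \<subseteq> \<Omega>"
  shows "test_function \<Omega> (\<lambda>y. mollifier h (x - y))"
proof -
  have "closure {y. mollifier h (x - y) \<noteq> 0} \<subseteq> cball x h"
    by (rule closure_minimal) (use mollifier_eq_0[OF assms(1)] in \<open>auto simp: dist_norm intro: ccontr\<close>)
  moreover from this have "compact (closure {y. mollifier h (x - y) \<noteq> 0})"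
    by (meson bounded_cball bounded_subset closed_closure compact_eq_bounded_closed)
  ultimately show ?thesis
    using smooth_class_C_k[OF smooth_class_reflect[OF smooth_class_mollifier]] assms(2)
    unfolding test_function_def by blast
qed

subsection \<open>Change of variables and polar coordinates in the plane\<close>

text \<open>Change of variables with values in [0, infinity]. If the Jacobian integral diverges, the
  image has infinite measure, since finite measure would make the Jacobian integrable.\<close>

lemma emeasure_differentiable_image:
  fixes f :: "real^'n::{finite,wellorder} \<Rightarrow> real^'n::_"
  assumes S: "S \<in> sets lebesgue"
    and der: "\<And>x. x \<in> S \<Longrightarrow> (f has_derivative f' x) (at x within S)"
    and inj: "inj_on f S"
    and J: "J \<in> borel_measurable lebesgue" "\<And>x. x \<in> S \<Longrightarrow> J x = \<bar>det (matrix (f' x))\<bar>"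
  shows "emeasure lebesgue (f ` S) = (\<integral>\<^sup>+x. ennreal (J x) * indicator S x \<partial>lebesgue)"
proof -
  have fS: "f ` S \<in> sets lebesgue"
    by (rule differentiable_image_in_sets_lebesgue[OF S])
       (use der in \<open>auto simp: differentiable_on_def differentiable_def\<close>)
  define m where "m x = J x * indicat_real S x" for x
  have m: "m \<in> borel_measurable lebesgue"
    unfolding m_def using J(1) S by measurable
  have m0: "0 \<le> m x" for x
    using J(2) by (auto simp: m_def indicator_def)
  have nn: "(\<integral>\<^sup>+x. ennreal (J x) * indicator S x \<partial>lebesgue) = (\<integral>\<^sup>+x. ennreal (m x) \<partial>lebesgue)"
    by (intro nn_integral_cong) (auto simp: m_def indicator_def)
  have cong: "((\<lambda>x. \<bar>det (matrix (f' x))\<bar>) has_integral b) S \<longleftrightarrow> (m has_integral b) UNIV" for b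
  proof -
    have "((\<lambda>x. \<bar>det (matrix (f' x))\<bar>) has_integral b) S \<longleftrightarrow>
        ((\<lambda>x. if x \<in> S then \<bar>det (matrix (f' x))\<bar> else 0) has_integral b) UNIV"
      by (rule has_integral_restrict_UNIV[symmetric])
    also have "(\<lambda>x. if x \<in> S then \<bar>det (matrix (f' x))\<bar> else 0) = m"
      using J(2) by (auto simp: m_def fun_eq_iff)
    finally show ?thesis .
  qed
  show ?thesis
  proof (cases "(\<integral>\<^sup>+x. ennreal (m x) \<partial>lebesgue) < \<infinity>")
    case True
    then have int: "integrable lebesgue m"
      using m m0 by (intro integrableI_nonneg) auto
    then have "(m has_integral (\<integral>x. m x \<partial>lebesgue)) UNIV"
      by (rule has_integral_integral_lebesgue)
    then have *: "f ` S \<in> lmeasurable \<and> measure lebesgue (f ` S) = (\<integral>x. m x \<partial>lebesgue)"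
      using has_measure_differentiable_image[OF S der inj] cong by blast
    then have "emeasure lebesgue (f ` S) = ennreal (measure lebesgue (f ` S))"
      by (metis emeasure_eq_measure2 fmeasurableD2 emeasure_eq_ennreal_measure)
    also have "\<dots> = (\<integral>\<^sup>+x. ennreal (m x) \<partial>lebesgue)"
      using * nn_integral_eq_integral[OF int] m0 by simp
    finally show ?thesis by (simp add: nn)
  next
    case False
    have "f ` S \<notin> lmeasurable"
    proof
      assume "f ` S \<in> lmeasurable"
      then obtain b where "(m has_integral b) UNIV"
        using has_measure_differentiable_image[OF S der inj] cong by blast
      then have "m absolutely_integrable_on UNIV"
        using m0 by (intro nonnegative_absolutely_integrable_1) (auto simp: integrable_on_def)
      then have "integrable lebesgue m"
        by (simp add: set_integrable_def)
      then have "(\<integral>\<^sup>+x. ennreal (norm (m x)) \<partial>lebesgue) < \<infinity>"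
        by (simp add: integrable_iff_bounded)
      then show False using False m0 by simp
    qed
    then have "emeasure lebesgue (f ` S) = \<infinity>"
      using fS by (metis fmeasurableI infinity_ennreal_def top.not_eq_extremum)
    then show ?thesis
      using False nn by (metis infinity_ennreal_def top.not_eq_extremum)
  qed
qed

section \<open>Transfer of the change of variables from real^2 to the complex plane\<close>

definition vec_of_complex :: "complex \<Rightarrow> real^2" where
  "vec_of_complex z = vector [Re z, Im z]"

definition complex_of_vec :: "real^2 \<Rightarrow> complex" where
  "complex_of_vec v = Complex (v $ 1) (v $ 2)"

lemma complex_vec_inverse [simp]:
  "complex_of_vec (vec_of_complex z) = z" "vec_of_complex (complex_of_vec v) = v"
  by (simp_all add: vec_of_complex_def complex_of_vec_def vec_eq_iff forall_2)

lemma vec_of_complex_nth [simp]: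
  "vec_of_complex z $ 1 = Re z" "vec_of_complex z $ 2 = Im z"
  by (simp_all add: vec_of_complex_def)

lemma bounded_linear_vec_of_complex: "bounded_linear vec_of_complex"
  by (rule linear_conv_bounded_linear[THEN iffD1], rule linearI)
     (simp_all add: vec_eq_iff forall_2)

lemma bounded_linear_complex_of_vec: "bounded_linear complex_of_vec"
  by (rule linear_conv_bounded_linear[THEN iffD1], rule linearI)
     (simp_all add: complex_of_vec_def complex_eq_iff)

lemma vec_of_complex_measurable [measurable]: "vec_of_complex \<in> borel_measurable borel"
  by (intro borel_measurable_continuous_onI linear_continuous_on bounded_linear_vec_of_complex)

lemma complex_of_vec_measurable [measurable]: "complex_of_vec \<in> borel_measurable borel"
  by (intro borel_measurable_continuous_onI linear_continuous_on bounded_linear_complex_of_vec)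

lemma lborel_distr_vec_of_complex: "distr lborel borel vec_of_complex = lborel"
proof (rule lborel_eqI[symmetric])
  fix l u :: "real^2"
  assume le: "\<And>b. b \<in> Basis \<Longrightarrow> l \<bullet> b \<le> u \<bullet> b"
  have le': "l $ 1 \<le> u $ 1" "l $ 2 \<le> u $ 2"
    using le[of "axis 1 1"] le[of "axis 2 1"] by (auto simp: inner_axis axis_in_Basis_iff)
  have "vec_of_complex -` box l u = box (complex_of_vec l) (complex_of_vec u)"
  proof (rule set_eqI)
    fix z
    have "vec_of_complex z \<in> box l u \<longleftrightarrow> l $ 1 < Re z \<and> Re z < u $ 1 \<and> l $ 2 < Im z \<and> Im z < u $ 2"
      by (auto simp: mem_box_cart forall_2)
    also have "\<dots> \<longleftrightarrow> z \<in> box (complex_of_vec l) (complex_of_vec u)"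
      by (auto simp: box_def Basis_complex_def complex_of_vec_def)
    finally show "z \<in> vec_of_complex -` box l u \<longleftrightarrow> z \<in> box (complex_of_vec l) (complex_of_vec u)"
      by simp
  qed
  then have "emeasure (distr lborel borel vec_of_complex) (box l u)
      = emeasure lborel (box (complex_of_vec l) (complex_of_vec u))"
    by (simp add: emeasure_distr)
  also have "\<dots> = ennreal (\<Prod>b\<in>Basis. (complex_of_vec u - complex_of_vec l) \<bullet> b)"
    by (rule emeasure_lborel_box) (use le' in \<open>auto simp: Basis_complex_def complex_of_vec_def\<close>)
  also have "(\<Prod>b\<in>Basis. (complex_of_vec u - complex_of_vec l) \<bullet> b) = (\<Prod>b\<in>Basis. (u - l) \<bullet> b)"
  proof -
    have "(\<Prod>b\<in>Basis. (u - l) \<bullet> b) = (\<Prod>i\<in>UNIV. (u - l) $ i)"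
      unfolding Basis_vec_def
      by (simp add: UNION_singleton_eq_range prod.reindex inj_on_def axis_eq_axis inner_axis)
    then show ?thesis
      by (simp add: UNIV_2 Basis_complex_def complex_of_vec_def)
  qed
  finally show "emeasure (distr lborel borel vec_of_complex) (box l u) = (\<Prod>b\<in>Basis. (u - l) \<bullet> b)" .
qed simp

lemma nn_integral_complex_of_vec:
  assumes [measurable]: "F \<in> borel_measurable borel"
  shows "(\<integral>\<^sup>+v. F (complex_of_vec v) \<partial>lborel) = (\<integral>\<^sup>+z. F z \<partial>lborel)"
  by (subst lborel_distr_vec_of_complex[symmetric]) (simp add: nn_integral_distr)

lemma emeasure_vec_of_complex_image:
  assumes "X \<in> sets borel"
  shows "emeasure lborel (vec_of_complex ` X) = emeasure lborel X" "vec_of_complex ` X \<in> sets borel"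
proof -
  have eq: "vec_of_complex ` X = complex_of_vec -` X \<inter> space borel"
    by (auto simp: image_iff) (metis complex_vec_inverse(2))
  show "vec_of_complex ` X \<in> sets borel"
    unfolding eq using assms by measurable
  then show "emeasure lborel (vec_of_complex ` X) = emeasure lborel X"
    by (subst lborel_distr_vec_of_complex[symmetric])
       (simp add: emeasure_distr eq vimage_comp comp_def)
qed

definition real_det :: "(complex \<Rightarrow> complex) \<Rightarrow> real" where
  "real_det T = Re (T 1) * Im (T \<i>) - Re (T \<i>) * Im (T 1)"

lemma emeasure_differentiable_image_complex:
  fixes g :: "complex \<Rightarrow> complex"
  assumes S: "S \<in> sets borel" and gS: "g ` S \<in> sets borel"
    and der: "\<And>x. x \<in> S \<Longrightarrow> (g has_derivative g' x) (at x within S)"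
    and inj: "inj_on g S"
    and J [measurable]: "J \<in> borel_measurable borel" and J2: "\<And>x. x \<in> S \<Longrightarrow> J x = \<bar>real_det (g' x)\<bar>"
  shows "emeasure lborel (g ` S) = (\<integral>\<^sup>+x. ennreal (J x) * indicator S x \<partial>lborel)"
proof -
  note S [measurable]
  define S2 where "S2 = vec_of_complex ` S"
  define G where "G = vec_of_complex \<circ> g \<circ> complex_of_vec"
  define G' where "G' v = vec_of_complex \<circ> g' (complex_of_vec v) \<circ> complex_of_vec" for v
  have S2: "S2 \<in> sets borel"
    unfolding S2_def by (rule emeasure_vec_of_complex_image(2)[OF S])
  have mem: "v \<in> S2 \<longleftrightarrow> complex_of_vec v \<in> S" for v
    by (auto simp: S2_def image_iff) (metis complex_vec_inverse(2))
  have GS: "G ` S2 = vec_of_complex ` (g ` S)"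
    by (auto simp: G_def S2_def image_iff)
  have derG: "(G has_derivative G' v) (at v within S2)" if "v \<in> S2" for v
  proof -
    have 1: "(complex_of_vec has_derivative complex_of_vec) (at v within S2)"
      by (rule bounded_linear_imp_has_derivative[OF bounded_linear_complex_of_vec])
    have "complex_of_vec ` S2 = S"
      by (auto simp: S2_def image_image)
    then have "(g has_derivative g' (complex_of_vec v)) (at (complex_of_vec v) within complex_of_vec ` S2)"
      using der that mem by auto
    from diff_chain_within[OF 1 this]
    have "((g \<circ> complex_of_vec) has_derivative (g' (complex_of_vec v) \<circ> complex_of_vec)) (at v within S2)" .
    from diff_chain_within[OF this bounded_linear_imp_has_derivative[OF bounded_linear_vec_of_complex]]
    show ?thesis by (simp add: G_def G'_def comp_assoc)
  qed
  have injG: "inj_on G S2"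
    by (rule inj_onI) (metis G_def comp_apply complex_vec_inverse inj inj_onD mem)
  have ax: "complex_of_vec (axis 1 1) = 1" "complex_of_vec (axis 2 1) = \<i>"
    by (simp_all add: complex_of_vec_def axis_def complex_eq_iff)
  have det: "det (matrix (G' v)) = real_det (g' (complex_of_vec v))" for v
    by (simp add: det_2 matrix_def G'_def ax real_det_def)
  have "emeasure lborel (g ` S) = emeasure lebesgue (G ` S2)"
    unfolding GS using emeasure_vec_of_complex_image[OF gS] by (simp add: emeasure_completion)
  also have "\<dots> = (\<integral>\<^sup>+v. ennreal (J (complex_of_vec v)) * indicator S2 v \<partial>lebesgue)"
  proof (rule emeasure_differentiable_image[where f'=G'])
    show "(\<lambda>v. J (complex_of_vec v)) \<in> borel_measurable lebesgue"
      by (rule measurable_completion) simp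
    show "J (complex_of_vec v) = \<bar>det (matrix (G' v))\<bar>" if "v \<in> S2" for v
      using that J2 mem by (simp add: det)
  qed (use S2 derG injG in auto)
  also have "\<dots> = (\<integral>\<^sup>+v. ennreal (J (complex_of_vec v)) * indicator S (complex_of_vec v) \<partial>lborel)"
    using mem by (simp add: nn_integral_completion indicator_def)
  also have "\<dots> = (\<integral>\<^sup>+x. ennreal (J x) * indicator S x \<partial>lborel)"
    by (rule nn_integral_complex_of_vec[where F="\<lambda>x. ennreal (J x) * indicator S x"]) measurable
  finally show ?thesis .
qed

text \<open>The image formula, applied to the part of S lying over a Borel set, says that the
  push-forward of J dx on S under g is Lebesgue measure on g(S). Integrating F against these equal
  measures gives the claim.\<close>

lemma nn_integral_change_of_variables_complex:
  fixes g :: "complex \<Rightarrow> complex"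
  assumes [measurable]: "S \<in> sets borel" "g ` S \<in> sets borel" "g \<in> borel_measurable borel"
    and der: "\<And>x. x \<in> S \<Longrightarrow> (g has_derivative g' x) (at x within S)"
    and inj: "inj_on g S"
    and J [measurable]: "J \<in> borel_measurable borel" and J2: "\<And>x. x \<in> S \<Longrightarrow> J x = \<bar>real_det (g' x)\<bar>"
    and F [measurable]: "F \<in> borel_measurable borel"
  shows "(\<integral>\<^sup>+x. F (g x) * (ennreal (J x) * indicator S x) \<partial>lborel) = (\<integral>\<^sup>+y. F y * indicator (g ` S) y \<partial>lborel)"
proof -
  have "distr (density lborel (\<lambda>x. ennreal (J x) * indicator S x)) borel g = density lborel (indicator (g ` S))"
  proof (rule measure_eqI)
    fix B assume "B \<in> sets (distr (density lborel (\<lambda>x. ennreal (J x) * indicator S x)) borel g)"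
    then have B [measurable]: "B \<in> sets borel" by simp
    have [measurable]: "g -` B \<in> sets borel"
      using measurable_sets[of g borel borel B] by simp
    have im: "g ` (S \<inter> g -` B) = g ` S \<inter> B" by auto
    have "emeasure (distr (density lborel (\<lambda>x. ennreal (J x) * indicator S x)) borel g) B
      = (\<integral>\<^sup>+x. ennreal (J x) * indicator (S \<inter> g -` B) x \<partial>lborel)"
      by (simp add: emeasure_distr emeasure_density indicator_inter_arith mult.assoc)
    also have "\<dots> = emeasure lborel (g ` (S \<inter> g -` B))"
      by (rule emeasure_differentiable_image_complex[symmetric, where g'=g'])
         (use der J2 inj in \<open>auto simp: im intro: has_derivative_subset inj_on_subset\<close>)
    also have "\<dots> = emeasure (density lborel (indicator (g ` S))) B"
      by (simp add: im emeasure_density indicator_inter_arith[symmetric])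
    finally show "emeasure (distr (density lborel (\<lambda>x. ennreal (J x) * indicator S x)) borel g) B
      = emeasure (density lborel (indicator (g ` S))) B" .
  qed simp
  then have "(\<integral>\<^sup>+x. F x \<partial>distr (density lborel (\<lambda>x. ennreal (J x) * indicator S x)) borel g)
     = (\<integral>\<^sup>+x. F x \<partial>density lborel (indicator (g ` S)))" by simp
  then show ?thesis
    by (simp add: nn_integral_distr nn_integral_density mult.commute)
qed

section \<open>Fubini in Cartesian and in polar coordinates\<close>

lemma lborel_complex_eq_distr: "distr (lborel \<Otimes>\<^sub>M lborel) borel (\<lambda>(x, y). Complex x y) = lborel"
proof (rule lborel_eqI[symmetric])
  have [measurable]: "(\<lambda>(x, y). Complex x y) \<in> borel_measurable (borel \<Otimes>\<^sub>M borel)"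
    unfolding borel_prod by (intro borel_measurable_continuous_onI) (auto intro!: continuous_intros simp: case_prod_beta)
  fix l u :: complex
  assume le: "\<And>b. b \<in> Basis \<Longrightarrow> l \<bullet> b \<le> u \<bullet> b"
  have le': "Re l \<le> Re u" "Im l \<le> Im u"
    using le[of 1] le[of \<i>] by (auto simp: Basis_complex_def)
  have "(\<lambda>(x, y). Complex x y) -` box l u = {Re l<..<Re u} \<times> {Im l<..<Im u}"
    by (auto simp: box_def Basis_complex_def)
  then show "emeasure (distr (lborel \<Otimes>\<^sub>M lborel) borel (\<lambda>(x, y). Complex x y)) (box l u) = (\<Prod>b\<in>Basis. (u - l) \<bullet> b)"
    using le' by (simp add: emeasure_distr space_pair_measure lborel.emeasure_pair_measure_Times Basis_complex_def
       ennreal_mult)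
qed simp

lemma nn_integral_lborel_complex:
  fixes F :: "complex \<Rightarrow> ennreal"
  assumes [measurable]: "F \<in> borel_measurable borel"
  shows "(\<integral>\<^sup>+z. F z \<partial>lborel) = (\<integral>\<^sup>+x. \<integral>\<^sup>+y. F (Complex x y) \<partial>lborel \<partial>lborel)"
proof -
  have [measurable]: "(\<lambda>(x, y). Complex x y) \<in> borel_measurable (borel \<Otimes>\<^sub>M borel)"
    unfolding borel_prod by (intro borel_measurable_continuous_onI) (auto intro!: continuous_intros simp: case_prod_beta)
  have "(\<integral>\<^sup>+z. F z \<partial>lborel) = (\<integral>\<^sup>+p. F (case p of (x, y) \<Rightarrow> Complex x y) \<partial>(lborel \<Otimes>\<^sub>M lborel))"
    by (subst lborel_complex_eq_distr[symmetric]) (simp add: nn_integral_distr)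
  also have "\<dots> = (\<integral>\<^sup>+x. \<integral>\<^sup>+y. F (Complex x y) \<partial>lborel \<partial>lborel)"
    by (subst lborel.nn_integral_fst[symmetric]) simp_all
  finally show ?thesis .
qed

text \<open>The open strip is mapped injectively onto the plane slit along the ray from p opposite
  to b, and the slit is null. The axis b is left free so that it can later point from p towards the
  origin.\<close>

lemma nn_integral_polar:
  fixes F :: "complex \<Rightarrow> ennreal" and p b :: complex
  assumes [measurable]: "F \<in> borel_measurable borel" and b: "cmod b = 1"
  shows "(\<integral>\<^sup>+z. F z \<partial>lborel) =
    (\<integral>\<^sup>+t. \<integral>\<^sup>+\<phi>. F (p + b * (of_real t * cis \<phi>)) * (ennreal t * indicator {0<..} t * indicator {-pi<..<pi} \<phi>) \<partial>lborel \<partial>lborel)"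
proof -
  define S where "S = {z. 0 < Re z \<and> - pi < Im z \<and> Im z < pi}"
  define g where "g z = p + b * (of_real (Re z) * cis (Im z))" for z
  define g' where "g' z v = b * (of_real (Re v) * cis (Im z) + of_real (Re z) * (of_real (Im v) * (\<i> * cis (Im z))))" for z v
  have "S = Re -` {0<..} \<inter> Im -` {- pi<..<pi}"
    by (auto simp: S_def)
  then have "open S"
    by (auto intro!: open_Int open_vimage continuous_on_Re continuous_on_Im continuous_on_id)
  then have [measurable]: "S \<in> sets borel" by simp
  have [measurable]: "g \<in> borel_measurable borel"
    unfolding g_def[abs_def] cis_conv_exp
    by (intro borel_measurable_continuous_onI continuous_intros)
  have b0: "b \<noteq> 0" using b by auto
  have img: "g ` S = {y. (y - p) / b \<notin> \<real>\<^sub>\<le>\<^sub>0}"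
  proof (rule set_eqI, rule iffI)
    fix y assume "y \<in> g ` S"
    then obtain z where z: "z \<in> S" "y = g z" by auto
    then have eq: "(y - p) / b = of_real (Re z) * cis (Im z)"
      using b0 by (simp add: g_def)
    have "sin (Im z) \<noteq> 0 \<or> Im z = 0"
      using z sin_gt_zero[of "Im z"] sin_gt_zero[of "- Im z"] by (cases "Im z" "0::real" rule: linorder_cases) (auto simp: S_def)
    then have "(y - p) / b \<notin> \<real>\<^sub>\<le>\<^sub>0"
      using z unfolding eq by (auto simp: S_def complex_nonpos_Reals_iff)
    then show "y \<in> {y. (y - p) / b \<notin> \<real>\<^sub>\<le>\<^sub>0}" by simp
  next
    fix y assume "y \<in> {y. (y - p) / b \<notin> \<real>\<^sub>\<le>\<^sub>0}"
    then have y: "(y - p) / b \<notin> \<real>\<^sub>\<le>\<^sub>0" by simp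
    define q where "q = (y - p) / b"
    have q0: "q \<noteq> 0" using y by (auto simp: q_def)
    have "y = g (Complex (cmod q) (Arg q))"
      using b0 rcis_cmod_Arg[of q] by (simp add: g_def rcis_def q_def)
    moreover have "Complex (cmod q) (Arg q) \<in> S"
      using q0 y mpi_less_Arg[of q] Arg_le_pi[of q] Arg_eq_pi[of q]
      by (auto simp: S_def q_def[symmetric] complex_nonpos_Reals_iff less_le)
    ultimately show "y \<in> g ` S" by blast
  qed
  have "closed {y. (y - p) / b \<in> \<real>\<^sub>\<le>\<^sub>0}"
    using continuous_closed_vimage[of "\<real>\<^sub>\<le>\<^sub>0" "\<lambda>y. (y - p) / b"] b0
    by (simp add: vimage_def continuous_intros)
  then have gS [measurable]: "g ` S \<in> sets borel"
    unfolding img using borel_closed[of "{y. (y - p) / b \<in> \<real>\<^sub>\<le>\<^sub>0}"] sets.compl_sets[of "{y. (y - p) / b \<in> \<real>\<^sub>\<le>\<^sub>0}" borel]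
    by (simp add: Compl_eq_Diff_UNIV[symmetric] Collect_neg_eq)
  have inj: "inj_on g S"
  proof (rule inj_onI)
    fix z w assume *: "z \<in> S" "w \<in> S" "g z = g w"
    then have eq: "of_real (Re z) * cis (Im z) = of_real (Re w) * cis (Im w)"
      using b0 by (simp add: g_def)
    then have "cmod (of_real (Re z) * cis (Im z)) = cmod (of_real (Re w) * cis (Im w))" by simp
    then have re: "Re z = Re w"
      using * by (simp add: norm_mult S_def)
    have "Arg (of_real (Re v) * cis (Im v)) = Im v" if "v \<in> S" for v
      using that by (intro cis_Arg_unique) (auto simp: S_def sgn_mult sgn_of_real)
    then have "Im z = Im w"
      using * eq by metis
    with re show "z = w" by (simp add: complex_eq_iff)
  qed
  have der: "(g has_derivative g' z) (at z within S)" for z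
  proof -
    have "((\<lambda>z. cis (Im z)) has_derivative (\<lambda>v. of_real (Im v) * (\<i> * cis (Im z)))) (at z within S)"
    proof -
      have "((\<lambda>z. \<i> * complex_of_real (Im z)) has_derivative (\<lambda>v. \<i> * complex_of_real (Im v))) (at z within S)"
        by (intro bounded_linear_imp_has_derivative bounded_linear_const_mult
            bounded_linear_compose[OF bounded_linear_of_real bounded_linear_Im])
      from has_derivative_compose[OF this DERIV_exp[unfolded has_field_derivative_def]] show ?thesis
        unfolding cis_conv_exp by (rule has_derivative_eq_rhs) (simp add: fun_eq_iff mult.commute)
    qed
    then show ?thesis
      unfolding g_def[abs_def] g'_def[abs_def]
      by (auto intro!: derivative_eq_intros simp: fun_eq_iff algebra_simps scaleR_conv_of_real)
  qed
  have det: "Re z = \<bar>real_det (g' z)\<bar>" if "z \<in> S" for z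
  proof -
    have mul: "real_det (\<lambda>v. b * T v) = (Re b ^ 2 + Im b ^ 2) * real_det T" for T
      by (simp add: real_det_def power2_eq_square algebra_simps)
    have "Re b ^ 2 + Im b ^ 2 = 1"
      using b by (metis cmod_power2 power_one)
    moreover have "real_det (\<lambda>v. of_real (Re v) * cis (Im z) + of_real (Re z) * (of_real (Im v) * (\<i> * cis (Im z)))) = Re z"
    proof -
      have "real_det (\<lambda>v. of_real (Re v) * cis (Im z) + of_real (Re z) * (of_real (Im v) * (\<i> * cis (Im z))))
          = Re z * (cos (Im z) * cos (Im z)) + Re z * (sin (Im z) * sin (Im z))"
        by (simp add: real_det_def algebra_simps)
      then show ?thesis
        by (simp only: distrib_left[symmetric] sin_cos_squared_add3 mult_1_right)
    qed
    ultimately show ?thesis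
      using that mul by (simp add: g'_def[abs_def] S_def)
  qed
  \<comment> \<open>The slit lies in the line through p with direction b, whose normal is i
    b.\<close>
  have "negligible (- g ` S)"
  proof -
    have "- g ` S \<subseteq> {y. (\<i> * b) \<bullet> y = (\<i> * b) \<bullet> p}"
    proof
      fix y assume "y \<in> - g ` S"
      then have "(y - p) / b \<in> \<real>\<^sub>\<le>\<^sub>0" by (simp add: img)
      then obtain x where "(y - p) / b = of_real x" by (metis nonpos_Reals_cases)
      then have "y = p + b * of_real x" using b0 by (simp add: field_simps)
      then show "y \<in> {y. (\<i> * b) \<bullet> y = (\<i> * b) \<bullet> p}"
        by (simp add: inner_complex_def algebra_simps)
    qed
    moreover have "negligible {y. (\<i> * b) \<bullet> y = (\<i> * b) \<bullet> p}"
      by (rule negligible_hyperplane) (use b0 in simp)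
    ultimately show ?thesis by (rule negligible_subset[rotated])
  qed
  then have "AE y in lborel. y \<in> g ` S"
    using gS by (intro AE_I'[of "- g ` S"])
      (auto simp: negligible_iff_null_sets null_sets_completion_iff)
  then have "(\<integral>\<^sup>+z. F z \<partial>lborel) = (\<integral>\<^sup>+y. F y * indicator (g ` S) y \<partial>lborel)"
    by (intro nn_integral_cong_AE) auto
  also have "\<dots> = (\<integral>\<^sup>+z. F (g z) * (ennreal (Re z) * indicator S z) \<partial>lborel)"
    by (rule nn_integral_change_of_variables_complex[symmetric, where g'=g']) (auto intro: der inj det)
  also have "\<dots> = (\<integral>\<^sup>+t. \<integral>\<^sup>+\<phi>. F (g (Complex t \<phi>)) * (ennreal t * indicator S (Complex t \<phi>)) \<partial>lborel \<partial>lborel)"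
    by (subst nn_integral_lborel_complex) simp_all
  also have "\<dots> = (\<integral>\<^sup>+t. \<integral>\<^sup>+\<phi>. F (p + b * (of_real t * cis \<phi>)) * (ennreal t * indicator {0<..} t * indicator {-pi<..<pi} \<phi>) \<partial>lborel \<partial>lborel)"
    by (intro nn_integral_cong) (auto simp: g_def S_def indicator_def)
  finally show ?thesis .
qed

subsection \<open>Lebesgue points\<close>

lemma ball_measurable [measurable]: "ball (c::'a::metric_space) r \<in> sets borel"
  by simp

lemma cball_measurable [measurable]: "cball (c::'a::metric_space) r \<in> sets borel"
  by simp

definition locally_integrable :: "(complex \<Rightarrow> 'b::{banach, second_countable_topology}) \<Rightarrow> bool" where
  "locally_integrable g \<longleftrightarrow> g \<in> borel_measurable borel \<and>
     (\<forall>r. (\<integral>\<^sup>+y. ennreal (norm (g y)) * indicator (ball 0 r) y \<partial>lborel) < \<infinity>)"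

lemma locally_integrable_ball:
  assumes "locally_integrable g"
  shows "(\<integral>\<^sup>+y. ennreal (norm (g y)) * indicator (ball x r) y \<partial>lborel) < \<infinity>"
proof -
  have "(\<integral>\<^sup>+y. ennreal (norm (g y)) * indicator (ball x r) y \<partial>lborel)
      \<le> (\<integral>\<^sup>+y. ennreal (norm (g y)) * indicator (ball 0 (cmod x + r)) y \<partial>lborel)"
  proof (intro nn_integral_mono mult_left_mono)
    fix y
    have "ball x r \<subseteq> ball 0 (cmod x + r)"
      proof
        fix y assume "y \<in> ball x r"
        then show "y \<in> ball 0 (cmod x + r)"
          using norm_triangle_sub[of y x] by (simp add: dist_norm norm_minus_commute)
      qed
    then show "indicator (ball x r) y \<le> (indicator (ball 0 (cmod x + r)) y :: ennreal)"
      by (auto simp: indicator_def)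
  qed simp
  also have "\<dots> < \<infinity>"
    using assms by (simp add: locally_integrable_def)
  finally show ?thesis .
qed

text \<open>The mass of an open ball is the supremum over smaller concentric balls, and such a
  smaller ball stays inside the ball of the original radius after a small shift of the centre. This
  settles the measurability of conditions that quantify over uncountably many radii.\<close>

lemma open_mass_gt:
  fixes \<mu> :: "complex measure"
  assumes sets_mu [measurable_cong, simp]: "sets \<mu> = sets borel"
  shows "open {x. \<exists>r. 0 < r \<and> r < d \<and> \<phi> r < emeasure \<mu> (ball x r)}" (is "open ?O")
proof (rule openI)
  fix x assume "x \<in> ?O"
  then obtain r where r: "0 < r" "r < d" "\<phi> r < emeasure \<mu> (ball x r)"
    by auto
  define s where "s k = r - r / real (k + 2)" for k :: nat
  have "incseq (\<lambda>k. ball x (s k))"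
    by (auto simp: incseq_def s_def intro!: subset_ball divide_left_mono r)
       (use r in \<open>auto simp: less_imp_le\<close>)
  moreover have "(\<Union>k. ball x (s k)) = ball x r"
  proof (rule antisym)
    show "(\<Union>k. ball x (s k)) \<subseteq> ball x r"
      using r by (auto simp: s_def intro: less_le_trans)
        (smt (verit) divide_nonneg_nonneg of_nat_0_le_iff)
    show "ball x r \<subseteq> (\<Union>k. ball x (s k))"
    proof
      fix y assume "y \<in> ball x r"
      then have d: "0 < (r - dist x y) / r" using r by simp
      then obtain k :: nat where k: "inverse (real (Suc k)) < (r - dist x y) / r"
        using reals_Archimedean by blast
      have "r / real (k + 2) \<le> r * inverse (real (Suc k))"
        using r by (simp add: divide_inverse)
      also have "\<dots> < r - dist x y"
        using k r by (simp add: field_simps)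
      finally show "y \<in> (\<Union>k. ball x (s k))"
        by (auto simp: s_def intro!: exI[of _ k])
    qed
  qed
  ultimately have "emeasure \<mu> (ball x r) = (SUP k. emeasure \<mu> (ball x (s k)))"
    by (subst SUP_emeasure_incseq) auto
  with r(3) obtain k where k: "\<phi> r < emeasure \<mu> (ball x (s k))"
    by (auto simp: less_SUP_iff)
  have "ball x (r / real (k + 2)) \<subseteq> ?O"
  proof
    fix x' assume "x' \<in> ball x (r / real (k + 2))"
    then have "ball x (s k) \<subseteq> ball x' r"
    proof (intro subsetI)
      fix y assume "y \<in> ball x (s k)"
      with \<open>x' \<in> ball x (r / real (k + 2))\<close> show "y \<in> ball x' r"
        using dist_triangle[of x' y x] by (simp add: s_def dist_commute)
    qed
    then have "emeasure \<mu> (ball x (s k)) \<le> emeasure \<mu> (ball x' r)"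
      by (intro emeasure_mono) auto
    with k r show "x' \<in> ?O" by (auto intro: less_le_trans)
  qed
  then show "\<exists>e>0. ball x e \<subseteq> ?O"
    using r by (intro exI[of _ "r / real (k + 2)"]) auto
qed

text \<open>Choose an open V containing the set E with \<mu>(V) <= \<mu>(E) + e. By Vitali, disjoint
  balls inside V with mass above a times their area cover E up to a null set, so a |E| <= \<mu>(V)
  <= a' |E| + e. Since a' < a and |E| is finite, |E| = 0.\<close>

lemma upper_density_aux:
  fixes h :: "complex \<Rightarrow> ennreal"
  assumes [measurable]: "h \<in> borel_measurable borel"
    and fin: "\<And>r. (\<integral>\<^sup>+y. h y * indicator (ball 0 r) y \<partial>lborel) < \<infinity>"
    and aa': "0 \<le> a'" "a' < a"
  defines "\<mu> \<equiv> density lborel h"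
  shows "emeasure lborel {x \<in> ball 0 N. h x < ennreal a' \<and>
    (\<forall>n::nat. \<exists>r. 0 < r \<and> r < 1 / real (Suc n) \<and> ennreal (a * (pi * r\<^sup>2)) < emeasure \<mu> (ball x r))} = 0"
    and "{x \<in> ball 0 N. h x < ennreal a' \<and>
    (\<forall>n::nat. \<exists>r. 0 < r \<and> r < 1 / real (Suc n) \<and> ennreal (a * (pi * r\<^sup>2)) < emeasure \<mu> (ball x r))} \<in> sets borel"
proof -
  define O' where "O' n = {x. \<exists>r. 0 < r \<and> r < 1 / real (Suc n) \<and> ennreal (a * (pi * r\<^sup>2)) < emeasure \<mu> (ball x r)}" for n :: nat
  define E where "E = {x \<in> ball 0 N. h x < ennreal a'} \<inter> (\<Inter>n. O' n)"
  have sets_mu [measurable_cong, simp]: "sets \<mu> = sets borel" by (simp add: \<mu>_def)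
  have op: "open (O' n)" for n
    unfolding O'_def by (rule open_mass_gt[OF sets_mu])
  have Eeq: "{x \<in> ball 0 N. h x < ennreal a' \<and>
    (\<forall>n::nat. \<exists>r. 0 < r \<and> r < 1 / real (Suc n) \<and> ennreal (a * (pi * r\<^sup>2)) < emeasure \<mu> (ball x r))} = E"
    by (auto simp: E_def O'_def)
  have "{x \<in> ball 0 N. h x < ennreal a'} \<in> sets borel"
    by measurable
  then have E [measurable]: "E \<in> sets borel"
    unfolding E_def using op by (intro sets.Int sets.countable_INT) auto
  show "{x \<in> ball 0 N. h x < ennreal a' \<and>
    (\<forall>n::nat. \<exists>r. 0 < r \<and> r < 1 / real (Suc n) \<and> ennreal (a * (pi * r\<^sup>2)) < emeasure \<mu> (ball x r))} \<in> sets borel"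
    unfolding Eeq by (rule E)
  have Efin: "emeasure lborel E < \<infinity>"
  proof -
    have "emeasure lborel E \<le> emeasure lborel (ball (0::complex) N)"
      by (rule emeasure_mono) (auto simp: E_def)
    also have "\<dots> < \<infinity>" by (rule emeasure_lborel_ball_finite)
    finally show ?thesis .
  qed
  have muE: "emeasure \<mu> E \<le> ennreal a' * emeasure lborel E"
  proof -
    have "emeasure \<mu> E = (\<integral>\<^sup>+x. h x * indicator E x \<partial>lborel)"
      by (simp add: \<mu>_def emeasure_density)
    also have "\<dots> \<le> (\<integral>\<^sup>+x. ennreal a' * indicator E x \<partial>lborel)"
      by (intro nn_integral_mono) (auto simp: E_def indicator_def less_imp_le)
    finally show ?thesis by (simp add: nn_integral_cmult_indicator)
  qed
  have main: "ennreal a * emeasure lborel E \<le> ennreal a' * emeasure lborel E + ennreal e" if e: "0 < e" for e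
  proof -
    \<comment> \<open>Outer regularity is applied to a finite measure, so the mass is cut off to the
      ball that contains E.\<close>
    define M where "M = density lborel (\<lambda>y. h y * indicator (ball 0 N) y)"
    have M: "emeasure M A = emeasure \<mu> (A \<inter> ball 0 N)" if [measurable]: "A \<in> sets borel" for A
      unfolding M_def \<mu>_def by (simp add: emeasure_density indicator_inter_arith mult_ac)
    have sM [simp]: "sets M = sets borel" by (simp add: M_def)
    have "emeasure M (space M) < \<infinity>"
      using fin[of N] M[of UNIV] by (simp add: M_def emeasure_density)
    then have "emeasure M (space M) \<noteq> \<infinity>" by simp
    then have "emeasure M E = (INF U\<in>{U. E \<subseteq> U \<and> open U}. emeasure M U)"
      by (intro outer_regular sM) auto
    moreover have "emeasure M E < emeasure M E + ennreal e"
    proof -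
      have "emeasure M E \<le> emeasure M (space M)" by (rule emeasure_space)
      then have "emeasure M E \<noteq> \<infinity>"
        using \<open>emeasure M (space M) < \<infinity>\<close> by auto
      then show ?thesis
        using e ennreal_add_left_cancel_less[of "emeasure M E" 0 "ennreal e"] by simp
    qed
    ultimately obtain U where U: "E \<subseteq> U" "open U" "emeasure M U < emeasure M E + ennreal e"
      by (auto simp: INF_less_iff)
    define V where "V = U \<inter> ball 0 N"
    have V: "open V" "E \<subseteq> V" "emeasure \<mu> V \<le> emeasure \<mu> E + ennreal e"
    proof -
      show "open V" "E \<subseteq> V" using U by (auto simp: V_def E_def)
      have "emeasure M E = emeasure \<mu> E"
      proof -
        have "E \<inter> ball 0 N = E" by (auto simp: E_def)
        with M[OF E] show ?thesis by simp
      qed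
      then show "emeasure \<mu> V \<le> emeasure \<mu> E + ennreal e"
        using U by (auto simp: M V_def)
    qed
    define K where "K = {(x, r). 0 < r \<and> ball x r \<subseteq> V \<and> ennreal (a * (pi * r\<^sup>2)) < emeasure \<mu> (ball x r)}"
    have "\<exists>i. i \<in> K \<and> x \<in> ball (fst i) (snd i) \<and> snd i < d" if x: "x \<in> E" and d: "0 < d" for x d
    proof -
      obtain d' where d': "0 < d'" "ball x d' \<subseteq> V"
        using x V by (meson open_contains_ball subsetD)
      obtain n :: nat where n: "1 / real (Suc n) < min d d'"
        using reals_Archimedean[of "min d d'"] d d' by (auto simp: inverse_eq_divide)
      obtain r where r: "0 < r" "r < 1 / real (Suc n)" "ennreal (a * (pi * r\<^sup>2)) < emeasure \<mu> (ball x r)"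
        using x by (auto simp: E_def O'_def)
      have "ball x r \<subseteq> ball x d'" using r n by (intro subset_ball) auto
      then have "(x, r) \<in> K" using r d' by (auto simp: K_def)
      then show ?thesis using r n by (intro exI[of _ "(x, r)"]) auto
    qed
    then obtain C where C: "countable C" "C \<subseteq> K"
      "pairwise (\<lambda>i j. disjnt (ball (fst i) (snd i)) (ball (fst j) (snd j))) C"
      "negligible (E - (\<Union>i\<in>C. ball (fst i) (snd i)))"
      using Vitali_covering_theorem_balls[of E K fst snd] by blast
    define B where "B i = ball (fst i) (snd i)" for i :: "complex \<times> real"
    have disj: "disjoint_family_on B C"
      using C(3) by (auto simp: disjoint_family_on_def pairwise_def B_def disjnt_def)
    have [measurable]: "B i \<in> sets borel" for i by (simp add: B_def)
    have Un [measurable]: "(\<Union>i\<in>C. B i) \<in> sets borel"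
      using C(1) by (intro sets.countable_UN') auto
    have null: "emeasure lborel (E - (\<Union>i\<in>C. B i)) = 0"
      using C(4) by (simp add: negligible_iff_emeasure0 B_def[symmetric] emeasure_completion)
    have "emeasure lborel E \<le> emeasure lborel ((E - (\<Union>i\<in>C. B i)) \<union> (\<Union>i\<in>C. B i))"
      by (rule emeasure_mono) auto
    also have "\<dots> \<le> emeasure lborel (E - (\<Union>i\<in>C. B i)) + emeasure lborel (\<Union>i\<in>C. B i)"
      by (rule emeasure_subadditive) auto
    also have "\<dots> = emeasure lborel (\<Union>i\<in>C. B i)" by (simp add: null)
    also have "\<dots> = (\<integral>\<^sup>+i. emeasure lborel (B i) \<partial>count_space C)"
      by (rule emeasure_UN_countable) (use C(1) disj in auto)
    finally have "ennreal a * emeasure lborel E \<le> ennreal a * (\<integral>\<^sup>+i. emeasure lborel (B i) \<partial>count_space C)"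
      by (rule mult_left_mono) simp
    also have "\<dots> = (\<integral>\<^sup>+i. ennreal a * emeasure lborel (B i) \<partial>count_space C)"
      by (simp add: nn_integral_cmult)
    also have "\<dots> \<le> (\<integral>\<^sup>+i. emeasure \<mu> (B i) \<partial>count_space C)"
    proof (rule nn_integral_mono)
      fix i assume "i \<in> space (count_space C)"
      then have "i \<in> K" using C by auto
      then show "ennreal a * emeasure lborel (B i) \<le> emeasure \<mu> (B i)"
        using aa' by (auto simp: K_def B_def measure_lborel_ball_complex ennreal_mult[symmetric])
    qed
    also have "\<dots> = emeasure \<mu> (\<Union>i\<in>C. B i)"
      by (rule emeasure_UN_countable[symmetric]) (use C(1) disj in auto)
    also have "\<dots> \<le> emeasure \<mu> V"
    proof (rule emeasure_mono)
      have "B i \<subseteq> V" if "i \<in> K" for i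
        using that by (auto simp: B_def K_def)
      then show "(\<Union>i\<in>C. B i) \<subseteq> V" using C(2) by blast
    qed (use V(1) in simp)
    also have "\<dots> \<le> emeasure \<mu> E + ennreal e" by (rule V)
    also have "\<dots> \<le> ennreal a' * emeasure lborel E + ennreal e"
      using muE by (rule add_right_mono)
    finally show ?thesis .
  qed
  obtain m where m: "0 \<le> m" "emeasure lborel E = ennreal m"
    using Efin by (cases "emeasure lborel E") auto
  have "a * m \<le> a' * m + e" if "0 < e" for e
    using main[OF that] m aa' that by (simp add: ennreal_mult[symmetric] ennreal_plus[symmetric] del: ennreal_plus)
  then have "a * m \<le> a' * m" by (rule field_le_epsilon)
  then have "m = 0" using m aa' by (simp add: mult_le_cancel_right)
  then show "emeasure lborel {x \<in> ball 0 N. h x < ennreal a' \<and>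
    (\<forall>n::nat. \<exists>r. 0 < r \<and> r < 1 / real (Suc n) \<and> ennreal (a * (pi * r\<^sup>2)) < emeasure \<mu> (ball x r))} = 0"
    unfolding Eeq using m by simp
qed

text \<open>Rational thresholds between h x and a reduce the statement to countably many null sets,
  hence to one exceptional set valid for every a.\<close>

lemma upper_density_AE:
  fixes h :: "complex \<Rightarrow> real"
  assumes "locally_integrable h" and h0: "\<And>x. 0 \<le> h x"
  shows "AE x in lborel. \<forall>a>h x. \<exists>\<delta>>0. \<forall>r. 0 < r \<and> r < \<delta> \<longrightarrow>
     (\<integral>\<^sup>+y. ennreal (h y) * indicator (ball x r) y \<partial>lborel) \<le> ennreal (a * (pi * r\<^sup>2))"
proof -
  have [measurable]: "h \<in> borel_measurable borel"
    using assms by (simp add: locally_integrable_def)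
  define \<mu> where "\<mu> = density lborel (\<lambda>x. ennreal (h x))"
  define E where "E N a a' = {x \<in> ball 0 N. ennreal (h x) < ennreal a' \<and>
    (\<forall>n::nat. \<exists>r. 0 < r \<and> r < 1 / real (Suc n) \<and> ennreal (a * (pi * r\<^sup>2)) < emeasure \<mu> (ball x r))}" for N a a'
  have fin: "(\<integral>\<^sup>+y. ennreal (h y) * indicator (ball 0 r) y \<partial>lborel) < \<infinity>" for r
    using assms by (simp add: locally_integrable_def)
  have "AE x in lborel. x \<notin> E N a a'" if "0 \<le> a'" "a' < a" for N a a'
  proof -
    have "E N a a' \<in> null_sets lborel"
      using upper_density_aux[OF _ fin that, of N]
      unfolding E_def \<mu>_def null_sets_def by simp
    then show ?thesis by (rule AE_not_in)
  qed
  then have "AE x in lborel. \<forall>N::nat. \<forall>a\<in>\<rat>. \<forall>a'\<in>\<rat>. 0 \<le> a' \<longrightarrow> a' < a \<longrightarrow> x \<notin> E N a a'"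
    by (intro AE_all_countable[THEN iffD2] allI AE_ball_countable' countable_rat AE_impI)
  then show ?thesis
  proof (eventually_elim, safe)
    fix x a
    assume x: "\<forall>N::nat. \<forall>a\<in>\<rat>. \<forall>a'\<in>\<rat>. 0 \<le> a' \<longrightarrow> a' < a \<longrightarrow> x \<notin> E N a a'" and a: "h x < a"
    obtain b where b: "b \<in> \<rat>" "h x < b" "b < a" using Rats_dense_in_real[OF a] by blast
    obtain b' where b': "b' \<in> \<rat>" "h x < b'" "b' < b" using Rats_dense_in_real[OF b(2)] by blast
    obtain N :: nat where N: "cmod x < N" using reals_Archimedean2 by blast
    have "x \<notin> E N b b'" using x b b' h0[of x] by auto
    then have "\<exists>n::nat. \<forall>r. \<not> (0 < r \<and> r < 1 / real (Suc n) \<and> ennreal (b * (pi * r\<^sup>2)) < emeasure \<mu> (ball x r))"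
    proof -
      have "x \<in> ball 0 N" "ennreal (h x) < ennreal b'"
        using b' h0[of x] N by (simp_all add: ennreal_less_iff)
      then show ?thesis
        using \<open>x \<notin> E N b b'\<close> unfolding E_def by blast
    qed
    then obtain n :: nat where n: "\<And>r. 0 < r \<Longrightarrow> r < 1 / real (Suc n) \<Longrightarrow> emeasure \<mu> (ball x r) \<le> ennreal (b * (pi * r\<^sup>2))"
      by (meson not_less)
    show "\<exists>\<delta>>0. \<forall>r. 0 < r \<and> r < \<delta> \<longrightarrow>
     (\<integral>\<^sup>+y. ennreal (h y) * indicator (ball x r) y \<partial>lborel) \<le> ennreal (a * (pi * r\<^sup>2))"
    proof (intro exI[of _ "1 / real (Suc n)"] conjI allI impI)
      fix r assume r: "0 < r \<and> r < 1 / real (Suc n)"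
      have "(\<integral>\<^sup>+y. ennreal (h y) * indicator (ball x r) y \<partial>lborel) = emeasure \<mu> (ball x r)"
        by (simp add: \<mu>_def emeasure_density)
      also have "\<dots> \<le> ennreal (b * (pi * r\<^sup>2))" using n r by auto
      also have "\<dots> \<le> ennreal (a * (pi * r\<^sup>2))" using b by (intro ennreal_leI mult_right_mono) auto
      finally show "(\<integral>\<^sup>+y. ennreal (h y) * indicator (ball x r) y \<partial>lborel) \<le> ennreal (a * (pi * r\<^sup>2))" .
    qed simp
  qed
qed

section \<open>Lebesgue points through a countable dense set of comparison values\<close>

definition rational_points :: "complex set" where
  "rational_points = (\<lambda>(x, y). Complex (of_rat x) (of_rat y)) ` UNIV"

lemma countable_rational_points: "countable rational_points"
  unfolding rational_points_def by simp

lemma rational_points_dense: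
  assumes "0 < e" obtains q where "q \<in> rational_points" "cmod (z - q) < e"
proof -
  obtain a where a: "Re z - e/2 < of_rat a" "of_rat a < Re z + e/2"
    using of_rat_dense[of "Re z - e/2" "Re z + e/2"] assms by auto
  obtain b where b: "Im z - e/2 < of_rat b" "of_rat b < Im z + e/2"
    using of_rat_dense[of "Im z - e/2" "Im z + e/2"] assms by auto
  have "cmod (z - Complex (of_rat a) (of_rat b)) \<le> \<bar>Re z - of_rat a\<bar> + \<bar>Im z - of_rat b\<bar>"
    using cmod_le[of "z - Complex (of_rat a) (of_rat b)"] by simp
  also have "\<dots> < e" using a b by linarith
  finally show ?thesis
    by (rule that[rotated]) (auto simp: rational_points_def intro: image_eqI[of _ _ "(a, b)"])
qed

lemma locally_integrable_const: "locally_integrable (\<lambda>_. c)"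
  unfolding locally_integrable_def
  by (simp add: nn_integral_cmult_indicator ennreal_mult_less_top
      emeasure_lborel_ball_finite[unfolded infinity_ennreal_def])

lemma locally_integrable_bound:
  assumes "locally_integrable f" "locally_integrable g"
    and [measurable]: "h \<in> borel_measurable borel" and le: "\<And>x. norm (h x) \<le> norm (f x) + norm (g x)"
  shows "locally_integrable h"
  unfolding locally_integrable_def
proof safe
  fix r
  have [measurable]: "f \<in> borel_measurable borel" "g \<in> borel_measurable borel"
    using assms by (auto simp: locally_integrable_def)
  have "(\<integral>\<^sup>+y. ennreal (norm (h y)) * indicator (ball 0 r) y \<partial>lborel)
    \<le> (\<integral>\<^sup>+y. ennreal (norm (f y)) * indicator (ball 0 r) y + ennreal (norm (g y)) * indicator (ball 0 r) y \<partial>lborel)"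
    using le by (intro nn_integral_mono) (auto simp: indicator_def ennreal_plus[symmetric] simp del: ennreal_plus)
  also have "\<dots> = (\<integral>\<^sup>+y. ennreal (norm (f y)) * indicator (ball 0 r) y \<partial>lborel) +
      (\<integral>\<^sup>+y. ennreal (norm (g y)) * indicator (ball 0 r) y \<partial>lborel)"
    by (rule nn_integral_add) measurable
  also have "\<dots> < \<infinity>"
    using assms by (auto simp: locally_integrable_def)
  finally show "(\<integral>\<^sup>+y. ennreal (norm (h y)) * indicator (ball 0 r) y \<partial>lborel) < \<infinity>" .
qed fact

text \<open>Comparing with countably many constants q makes the exceptional set independent of q.
  Taking q close to g x recovers the usual averages of |g y - g x|.\<close>

theorem lebesgue_points_AE:
  fixes g :: "complex \<Rightarrow> complex"
  assumes g: "locally_integrable g"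
  shows "AE x in lborel. \<forall>q\<in>rational_points. \<forall>a>cmod (g x - q). \<exists>\<delta>>0. \<forall>r. 0 < r \<and> r < \<delta> \<longrightarrow>
     (\<integral>\<^sup>+y. ennreal (cmod (g y - q)) * indicator (ball x r) y \<partial>lborel) \<le> ennreal (a * (pi * r\<^sup>2))"
proof (rule AE_ball_countable'[OF _ countable_rational_points])
  fix q
  have [measurable]: "g \<in> borel_measurable borel"
    using assms by (simp add: locally_integrable_def)
  have "locally_integrable (\<lambda>x. cmod (g x - q))"
    by (rule locally_integrable_bound[OF g locally_integrable_const[of q]])
       (auto intro: norm_triangle_ineq4)
  from upper_density_AE[OF this]
  show "AE x in lborel. \<forall>a>cmod (g x - q). \<exists>\<delta>>0. \<forall>r. 0 < r \<and> r < \<delta> \<longrightarrow>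
     (\<integral>\<^sup>+y. ennreal (cmod (g y - q)) * indicator (ball x r) y \<partial>lborel) \<le> ennreal (a * (pi * r\<^sup>2))"
    by simp
qed

subsection \<open>Mollification of Sobolev maps\<close>

definition mollify :: "real \<Rightarrow> (complex \<Rightarrow> complex) \<Rightarrow> complex \<Rightarrow> complex" where
  "mollify h g x = (\<integral>y. mollifier h (x - y) *\<^sub>R g y \<partial>lborel)"

lemma locally_integrable_measurable: "locally_integrable g \<Longrightarrow> g \<in> borel_measurable borel"
  by (simp add: locally_integrable_def)

lemma integrable_indicator_ball:
  assumes "locally_integrable g"
  shows "integrable lborel (\<lambda>y. indicator (ball x r) y *\<^sub>R g y)"
proof (rule integrableI_bounded)
  note [measurable] = locally_integrable_measurable[OF assms]
  show "(\<lambda>y. indicator (ball x r) y *\<^sub>R g y) \<in> borel_measurable lborel" by measurable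
  have "(\<integral>\<^sup>+y. ennreal (norm (indicator (ball x r) y *\<^sub>R g y)) \<partial>lborel)
     = (\<integral>\<^sup>+y. ennreal (norm (g y)) * indicator (ball x r) y \<partial>lborel)"
    by (intro nn_integral_cong) (auto simp: indicator_def)
  then show "(\<integral>\<^sup>+y. ennreal (norm (indicator (ball x r) y *\<^sub>R g y)) \<partial>lborel) < \<infinity>"
    using locally_integrable_ball[OF assms, of x r] by simp
qed

lemma integrable_mollifier_scaleR:
  assumes g: "locally_integrable g" and h: "0 < h"
  shows "integrable lborel (\<lambda>y. mollifier h (x - y) *\<^sub>R g y)"
proof (rule Bochner_Integration.integrable_bound)
  note [measurable] = locally_integrable_measurable[OF g]
  show "integrable lborel (\<lambda>y. (3 / h\<^sup>2) *\<^sub>R (indicator (ball x h) y *\<^sub>R g y))"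
    by (intro integrable_scaleR_right integrable_indicator_ball g)
  show "(\<lambda>y. mollifier h (x - y) *\<^sub>R g y) \<in> borel_measurable lborel" by measurable
  have "norm (mollifier h (x - y) *\<^sub>R g y) \<le> norm ((3 / h\<^sup>2) *\<^sub>R (indicator (ball x h) y *\<^sub>R g y))" for y
  proof (cases "y \<in> ball x h")
    case True
    then show ?thesis
      using mult_right_mono[OF mollifier_le[OF h, of "x - y"], of "norm (g y)"] mollifier_nonneg[OF h, of "x - y"]
      by simp
  next
    case False
    then have "mollifier h (x - y) = 0"
      by (intro mollifier_eq_0[OF h]) (simp add: dist_norm)
    then show ?thesis by simp
  qed
  then show "AE y in lborel. norm (mollifier h (x - y) *\<^sub>R g y) \<le> norm ((3 / h\<^sup>2) *\<^sub>R (indicator (ball x h) y *\<^sub>R g y))"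
    by simp
qed

lemma lborel_reflect_complex: "distr lborel borel (\<lambda>y. x - y) = (lborel :: complex measure)"
  using lborel_affine[of "-1" x] by (simp add: density_1)

lemma integral_reflect_complex:
  fixes g :: "complex \<Rightarrow> 'b::{banach, second_countable_topology}"
  assumes [measurable]: "g \<in> borel_measurable borel"
  shows "(\<integral>y. g (x - y) \<partial>lborel) = (\<integral>y. g y \<partial>lborel)"
  by (subst (2) lborel_reflect_complex[of x, symmetric]) (simp add: integral_distr)

lemma nn_integral_reflect_complex:
  fixes g :: "complex \<Rightarrow> ennreal"
  assumes [measurable]: "g \<in> borel_measurable borel"
  shows "(\<integral>\<^sup>+y. g (x - y) \<partial>lborel) = (\<integral>\<^sup>+y. g y \<partial>lborel)"
  by (subst (2) lborel_reflect_complex[of x, symmetric]) (simp add: nn_integral_distr)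

lemma integral_mollifier_reflect: "0 < h \<Longrightarrow> (\<integral>y. mollifier h (x - y) \<partial>lborel) = 1"
  by (simp add: integral_reflect_complex integral_mollifier)

lemma integrable_mollifier: "0 < h \<Longrightarrow> integrable lborel (mollifier h)"
  using integral_mollifier[of h] not_integrable_integral_eq[of lborel "mollifier h"] by fastforce

lemma nn_integral_mollifier: "0 < h \<Longrightarrow> (\<integral>\<^sup>+y. ennreal (mollifier h y) \<partial>lborel) = 1"
  by (simp add: nn_integral_eq_integral integrable_mollifier integral_mollifier mollifier_nonneg)

lemma mollify_diff_const:
  assumes g: "locally_integrable g" and h: "0 < h"
  shows "mollify h g x - q = mollify h (\<lambda>y. g y - q) x"
proof -
  have "mollify h (\<lambda>y. g y - q) x = (\<integral>y. mollifier h (x - y) *\<^sub>R g y - mollifier h (x - y) *\<^sub>R q \<partial>lborel)"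
    unfolding mollify_def by (simp add: scaleR_diff_right)
  also have "\<dots> = mollify h g x - (\<integral>y. mollifier h (x - y) *\<^sub>R q \<partial>lborel)"
    unfolding mollify_def
    by (intro Bochner_Integration.integral_diff integrable_mollifier_scaleR g h locally_integrable_const)
  also have "(\<integral>y. mollifier h (x - y) *\<^sub>R q \<partial>lborel) = q"
  proof -
    have "integrable lborel (\<lambda>y. mollifier h (x - y))"
      using integral_mollifier_reflect[OF h, of x] not_integrable_integral_eq[of lborel "\<lambda>y. mollifier h (x - y)"]
      by fastforce
    then show ?thesis using integral_mollifier_reflect[OF h, of x] by simp
  qed
  finally show ?thesis by simp
qed

lemma norm_mollify_le:
  assumes g: "locally_integrable g" and h: "0 < h"
  shows "ennreal (norm (mollify h g x)) \<le> (\<integral>\<^sup>+y. ennreal (mollifier h (x - y)) * ennreal (norm (g y)) \<partial>lborel)"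
proof -
  have "ennreal (norm (mollify h g x)) \<le> (\<integral>\<^sup>+y. ennreal (norm (mollifier h (x - y) *\<^sub>R g y)) \<partial>lborel)"
    unfolding mollify_def by (rule integral_norm_bound_ennreal[OF integrable_mollifier_scaleR[OF g h]])
  then show ?thesis
    by (simp add: ennreal_mult mollifier_nonneg[OF h])
qed

lemma continuous_on_mollify:
  assumes g: "locally_integrable g" and h: "0 < h"
  shows "continuous_on UNIV (mollify h g)"
proof (rule continuous_at_imp_continuous_on, safe)
  fix x
  note [measurable] = locally_integrable_measurable[OF g]
  show "isCont (mollify h g) x"
    unfolding continuous_at_sequentially
  proof safe
    fix X :: "nat \<Rightarrow> complex" assume X: "X \<longlonglongrightarrow> x"
    then obtain N where N: "\<And>n. N \<le> n \<Longrightarrow> dist (X n) x < 1"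
      by (metis lim_sequentially zero_less_one)
    have "(\<lambda>n. mollify h g (X (n + N))) \<longlonglongrightarrow> mollify h g x"
      unfolding mollify_def
    proof (rule integral_dominated_convergence)
      show "integrable lborel (\<lambda>y. norm ((3 / h\<^sup>2) *\<^sub>R (indicator (ball x (h + 1)) y *\<^sub>R g y)))"
        by (intro integrable_norm integrable_scaleR_right integrable_indicator_ball g)
      have "(\<lambda>n. mollifier h (X (n + N) - y)) \<longlonglongrightarrow> mollifier h (x - y)" for y
        by (rule continuous_on_tendsto_compose[OF continuous_on_mollifier[of UNIV]])
           (auto intro!: tendsto_intros LIMSEQ_ignore_initial_segment X)
      then show "AE y in lborel. (\<lambda>n. mollifier h (X (n + N) - y) *\<^sub>R g y) \<longlonglongrightarrow> mollifier h (x - y) *\<^sub>R g y"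
        by (auto intro!: tendsto_intros)
      have "norm (mollifier h (X (n + N) - y) *\<^sub>R g y) \<le> norm ((3 / h\<^sup>2) *\<^sub>R (indicator (ball x (h + 1)) y *\<^sub>R g y))" for n y
      proof (cases "y \<in> ball x (h + 1)")
        case True
        then show ?thesis
          using mult_right_mono[OF mollifier_le[OF h, of "X (n + N) - y"], of "norm (g y)"]
            mollifier_nonneg[OF h, of "X (n + N) - y"] by simp
      next
        case False
        have "dist x y \<le> dist (X (n + N)) x + dist (X (n + N)) y"
          by (metis dist_commute dist_triangle)
        then have "mollifier h (X (n + N) - y) = 0"
          using N[of "n + N"] False by (intro mollifier_eq_0[OF h]) (simp add: dist_norm)
        then show ?thesis by simp
      qed
      then show "AE y in lborel. norm (mollifier h (X (n + N) - y) *\<^sub>R g y) \<le> norm ((3 / h\<^sup>2) *\<^sub>R (indicator (ball x (h + 1)) y *\<^sub>R g y))" for n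
        by simp
    qed measurable
    then show "(mollify h g \<circ> X) \<longlonglongrightarrow> mollify h g x"
      unfolding comp_def by (rule LIMSEQ_offset)
  qed
qed

lemma locally_integrable_continuous:
  fixes f :: "complex \<Rightarrow> complex"
  assumes "continuous_on UNIV f"
  shows "locally_integrable f"
  unfolding locally_integrable_def
proof safe
  show m [measurable]: "f \<in> borel_measurable borel"
    by (rule borel_measurable_continuous_onI[OF assms])
  fix r :: real
  have "set_integrable lborel (cball 0 r) f"
    unfolding set_integrable_def
    by (rule borel_integrable_compact) (use assms in \<open>auto intro: continuous_on_subset\<close>)
  then have "(\<integral>\<^sup>+y. ennreal (norm (indicator (cball 0 r) y *\<^sub>R f y)) \<partial>lborel) < \<infinity>"
    by (simp add: set_integrable_def integrable_iff_bounded)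
  moreover have "(\<integral>\<^sup>+y. ennreal (norm (f y)) * indicator (ball 0 r) y \<partial>lborel)
      \<le> (\<integral>\<^sup>+y. ennreal (norm (indicator (cball 0 r) y *\<^sub>R f y)) \<partial>lborel)"
    by (intro nn_integral_mono) (auto simp: indicator_def)
  ultimately show "(\<integral>\<^sup>+y. ennreal (norm (f y)) * indicator (ball 0 r) y \<partial>lborel) < \<infinity>"
    by (rule le_less_trans[rotated])
qed

lemma mollify_approx:
  assumes f: "continuous_on UNIV f" and e: "0 < e"
  obtains h0 where "0 < h0" "\<And>h x. 0 < h \<Longrightarrow> h < h0 \<Longrightarrow> cmod x \<le> R \<Longrightarrow> cmod (mollify h f x - f x) \<le> e"
proof -
  have "uniformly_continuous_on (cball 0 (R + 1)) f"
    by (intro compact_uniformly_continuous continuous_on_subset[OF f]) auto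
  then obtain d where d: "0 < d" "\<And>x y. x \<in> cball 0 (R + 1) \<Longrightarrow> y \<in> cball 0 (R + 1) \<Longrightarrow> dist x y < d \<Longrightarrow> dist (f x) (f y) < e"
    using e unfolding uniformly_continuous_on_def by metis
  show ?thesis
  proof (rule that[of "min d 1"])
    fix h x assume h: "0 < h" "h < min d 1" and x: "cmod x \<le> R"
    have lf: "locally_integrable (\<lambda>y. f y - f x)"
      by (intro locally_integrable_continuous continuous_intros f)
    note [measurable] = locally_integrable_measurable[OF lf]
    have "mollify h f x - f x = mollify h (\<lambda>y. f y - f x) x"
      by (rule mollify_diff_const[OF locally_integrable_continuous[OF f] h(1)])
    then have "ennreal (cmod (mollify h f x - f x)) \<le> (\<integral>\<^sup>+y. ennreal (mollifier h (x - y)) * ennreal (cmod (f y - f x)) \<partial>lborel)"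
      using norm_mollify_le[OF lf h(1), of x] by simp
    also have "\<dots> \<le> (\<integral>\<^sup>+y. ennreal (mollifier h (x - y)) * ennreal e \<partial>lborel)"
    proof (rule nn_integral_mono)
      fix y
      show "ennreal (mollifier h (x - y)) * ennreal (cmod (f y - f x)) \<le> ennreal (mollifier h (x - y)) * ennreal e"
      proof (cases "cmod (x - y) < h")
        case True
        then have "cmod y \<le> R + 1"
          using norm_triangle_sub[of y x] x h by (simp add: norm_minus_commute)
        then have "cmod (f y - f x) < e"
          using d(2)[of y x] x h True by (simp add: dist_norm norm_minus_commute)
        then show ?thesis by (intro mult_left_mono ennreal_leI) auto
      next
        case False
        then show ?thesis using mollifier_eq_0[OF h(1), of "x - y"] by simp
      qed
    qed
    also have "\<dots> = ennreal e"
      by (simp add: nn_integral_multc nn_integral_reflect_complex[of "\<lambda>y. ennreal (mollifier h y)"] nn_integral_mollifier h)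
    finally show "cmod (mollify h f x - f x) \<le> e"
      using e by simp
  qed (use d in auto)
qed

text \<open>The situation after the weak partial derivatives have been replaced by Borel
  representatives \<open>fx\<close> and \<open>fy\<close>, so that product measurability and Fubini
  are available on \<open>lborel\<close>. Injectivity of f is not part of the locale; it enters
  through \<open>homeomorphism\<close> where needed.\<close>

locale sobolev_map =
  fixes f fx fy :: "complex \<Rightarrow> complex"
  assumes cont: "continuous_on UNIV f"
    and locally_integrable_fx: "locally_integrable fx" and locally_integrable_fy: "locally_integrable fy"
    and weak_x: "\<And>\<phi>. test_function UNIV \<phi> \<Longrightarrow>
      (\<integral>z. frechet_derivative \<phi> (at z) 1 *\<^sub>R f z \<partial>lborel) = - (\<integral>z. \<phi> z *\<^sub>R fx z \<partial>lborel)"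
    and weak_y: "\<And>\<phi>. test_function UNIV \<phi> \<Longrightarrow>
      (\<integral>z. frechet_derivative \<phi> (at z) \<i> *\<^sub>R f z \<partial>lborel) = - (\<integral>z. \<phi> z *\<^sub>R fy z \<partial>lborel)"
begin

lemma measurable_data [measurable]:
  "f \<in> borel_measurable borel" "fx \<in> borel_measurable borel" "fy \<in> borel_measurable borel"
  using cont locally_integrable_fx locally_integrable_fy
  by (auto simp: locally_integrable_def borel_measurable_continuous_onI)

text \<open>Differentiation under the integral puts the derivative on the kernel. The reflected
  kernel y -> k(x - y) is a test function, and the sign from the reflection cancels the sign in the
  definition of the weak derivative.\<close>

lemma mollify_has_derivative:
  assumes h: "0 < h"
  shows "(mollify h f has_derivative (\<lambda>v. Re v *\<^sub>R mollify h fx x + Im v *\<^sub>R mollify h fy x)) (at x)"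
proof -
  obtain kx ky where k: "smooth_class kx" "smooth_class ky"
    "\<And>z. (mollifier h has_derivative (\<lambda>v. Re v * kx z + Im v * ky z)) (at z)"
    using smooth_class_has_derivative[OF smooth_class_mollifier] by metis
  have ck: "continuous_on S kx" "continuous_on S ky" for S
    using k smooth_class_continuous by auto
  have k0: "kx z = 0" "ky z = 0" if "h < cmod z" for z
  proof -
    have "((\<lambda>_. 0) has_derivative (\<lambda>v. Re v * kx z + Im v * ky z)) (at z)"
      by (rule has_derivative_transform_within_open[OF k(3), of "- cball 0 h"])
         (use that mollifier_eq_0[OF h] in auto)
    then have "(\<lambda>v. Re v * kx z + Im v * ky z) = (\<lambda>_. 0)"
      by (rule has_derivative_unique) (rule has_derivative_const)
    from fun_cong[OF this, of 1] fun_cong[OF this, of \<i>] show "kx z = 0" "ky z = 0" by auto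
  qed
  \<comment> \<open>A box containing the supports of the kernels centred at all w within distance 1
    of x, so one fixed domain of integration serves a whole neighbourhood of x.\<close>
  define B :: "complex set" where "B = cbox (x - (h + 2) *\<^sub>R One) (x + (h + 2) *\<^sub>R One)"
  have outB: "h + 2 < cmod (x - y)" if "y \<notin> B" for y
  proof -
    have "\<bar>Re (x - y)\<bar> > h + 2 \<or> \<bar>Im (x - y)\<bar> > h + 2"
      using that by (auto simp: B_def cbox_def Basis_complex_def)
    then show ?thesis
      using abs_Re_le_cmod[of "x - y"] abs_Im_le_cmod[of "x - y"] by linarith
  qed
  define bR bI where "bR = Blinfun Re" and "bI = Blinfun Im"
  have bRI: "blinfun_apply bR v = Re v" "blinfun_apply bI v = Im v" for v
    by (simp_all add: bR_def bI_def bounded_linear_Blinfun_apply bounded_linear_Re bounded_linear_Im)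
  define D where "D w y = kx (w - y) *\<^sub>R (blinfun_scaleR_left (f y) o\<^sub>L bR) + ky (w - y) *\<^sub>R (blinfun_scaleR_left (f y) o\<^sub>L bI)" for w y
  have D_apply: "blinfun_apply (D w y) v = (Re v * kx (w - y) + Im v * ky (w - y)) *\<^sub>R f y" for w y v
    by (simp add: D_def blinfun.add_left blinfun.scaleR_left bRI scaleR_add_left mult.commute)
  have cf: "continuous_on S (\<lambda>p. f (snd p))" for S :: "(complex \<times> complex) set"
    by (rule continuous_on_compose2[OF cont]) (auto intro: continuous_intros)
  have contD: "continuous_on (ball x 1 \<times> B) (\<lambda>(w, y). D w y)"
    unfolding D_def case_prod_beta
    by (intro continuous_intros continuous_on_compose2[OF ck(1)[of UNIV]] continuous_on_compose2[OF ck(2)[of UNIV]]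
        bounded_linear.continuous_on[OF bounded_linear_blinfun_scaleR_left] cf) auto
  have ckf: "continuous_on S (\<lambda>y. mollifier h (w - y) *\<^sub>R f y)" for S w
    by (intro continuous_intros continuous_on_compose2[OF continuous_on_mollifier[of UNIV]] continuous_on_subset[OF cont]) auto
  have int: "mollify h f w = integral B (\<lambda>y. mollifier h (w - y) *\<^sub>R f y)" if "w \<in> ball x 1" for w
  proof -
    have 0: "mollifier h (w - y) = 0" if "y \<notin> B" for y
    proof (rule mollifier_eq_0[OF h])
      have "cmod (x - y) \<le> cmod (x - w) + cmod (w - y)"
        using norm_triangle_ineq[of "x - w" "w - y"] by simp
      then show "h \<le> cmod (w - y)"
        using outB[OF that] \<open>w \<in> ball x 1\<close> by (simp add: dist_norm)
    qed
    have "mollify h f w = integral UNIV (\<lambda>y. mollifier h (w - y) *\<^sub>R f y)"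
      unfolding mollify_def
      by (rule integral_lborel[symmetric]) (rule integrable_mollifier_scaleR[OF locally_integrable_continuous[OF cont] h])
    also have "\<dots> = integral UNIV (\<lambda>y. if y \<in> B then mollifier h (w - y) *\<^sub>R f y else 0)"
      using 0 by (intro integral_cong) auto
    also have "\<dots> = integral B (\<lambda>y. mollifier h (w - y) *\<^sub>R f y)"
      by (rule integral_restrict_UNIV)
    finally show ?thesis .
  qed
  have "((\<lambda>w. integral B (\<lambda>y. mollifier h (w - y) *\<^sub>R f y)) has_derivative integral B (D x)) (at x within ball x 1)"
    unfolding B_def
  proof (rule leibniz_rule)
    show "((\<lambda>w. mollifier h (w - y) *\<^sub>R f y) has_derivative blinfun_apply (D w y)) (at w within ball x 1)" for w y
    proof -
      have "((\<lambda>w. mollifier h (w - y)) has_derivative (\<lambda>v. Re v * kx (w - y) + Im v * ky (w - y))) (at w within ball x 1)"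
        by (rule has_derivative_compose[OF _ k(3), of "\<lambda>w. w - y" "\<lambda>v. v", simplified]) (auto intro!: derivative_eq_intros)
      then show ?thesis
        by (auto intro!: derivative_eq_intros simp: D_apply fun_eq_iff)
    qed
    show "(\<lambda>y. mollifier h (w - y) *\<^sub>R f y) integrable_on cbox (x - (h + 2) *\<^sub>R One) (x + (h + 2) *\<^sub>R One)" for w
      by (rule integrable_continuous[OF ckf])
  qed (use contD in \<open>auto simp: B_def\<close>)
  then have "(mollify h f has_derivative integral B (D x)) (at x within ball x 1)"
    by (rule has_derivative_transform[rotated 2]) (auto simp: int)
  then have der: "(mollify h f has_derivative integral B (D x)) (at x)"
    by (simp add: at_within_open[of x "ball x 1"])
  have "blinfun_apply (integral B (D x)) v = Re v *\<^sub>R mollify h fx x + Im v *\<^sub>R mollify h fy x" for v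
  proof -
    have cD: "continuous_on B (D x)"
    proof -
      have "continuous_on B (\<lambda>y. (x, y))" by (intro continuous_intros)
      then have "continuous_on B (\<lambda>y. case (x, y) of (w, y) \<Rightarrow> D w y)"
        by (rule continuous_on_compose2[OF contD]) auto
      then show ?thesis by simp
    qed
    have iD: "D x integrable_on B"
      unfolding B_def by (rule integrable_continuous) (use cD in \<open>simp add: B_def\<close>)
    have "blinfun_apply (integral B (D x)) v = integral B (\<lambda>y. blinfun_apply (D x y) v)"
      using integral_linear[OF iD blinfun.bounded_linear_left[of v]] by (simp add: comp_def)
    also have "\<dots> = integral UNIV (\<lambda>y. if y \<in> B then blinfun_apply (D x y) v else 0)"
      by (rule integral_restrict_UNIV[symmetric])
    also have "\<dots> = integral UNIV (\<lambda>y. (Re v * kx (x - y) + Im v * ky (x - y)) *\<^sub>R f y)"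
      by (intro integral_cong) (use outB k0 in \<open>force simp: D_apply\<close>)
    also have "\<dots> = (\<integral>y. (Re v * kx (x - y) + Im v * ky (x - y)) *\<^sub>R f y \<partial>lborel)"
    proof (rule integral_lborel)
      show "integrable lborel (\<lambda>y. (Re v * kx (x - y) + Im v * ky (x - y)) *\<^sub>R f y)"
        by (rule integrable_compact_support[where c=x and r=h])
           (auto intro!: continuous_intros continuous_on_compose2[OF ck(1)[of UNIV]] continuous_on_compose2[OF ck(2)[of UNIV]]
             continuous_on_subset[OF cont] simp: k0 dist_norm)
    qed
    also have "\<dots> = (\<integral>y. Re v *\<^sub>R (kx (x - y) *\<^sub>R f y) + Im v *\<^sub>R (ky (x - y) *\<^sub>R f y) \<partial>lborel)"
      by (simp add: scaleR_add_left)
    also have "\<dots> = Re v *\<^sub>R (\<integral>y. kx (x - y) *\<^sub>R f y \<partial>lborel) + Im v *\<^sub>R (\<integral>y. ky (x - y) *\<^sub>R f y \<partial>lborel)"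
    proof -
      have "integrable lborel (\<lambda>y. kx (x - y) *\<^sub>R f y)" "integrable lborel (\<lambda>y. ky (x - y) *\<^sub>R f y)"
        by (rule integrable_compact_support[where c=x and r=h];
            auto intro!: continuous_intros continuous_on_compose2[OF ck(1)[of UNIV]] continuous_on_compose2[OF ck(2)[of UNIV]]
             continuous_on_subset[OF cont] simp: k0 dist_norm)+
      then show ?thesis by (simp del: scaleR_scaleR)
    qed
    also have "\<dots> = Re v *\<^sub>R mollify h fx x + Im v *\<^sub>R mollify h fy x"
    proof -
      have "((\<lambda>y. mollifier h (x - y)) has_derivative (\<lambda>v. Re (- v) * kx (x - y) + Im (- v) * ky (x - y))) (at y)" for y
        by (rule has_derivative_compose[OF _ k(3), of "\<lambda>y. x - y" "\<lambda>v. - v"]) (auto intro!: derivative_eq_intros)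
      then have fd: "frechet_derivative (\<lambda>y. mollifier h (x - y)) (at y) = (\<lambda>v. Re (- v) * kx (x - y) + Im (- v) * ky (x - y))" for y
        using frechet_derivative_at by metis
      have t: "test_function UNIV (\<lambda>y. mollifier h (x - y))"
        by (rule test_function_mollifier[OF h]) simp
      have "(\<integral>y. kx (x - y) *\<^sub>R f y \<partial>lborel) = mollify h fx x"
        using weak_x[OF t] by (simp add: fd mollify_def)
      moreover have "(\<integral>y. ky (x - y) *\<^sub>R f y \<partial>lborel) = mollify h fy x"
        using weak_y[OF t] by (simp add: fd mollify_def)
      ultimately show ?thesis by simp
    qed
    finally show ?thesis .
  qed
  then have "blinfun_apply (integral B (D x)) = (\<lambda>v. Re v *\<^sub>R mollify h fx x + Im v *\<^sub>R mollify h fy x)" by auto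
  with der show ?thesis by simp
qed

end

section \<open>Oscillation on balls from mass bounds for the gradient\<close>

lemma norm_diff_le_nn_integral:
  fixes \<gamma> :: "real \<Rightarrow> 'b::euclidean_space"
  assumes ab: "a \<le> b"
    and der: "\<And>t. t \<in> {a..b} \<Longrightarrow> (\<gamma> has_vector_derivative \<gamma>' t) (at t within {a..b})"
    and cont: "continuous_on {a..b} \<gamma>'"
    and le: "\<And>t. t \<in> {a..b} \<Longrightarrow> norm (\<gamma>' t) \<le> N t"
  shows "ennreal (norm (\<gamma> b - \<gamma> a)) \<le> (\<integral>\<^sup>+t. ennreal (N t) * indicator {a..b} t \<partial>lborel)"
proof -
  have ftc: "(\<gamma>' has_integral (\<gamma> b - \<gamma> a)) {a..b}"
    by (rule fundamental_theorem_of_calculus[OF ab]) (use der in auto)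
  have int: "(\<lambda>t. norm (\<gamma>' t)) integrable_on {a..b}"
    by (intro integrable_continuous_interval continuous_intros cont)
  have "norm (\<gamma> b - \<gamma> a) \<le> integral {a..b} (\<lambda>t. norm (\<gamma>' t))"
    using integral_norm_bound_integral[of \<gamma>' "{a..b}" "\<lambda>t. norm (\<gamma>' t)"] ftc int
    by (auto simp: has_integral_iff)
  then have "ennreal (norm (\<gamma> b - \<gamma> a)) \<le> ennreal (integral {a..b} (\<lambda>t. norm (\<gamma>' t)))"
    by (rule ennreal_leI)
  also have "\<dots> = (\<integral>\<^sup>+t. indicator {a..b} t * norm (\<gamma>' t) \<partial>lborel)"
    by (rule nn_integral_has_integral_lebesgue[symmetric]) (use int in \<open>auto simp: integrable_integral\<close>)
  also have "\<dots> \<le> (\<integral>\<^sup>+t. ennreal (N t) * indicator {a..b} t \<partial>lborel)"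
    using le by (intro nn_integral_mono) (auto simp: indicator_def intro: ennreal_leI)
  finally show ?thesis .
qed

definition ball_mass :: "(complex \<Rightarrow> real) \<Rightarrow> complex \<Rightarrow> real \<Rightarrow> ennreal" where
  "ball_mass W x r = (\<integral>\<^sup>+y. ennreal (W y) * indicator (ball x r) y \<partial>lborel)"

lemma nn_integral_affine_complex:
  fixes F :: "complex \<Rightarrow> ennreal"
  assumes [measurable]: "F \<in> borel_measurable borel" and t: "0 < t"
  shows "(\<integral>\<^sup>+y. F (x + t *\<^sub>R y) \<partial>lborel) * ennreal (t\<^sup>2) = (\<integral>\<^sup>+y. F y \<partial>lborel)"
proof -
  have "(\<integral>\<^sup>+y. F y \<partial>lborel) = (\<integral>\<^sup>+y. ennreal (\<bar>t\<bar> ^ DIM(complex)) * F (x + t *\<^sub>R y) \<partial>lborel)"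
    by (subst lborel_affine[of t x]) (use t in \<open>simp_all add: nn_integral_density nn_integral_distr\<close>)
  also have "\<dots> = ennreal (t\<^sup>2) * (\<integral>\<^sup>+y. F (x + t *\<^sub>R y) \<partial>lborel)"
    by (simp add: nn_integral_cmult)
  finally show ?thesis by (simp add: mult.commute)
qed

text \<open>Integrating the gradient along the radii of a ball avoids the Poincare inequality.\<close>

lemma ball_oscillation_C1:
  fixes v p q :: "complex \<Rightarrow> complex"
  assumes der: "\<And>z. (v has_derivative (\<lambda>w. Re w *\<^sub>R p z + Im w *\<^sub>R q z)) (at z)"
    and cp: "continuous_on UNIV p" and cq: "continuous_on UNIV q"
    and r: "0 < r" and m: "0 \<le> m"
    and mass: "\<And>\<rho>. 0 < \<rho> \<Longrightarrow> \<rho> \<le> r \<Longrightarrow> ball_mass (\<lambda>z. cmod (p z) + cmod (q z)) x \<rho> \<le> ennreal (m * \<rho>\<^sup>2)"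
  shows "ball_mass (\<lambda>y. cmod (v y - v x)) x r \<le> ennreal (m * r ^ 3)"
proof -
  define N where "N z = cmod (p z) + cmod (q z)" for z
  have [measurable]: "p \<in> borel_measurable borel" "q \<in> borel_measurable borel"
    using cp cq by (auto intro: borel_measurable_continuous_onI)
  then have N [measurable]: "N \<in> borel_measurable borel" unfolding N_def by measurable
  have cv: "continuous_on UNIV v"
    by (meson continuous_at_imp_continuous_on der has_derivative_continuous)
  then have [measurable]: "v \<in> borel_measurable borel" by (rule borel_measurable_continuous_onI)
  have pt: "ennreal (cmod (v (x + y) - v x)) \<le> (\<integral>\<^sup>+t. ennreal (N (x + t *\<^sub>R y) * r) * indicator {0..1} t \<partial>lborel)"
    if y: "y \<in> ball 0 r" for y
  proof -
    define \<gamma> where "\<gamma> t = v (x + t *\<^sub>R y)" for t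
    have "ennreal (cmod (\<gamma> 1 - \<gamma> 0)) \<le> (\<integral>\<^sup>+t. ennreal (N (x + t *\<^sub>R y) * r) * indicator {0..1} t \<partial>lborel)"
    proof (rule norm_diff_le_nn_integral)
      fix t :: real
      show "(\<gamma> has_vector_derivative (Re y *\<^sub>R p (x + t *\<^sub>R y) + Im y *\<^sub>R q (x + t *\<^sub>R y))) (at t within {0..1})"
        unfolding has_vector_derivative_def \<gamma>_def
        by (rule has_derivative_eq_rhs[OF has_derivative_compose[OF _ der, of "\<lambda>t. x + t *\<^sub>R y" "\<lambda>s. s *\<^sub>R y"]])
           (auto intro!: derivative_eq_intros simp: scaleR_add_right)
      show "cmod (Re y *\<^sub>R p (x + t *\<^sub>R y) + Im y *\<^sub>R q (x + t *\<^sub>R y)) \<le> N (x + t *\<^sub>R y) * r"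
      proof -
        have yr: "\<bar>Re y\<bar> \<le> r" "\<bar>Im y\<bar> \<le> r"
          using y abs_Re_le_cmod[of y] abs_Im_le_cmod[of y] by auto
        have "cmod (Re y *\<^sub>R p (x + t *\<^sub>R y) + Im y *\<^sub>R q (x + t *\<^sub>R y)) \<le> \<bar>Re y\<bar> * cmod (p (x + t *\<^sub>R y)) + \<bar>Im y\<bar> * cmod (q (x + t *\<^sub>R y))"
          by (rule norm_triangle_le) simp
        also have "\<dots> \<le> r * cmod (p (x + t *\<^sub>R y)) + r * cmod (q (x + t *\<^sub>R y))"
          using yr by (intro add_mono mult_right_mono) auto
        finally show ?thesis by (simp add: N_def algebra_simps)
      qed
    qed (auto intro!: continuous_intros continuous_on_compose2[OF cp] continuous_on_compose2[OF cq])
    then show ?thesis by (simp add: \<gamma>_def)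
  qed
  have "ball_mass (\<lambda>y. cmod (v y - v x)) x r = (\<integral>\<^sup>+y. ennreal (cmod (v (x + y) - v x)) * indicator (ball 0 r) y \<partial>lborel)"
  proof -
    have "(\<integral>\<^sup>+y. ennreal (cmod (v (x + 1 *\<^sub>R y) - v x)) * indicator (ball x r) (x + 1 *\<^sub>R y) \<partial>lborel) * ennreal (1\<^sup>2)
      = ball_mass (\<lambda>y. cmod (v y - v x)) x r"
      unfolding ball_mass_def by (rule nn_integral_affine_complex) auto
    moreover have "(indicator (ball x r) (x + y) :: ennreal) = indicator (ball 0 r) y" for y
      by (simp add: indicator_def dist_norm)
    ultimately show ?thesis by simp
  qed
  also have "\<dots> \<le> (\<integral>\<^sup>+y. (\<integral>\<^sup>+t. ennreal (N (x + t *\<^sub>R y) * r) * indicator {0..1} t \<partial>lborel) * indicator (ball 0 r) y \<partial>lborel)"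
    using pt by (intro nn_integral_mono) (auto simp: indicator_def)
  also have "\<dots> = (\<integral>\<^sup>+y. \<integral>\<^sup>+t. ennreal (N (x + t *\<^sub>R y) * r) * indicator {0..1} t * indicator (ball 0 r) y \<partial>lborel \<partial>lborel)"
    by (intro nn_integral_cong nn_integral_multc[symmetric]) measurable
  also have "\<dots> = (\<integral>\<^sup>+t. \<integral>\<^sup>+y. ennreal (N (x + t *\<^sub>R y) * r) * indicator {0..1} t * indicator (ball 0 r) y \<partial>lborel \<partial>lborel)"
    by (rule lborel_pair.Fubini') measurable
  \<comment> \<open>For fixed t > 0 the inner integral is, up to the factor t^2, the gradient mass
    of the ball of radius t r. The hypothesis m (t r)^2 cancels t^2, which is why the mass is
    controlled at all scales below r.\<close>
  also have "\<dots> \<le> (\<integral>\<^sup>+t. ennreal (m * r ^ 3) * indicator {0..1} (t::real) \<partial>lborel)"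
  proof (intro nn_integral_mono_AE)
    have "AE t in lborel. t \<noteq> (0::real)" by (rule AE_lborel_singleton)
    then show "AE t in lborel. (\<integral>\<^sup>+y. ennreal (N (x + t *\<^sub>R y) * r) * indicator {0..1} t * indicator (ball 0 r) y \<partial>lborel)
        \<le> ennreal (m * r ^ 3) * indicator {0..1} (t::real)"
    proof eventually_elim
      fix t :: real assume "t \<noteq> 0"
      show "(\<integral>\<^sup>+y. ennreal (N (x + t *\<^sub>R y) * r) * indicator {0..1} t * indicator (ball 0 r) y \<partial>lborel)
        \<le> ennreal (m * r ^ 3) * indicator {0..1} t"
      proof (cases "t \<in> {0..1}")
        case True
        with \<open>t \<noteq> 0\<close> have t: "0 < t" "t \<le> 1" by auto
        have "(\<integral>\<^sup>+y. ennreal (N (x + t *\<^sub>R y)) * indicator (ball x (t * r)) (x + t *\<^sub>R y) \<partial>lborel) * ennreal (t\<^sup>2)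
          = ball_mass N x (t * r)"
          unfolding ball_mass_def by (rule nn_integral_affine_complex[OF _ t(1)]) measurable
        also have "\<dots> \<le> ennreal (m * (t * r)\<^sup>2)"
          using mass[of "t * r"] t r by (simp add: N_def[abs_def] mult_left_le_one_le)
        also have "\<dots> = ennreal (m * r\<^sup>2) * ennreal (t\<^sup>2)"
          using m by (simp add: ennreal_mult[symmetric] power_mult_distrib mult_ac)
        finally have *: "(\<integral>\<^sup>+y. ennreal (N (x + t *\<^sub>R y)) * indicator (ball x (t * r)) (x + t *\<^sub>R y) \<partial>lborel) \<le> ennreal (m * r\<^sup>2)"
          using t by (simp add: ennreal_mult_le_mult_iff mult.commute[of _ "ennreal (t\<^sup>2)"])
        have ind: "(indicator (ball x (t * r)) (x + t *\<^sub>R y) :: ennreal) = indicator (ball 0 r) y" for y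
          using t by (simp add: indicator_def dist_norm)
        have "(\<integral>\<^sup>+y. ennreal (N (x + t *\<^sub>R y) * r) * indicator {0..1} t * indicator (ball 0 r) y \<partial>lborel)
          = (\<integral>\<^sup>+y. ennreal r * (ennreal (N (x + t *\<^sub>R y)) * indicator (ball 0 r) y) \<partial>lborel)"
          using True r by (intro nn_integral_cong) (simp add: N_def ennreal_mult mult_ac)
        also have "\<dots> = ennreal r * (\<integral>\<^sup>+y. ennreal (N (x + t *\<^sub>R y)) * indicator (ball 0 r) y \<partial>lborel)"
          by (rule nn_integral_cmult) measurable
        also have "\<dots> \<le> ennreal r * ennreal (m * r\<^sup>2)"
          using * by (intro mult_left_mono) (auto simp: ind)
        also have "\<dots> = ennreal (m * r ^ 3)"
          using r m by (simp add: ennreal_mult[symmetric] power3_eq_cube power2_eq_square mult_ac)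
        finally show ?thesis using True by simp
      qed simp
    qed
  qed
  also have "\<dots> = ennreal (m * r ^ 3)" by (simp add: nn_integral_cmult_indicator)
  finally show ?thesis .
qed

lemma mollify_pair_le:
  fixes p q :: "complex \<Rightarrow> complex"
  assumes p: "locally_integrable p" and q: "locally_integrable q" and h: "0 < h"
  shows "ennreal (cmod (mollify h p z) + cmod (mollify h q z))
    \<le> (\<integral>\<^sup>+y. ennreal (mollifier h (z - y)) * ennreal (cmod (p y) + cmod (q y)) \<partial>lborel)"
proof -
  note [measurable] = locally_integrable_measurable[OF p] locally_integrable_measurable[OF q]
  have "ennreal (cmod (mollify h p z) + cmod (mollify h q z)) = ennreal (cmod (mollify h p z)) + ennreal (cmod (mollify h q z))"
    by simp
  also have "\<dots> \<le> (\<integral>\<^sup>+y. ennreal (mollifier h (z - y)) * ennreal (norm (p y)) \<partial>lborel) + (\<integral>\<^sup>+y. ennreal (mollifier h (z - y)) * ennreal (norm (q y)) \<partial>lborel)"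
    by (intro add_mono norm_mollify_le p q h)
  also have "\<dots> = (\<integral>\<^sup>+y. ennreal (mollifier h (z - y)) * ennreal (norm (p y)) + ennreal (mollifier h (z - y)) * ennreal (norm (q y)) \<partial>lborel)"
    by (rule nn_integral_add[symmetric]) measurable
  also have "\<dots> = (\<integral>\<^sup>+y. ennreal (mollifier h (z - y)) * ennreal (cmod (p y) + cmod (q y)) \<partial>lborel)"
    by (simp add: distrib_left)
  finally show ?thesis .
qed

text \<open>Two regimes, uniform in h. If h <= \<rho>, Fubini moves the kernel away and only the
  mass of the ball of radius 2 \<rho> remains. If h > \<rho>, the kernel bound 3/h^2 and the mass m
  (2h)^2 give the pointwise bound 12 m, and the area of the ball contributes pi \<rho>^2.\<close>

lemma mollify_pair_mass:
  fixes p q :: "complex \<Rightarrow> complex"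
  assumes p: "locally_integrable p" and q: "locally_integrable q"
    and h: "0 < h" "h \<le> r" and m: "0 \<le> m" and \<rho>: "0 < \<rho>" "\<rho> \<le> r"
    and mass: "\<And>\<rho>. 0 < \<rho> \<Longrightarrow> \<rho> \<le> 2 * r \<Longrightarrow> ball_mass (\<lambda>z. cmod (p z) + cmod (q z)) x \<rho> \<le> ennreal (m * \<rho>\<^sup>2)"
  shows "ball_mass (\<lambda>z. cmod (mollify h p z) + cmod (mollify h q z)) x \<rho> \<le> ennreal (12 * pi * m * \<rho>\<^sup>2)"
proof -
  define W where "W z = cmod (p z) + cmod (q z)" for z
  note [measurable] = locally_integrable_measurable[OF p] locally_integrable_measurable[OF q]
  have W [measurable]: "W \<in> borel_measurable borel" unfolding W_def by measurable
  have pt: "ennreal (cmod (mollify h p z) + cmod (mollify h q z)) \<le> (\<integral>\<^sup>+y. ennreal (mollifier h (z - y)) * ennreal (W y) \<partial>lborel)" for z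
    unfolding W_def by (rule mollify_pair_le[OF p q h(1)])
  show ?thesis
  proof (cases "h \<le> \<rho>")
    case True
    have "ball_mass (\<lambda>z. cmod (mollify h p z) + cmod (mollify h q z)) x \<rho>
      \<le> (\<integral>\<^sup>+z. (\<integral>\<^sup>+y. ennreal (mollifier h (z - y)) * ennreal (W y) \<partial>lborel) * indicator (ball x \<rho>) z \<partial>lborel)"
      unfolding ball_mass_def using pt by (intro nn_integral_mono mult_right_mono) auto
    also have "\<dots> = (\<integral>\<^sup>+z. \<integral>\<^sup>+y. ennreal (mollifier h (z - y)) * ennreal (W y) * indicator (ball x \<rho>) z \<partial>lborel \<partial>lborel)"
      by (intro nn_integral_cong nn_integral_multc[symmetric]) measurable
    also have "\<dots> = (\<integral>\<^sup>+y. \<integral>\<^sup>+z. ennreal (mollifier h (z - y)) * ennreal (W y) * indicator (ball x \<rho>) z \<partial>lborel \<partial>lborel)"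
      by (rule lborel_pair.Fubini') measurable
    also have "\<dots> \<le> (\<integral>\<^sup>+y. \<integral>\<^sup>+z. ennreal (mollifier h (z - y)) * (ennreal (W y) * indicator (ball x (2 * \<rho>)) y) \<partial>lborel \<partial>lborel)"
    proof (intro nn_integral_mono)
      fix y z
      show "ennreal (mollifier h (z - y)) * ennreal (W y) * indicator (ball x \<rho>) z
        \<le> ennreal (mollifier h (z - y)) * (ennreal (W y) * indicator (ball x (2 * \<rho>)) y)"
      proof (cases "cmod (z - y) < h \<and> z \<in> ball x \<rho>")
        case T: True
        then have "y \<in> ball x (2 * \<rho>)"
          using dist_triangle[of x y z] True by (simp add: dist_norm norm_minus_commute)
        then show ?thesis by (simp add: mult.assoc mult_left_mono indicator_def)
      next
        case False
        then show ?thesis using mollifier_eq_0[OF h(1), of "z - y"] by (auto simp: not_less)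
      qed
    qed
    also have "\<dots> = (\<integral>\<^sup>+y. ennreal (W y) * indicator (ball x (2 * \<rho>)) y \<partial>lborel)"
    proof (intro nn_integral_cong)
      fix y
      have "(\<integral>\<^sup>+z. ennreal (mollifier h (z - y)) \<partial>lborel) = (\<integral>\<^sup>+z. ennreal (mollifier h (y - z)) \<partial>lborel)"
        by (intro nn_integral_cong arg_cong[where f=ennreal]) (metis minus_diff_eq mollifier_even)
      also have "\<dots> = 1"
        by (simp add: nn_integral_reflect_complex[of "\<lambda>y. ennreal (mollifier h y)"] nn_integral_mollifier h)
      finally show "(\<integral>\<^sup>+z. ennreal (mollifier h (z - y)) * (ennreal (W y) * indicator (ball x (2 * \<rho>)) y) \<partial>lborel)
        = ennreal (W y) * indicator (ball x (2 * \<rho>)) y"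
        by (simp add: nn_integral_multc)
    qed
    also have "\<dots> \<le> ennreal (m * (2 * \<rho>)\<^sup>2)"
      using mass[of "2 * \<rho>"] \<rho> by (simp add: ball_mass_def W_def[abs_def])
    also have "\<dots> \<le> ennreal (12 * pi * m * \<rho>\<^sup>2)"
    proof (rule ennreal_leI)
      have "4 * (m * \<rho>\<^sup>2) \<le> 12 * pi * (m * \<rho>\<^sup>2)"
        using pi_gt3 m by (intro mult_right_mono) auto
      then show "m * (2 * \<rho>)\<^sup>2 \<le> 12 * pi * m * \<rho>\<^sup>2"
        by (simp add: power_mult_distrib mult_ac)
    qed
    finally show ?thesis .
  next
    case False
    have "ennreal (cmod (mollify h p z) + cmod (mollify h q z)) \<le> ennreal (12 * m)" if z: "z \<in> ball x \<rho>" for z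
    proof -
      have "ennreal (cmod (mollify h p z) + cmod (mollify h q z)) \<le> (\<integral>\<^sup>+y. ennreal (mollifier h (z - y)) * ennreal (W y) \<partial>lborel)"
        by (rule pt)
      also have "\<dots> \<le> (\<integral>\<^sup>+y. ennreal (3 / h\<^sup>2) * (ennreal (W y) * indicator (ball x (2 * h)) y) \<partial>lborel)"
      proof (rule nn_integral_mono)
        fix y
        show "ennreal (mollifier h (z - y)) * ennreal (W y) \<le> ennreal (3 / h\<^sup>2) * (ennreal (W y) * indicator (ball x (2 * h)) y)"
        proof (cases "cmod (z - y) < h")
          case True
          then have "y \<in> ball x (2 * h)"
            using dist_triangle[of x y z] z False by (simp add: dist_norm norm_minus_commute)
          then show ?thesis
            using mollifier_le[OF h(1), of "z - y"] by (simp add: mult_right_mono ennreal_leI)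
        next
          case False
          then show ?thesis using mollifier_eq_0[OF h(1), of "z - y"] by (auto simp: not_less)
        qed
      qed
      also have "\<dots> = ennreal (3 / h\<^sup>2) * ball_mass W x (2 * h)"
        unfolding ball_mass_def by (rule nn_integral_cmult) measurable
      also have "\<dots> \<le> ennreal (3 / h\<^sup>2) * ennreal (m * (2 * h)\<^sup>2)"
        using mass[of "2 * h"] h by (intro mult_left_mono) (auto simp: W_def[abs_def])
      also have "\<dots> = ennreal (12 * m)"
        using h m by (simp add: ennreal_mult[symmetric] power_mult_distrib)
      finally show ?thesis .
    qed
    then have "ball_mass (\<lambda>z. cmod (mollify h p z) + cmod (mollify h q z)) x \<rho> \<le> (\<integral>\<^sup>+z. ennreal (12 * m) * indicator (ball x \<rho>) z \<partial>lborel)"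
      unfolding ball_mass_def by (intro nn_integral_mono) (auto simp: indicator_def)
    also have "\<dots> = ennreal (12 * m) * ennreal (pi * \<rho>\<^sup>2)"
      using \<rho> by (simp add: nn_integral_cmult_indicator measure_lborel_ball_complex)
    also have "\<dots> = ennreal (12 * pi * m * \<rho>\<^sup>2)"
      using m by (simp add: ennreal_mult[symmetric] mult_ac)
    finally show ?thesis .
  qed
qed

lemma ball_mass_shift:
  fixes g :: "complex \<Rightarrow> complex"
  assumes [measurable]: "g \<in> borel_measurable borel" and r: "0 \<le> r"
  shows "ball_mass (\<lambda>y. cmod (g y - c')) x r \<le> ball_mass (\<lambda>y. cmod (g y - c)) x r + ennreal (cmod (c - c') * (pi * r\<^sup>2))"
proof -
  have "ball_mass (\<lambda>y. cmod (g y - c')) x r \<le>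
     (\<integral>\<^sup>+y. ennreal (cmod (g y - c)) * indicator (ball x r) y + ennreal (cmod (c - c')) * indicator (ball x r) y \<partial>lborel)"
    unfolding ball_mass_def
  proof (rule nn_integral_mono)
    fix y
    have "ennreal (cmod (g y - c')) \<le> ennreal (cmod (g y - c)) + ennreal (cmod (c - c'))"
      using norm_triangle_ineq[of "g y - c" "c - c'"] by (simp add: ennreal_plus[symmetric] del: ennreal_plus)
    then show "ennreal (cmod (g y - c')) * indicator (ball x r) y \<le> ennreal (cmod (g y - c)) * indicator (ball x r) y + ennreal (cmod (c - c')) * indicator (ball x r) y"
      by (auto simp: indicator_def)
  qed
  also have "\<dots> = ball_mass (\<lambda>y. cmod (g y - c)) x r + (\<integral>\<^sup>+y. ennreal (cmod (c - c')) * indicator (ball x r) y \<partial>lborel)"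
    unfolding ball_mass_def by (rule nn_integral_add) measurable
  also have "(\<integral>\<^sup>+y. ennreal (cmod (c - c')) * indicator (ball x r) y \<partial>lborel) = ennreal (cmod (c - c') * (pi * r\<^sup>2))"
    using r by (simp add: nn_integral_cmult_indicator measure_lborel_ball_complex ennreal_mult)
  finally show ?thesis .
qed

text \<open>The ball of radius r/2 about the midpoint lies in both balls. On it |c - c'| <= |g - c|
  + |g - c'|, which is integrated.\<close>

lemma ball_mass_two_points:
  fixes g :: "complex \<Rightarrow> complex"
  assumes [measurable]: "g \<in> borel_measurable borel" and xy: "dist x y = r" "0 < r"
    and A: "ball_mass (\<lambda>y. cmod (g y - c)) x r \<le> ennreal A" "0 \<le> A"
    and B: "ball_mass (\<lambda>y. cmod (g y - c')) y r \<le> ennreal B" "0 \<le> B"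
  shows "cmod (c - c') * (pi * (r/2)\<^sup>2) \<le> A + B"
proof -
  define w where "w = (x + y) /\<^sub>R 2"
  have dw: "dist x w = r / 2" "dist y w = r / 2"
  proof -
    have "x - w = (x - y) /\<^sub>R 2" "y - w = (y - x) /\<^sub>R 2"
      by (simp_all add: w_def scaleR_conv_of_real field_simps)
    then show "dist x w = r / 2" "dist y w = r / 2"
      using xy by (auto simp: dist_norm norm_minus_commute)
  qed
  have sub: "ball w (r / 2) \<subseteq> ball x r" "ball w (r / 2) \<subseteq> ball y r"
  proof (safe)
    fix z assume z: "z \<in> ball w (r / 2)"
    show "z \<in> ball x r" "z \<in> ball y r"
      using z dw dist_triangle[of x z w] dist_triangle[of y z w] by auto
  qed
  have "ennreal (cmod (c - c') * (pi * (r/2)\<^sup>2)) = (\<integral>\<^sup>+z. ennreal (cmod (c - c')) * indicator (ball w (r/2)) z \<partial>lborel)"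
    using xy by (simp add: nn_integral_cmult_indicator measure_lborel_ball_complex ennreal_mult)
  also have "\<dots> \<le> (\<integral>\<^sup>+z. ennreal (cmod (g z - c)) * indicator (ball x r) z + ennreal (cmod (g z - c')) * indicator (ball y r) z \<partial>lborel)"
  proof (rule nn_integral_mono)
    fix z
    show "ennreal (cmod (c - c')) * indicator (ball w (r/2)) z \<le> ennreal (cmod (g z - c)) * indicator (ball x r) z + ennreal (cmod (g z - c')) * indicator (ball y r) z"
    proof (cases "z \<in> ball w (r/2)")
      case True
      have "ennreal (cmod (c - c')) \<le> ennreal (cmod (g z - c)) + ennreal (cmod (g z - c'))"
        using norm_triangle_ineq4[of "g z - c'" "g z - c"] by (simp add: ennreal_plus[symmetric] del: ennreal_plus)
      then show ?thesis
        using True sub by (simp add: subset_iff)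
    qed simp
  qed
  also have "\<dots> = ball_mass (\<lambda>y. cmod (g y - c)) x r + ball_mass (\<lambda>y. cmod (g y - c')) y r"
    unfolding ball_mass_def by (rule nn_integral_add) measurable
  also have "\<dots> \<le> ennreal A + ennreal B"
    by (intro add_mono A B)
  finally show ?thesis using A B by (simp add: ennreal_plus[symmetric] del: ennreal_plus)
qed

context sobolev_map
begin

text \<open>The C1 estimate is applied to the mollification of f minus the linear map with partials
  c1 and c2. Its constants do not depend on h, and mollifications of the continuous f converge
  locally uniformly.\<close>

lemma ball_oscillation:
  fixes c1 c2 :: complex
  assumes r: "0 < r" and m: "0 \<le> m"
    and mass: "\<And>\<rho>. 0 < \<rho> \<Longrightarrow> \<rho> \<le> 2 * r \<Longrightarrow> ball_mass (\<lambda>z. cmod (fx z - c1) + cmod (fy z - c2)) x \<rho> \<le> ennreal (m * \<rho>\<^sup>2)"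
  defines "u \<equiv> (\<lambda>z. f z - (Re z *\<^sub>R c1 + Im z *\<^sub>R c2))"
  shows "ball_mass (\<lambda>y. cmod (u y - u x)) x r \<le> ennreal (12 * pi * m * r ^ 3)"
proof -
  have [measurable]: "u \<in> borel_measurable borel"
    unfolding u_def by measurable
  have main: "ball_mass (\<lambda>y. cmod (u y - u x)) x r \<le> ennreal (12 * pi * m * r ^ 3) + ennreal (2 * e * (pi * r\<^sup>2))" if e: "0 < e" for e
  proof -
    obtain h0 where h0: "0 < h0" "\<And>h y. 0 < h \<Longrightarrow> h < h0 \<Longrightarrow> cmod y \<le> cmod x + r \<Longrightarrow> cmod (mollify h f y - f y) \<le> e"
      using mollify_approx[OF cont e] by metis
    define h where "h = min (h0 / 2) r"
    have h: "0 < h" "h < h0" "h \<le> r" using h0 r by (auto simp: h_def)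
    define v where "v z = mollify h f z - (Re z *\<^sub>R c1 + Im z *\<^sub>R c2)" for z
    have lx: "locally_integrable (\<lambda>z. fx z - c1)" and ly: "locally_integrable (\<lambda>z. fy z - c2)"
      by (rule locally_integrable_bound[OF locally_integrable_fx locally_integrable_const[of c1]];
          auto intro: norm_triangle_ineq4)
         (rule locally_integrable_bound[OF locally_integrable_fy locally_integrable_const[of c2]];
          auto intro: norm_triangle_ineq4)
    have "ball_mass (\<lambda>y. cmod (v y - v x)) x r \<le> ennreal (12 * pi * m * r ^ 3)"
    proof (rule ball_oscillation_C1[where p="mollify h (\<lambda>z. fx z - c1)" and q="mollify h (\<lambda>z. fy z - c2)"])
      show "(v has_derivative (\<lambda>w. Re w *\<^sub>R mollify h (\<lambda>z. fx z - c1) z + Im w *\<^sub>R mollify h (\<lambda>z. fy z - c2) z)) (at z)" for z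
        unfolding v_def mollify_diff_const[OF locally_integrable_fx h(1), symmetric] mollify_diff_const[OF locally_integrable_fy h(1), symmetric]
        by (auto intro!: derivative_eq_intros mollify_has_derivative[OF h(1)] simp: algebra_simps)
      show "ball_mass (\<lambda>z. cmod (mollify h (\<lambda>z. fx z - c1) z) + cmod (mollify h (\<lambda>z. fy z - c2) z)) x \<rho> \<le> ennreal (12 * pi * m * \<rho>\<^sup>2)"
        if "0 < \<rho>" "\<rho> \<le> r" for \<rho>
        by (rule mollify_pair_mass[OF lx ly h(1) h(3) m that mass])
    qed (use r m lx ly h in \<open>auto intro: continuous_on_mollify\<close>)
    moreover have "ball_mass (\<lambda>y. cmod (u y - u x)) x r \<le> ball_mass (\<lambda>y. cmod (v y - v x)) x r + ennreal (2 * e * (pi * r\<^sup>2))"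
    proof -
      have [measurable]: "v \<in> borel_measurable borel"
        unfolding v_def
        by (intro borel_measurable_diff borel_measurable_continuous_onI[OF continuous_on_mollify]
            locally_integrable_continuous cont h) measurable
      have "ball_mass (\<lambda>y. cmod (u y - u x)) x r \<le>
        (\<integral>\<^sup>+y. ennreal (cmod (v y - v x)) * indicator (ball x r) y + ennreal (2 * e) * indicator (ball x r) y \<partial>lborel)"
        unfolding ball_mass_def
      proof (rule nn_integral_mono)
        fix y
        show "ennreal (cmod (u y - u x)) * indicator (ball x r) y \<le> ennreal (cmod (v y - v x)) * indicator (ball x r) y + ennreal (2 * e) * indicator (ball x r) y"
        proof (cases "y \<in> ball x r")
          case True
          then have "cmod y \<le> cmod x + r"
            using norm_triangle_sub[of y x] by (simp add: dist_norm norm_minus_commute)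
          then have "cmod (mollify h f y - f y) \<le> e" "cmod (mollify h f x - f x) \<le> e"
            using h0 h r by auto
          moreover have "u y - u x = (v y - v x) - (mollify h f y - f y) + (mollify h f x - f x)"
            by (simp add: u_def v_def)
          then have "cmod (u y - u x) = cmod ((v y - v x) - (mollify h f y - f y) + (mollify h f x - f x))"
            by (rule arg_cong)
          ultimately have "cmod (u y - u x) \<le> cmod (v y - v x) + 2 * e"
            using norm_triangle_ineq[of "(v y - v x) - (mollify h f y - f y)" "mollify h f x - f x"]
              norm_triangle_ineq4[of "v y - v x" "mollify h f y - f y"] by linarith
          then show ?thesis
            using True e by (simp add: ennreal_plus[symmetric] ennreal_leI del: ennreal_plus)
        qed simp
      qed
      also have "\<dots> = ball_mass (\<lambda>y. cmod (v y - v x)) x r + (\<integral>\<^sup>+y. ennreal (2 * e) * indicator (ball x r) y \<partial>lborel)"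
        unfolding ball_mass_def by (rule nn_integral_add) measurable
      also have "(\<integral>\<^sup>+y. ennreal (2 * e) * indicator (ball x r) y \<partial>lborel) = ennreal (2 * e * (pi * r\<^sup>2))"
        using r e by (simp add: nn_integral_cmult_indicator measure_lborel_ball_complex ennreal_mult)
      finally show ?thesis .
    qed
    ultimately show ?thesis
      by (meson add_right_mono order_trans)
  qed
  show ?thesis
  proof (rule ennreal_le_epsilon)
    fix e :: real assume e: "0 < e"
    have "ball_mass (\<lambda>y. cmod (u y - u x)) x r \<le> ennreal (12 * pi * m * r ^ 3) + ennreal (2 * (e / (2 * (pi * r\<^sup>2))) * (pi * r\<^sup>2))"
      using e r by (intro main) auto
    also have "2 * (e / (2 * (pi * r\<^sup>2))) * (pi * r\<^sup>2) = e"
      using r by simp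
    finally show "ball_mass (\<lambda>y. cmod (u y - u x)) x r \<le> ennreal (12 * pi * m * r ^ 3) + ennreal e" .
  qed
qed

text \<open>Comparison of the two averages over the common ball of radius r/2. The constant is (12
  pi + 12 pi) m r^3 / (pi r^2/4) = 96 m r.\<close>

lemma two_point_estimate:
  fixes c1 c2 :: complex
  assumes r: "0 < r" "dist x y = r" and m: "0 \<le> m"
    and massx: "\<And>\<rho>. 0 < \<rho> \<Longrightarrow> \<rho> \<le> 2 * r \<Longrightarrow> ball_mass (\<lambda>z. cmod (fx z - c1) + cmod (fy z - c2)) x \<rho> \<le> ennreal (m * \<rho>\<^sup>2)"
    and massy: "\<And>\<rho>. 0 < \<rho> \<Longrightarrow> \<rho> \<le> 2 * r \<Longrightarrow> ball_mass (\<lambda>z. cmod (fx z - c1) + cmod (fy z - c2)) y \<rho> \<le> ennreal (m * \<rho>\<^sup>2)"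
  shows "cmod (f y - f x - (Re (y - x) *\<^sub>R c1 + Im (y - x) *\<^sub>R c2)) \<le> 96 * m * cmod (y - x)"
proof -
  define u where "u z = f z - (Re z *\<^sub>R c1 + Im z *\<^sub>R c2)" for z
  have [measurable]: "u \<in> borel_measurable borel"
    unfolding u_def by measurable
  have "cmod (u x - u y) * (pi * (r/2)\<^sup>2) \<le> 12 * pi * m * r ^ 3 + 12 * pi * m * r ^ 3"
    by (rule ball_mass_two_points[where g=u and x=x and y=y])
       (use r m ball_oscillation[OF r(1) m massx] ball_oscillation[OF r(1) m massy] in \<open>auto simp: u_def\<close>)
  then have "cmod (u x - u y) * (pi * r\<^sup>2) \<le> 96 * m * r * (pi * r\<^sup>2)"
    by (simp add: power_divide power2_eq_square power3_eq_cube mult_ac)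
  then have "cmod (u x - u y) \<le> 96 * m * r"
    using r by (simp add: mult_le_cancel_right)
  moreover have "f y - f x - (Re (y - x) *\<^sub>R c1 + Im (y - x) *\<^sub>R c2) = - (u x - u y)"
    by (simp add: u_def algebra_simps)
  ultimately show ?thesis
    using r by (simp add: dist_norm norm_minus_commute)
qed

end

subsection \<open>The area inequality for Sobolev homeomorphisms\<close>

text \<open>Egorov's argument for sets: continuity from above inside a ball of finite measure makes
  the j-th exceptional set smaller than e/2^(j+1), and these bounds sum to e.\<close>

lemma egorov_lborel:
  fixes A :: "nat \<Rightarrow> nat \<Rightarrow> complex set"
  assumes meas [measurable]: "\<And>j k. A j k \<in> sets borel" and inc: "\<And>j. incseq (A j)"
    and ae: "AE x in lborel. \<forall>j. \<exists>k. x \<in> A j k" and e: "0 < e"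
  obtains \<kappa> :: "nat \<Rightarrow> nat" where "emeasure lborel (ball 0 N - (\<Inter>j. A j (\<kappa> j))) \<le> ennreal e"
proof -
  have "\<exists>k. emeasure lborel (ball 0 N - A j k) \<le> ennreal (e * (1/2) ^ Suc j)" for j
  proof -
    have "(\<lambda>k. emeasure lborel (ball 0 N - A j k)) \<longlonglongrightarrow> emeasure lborel (\<Inter>k. ball 0 N - A j k)"
    proof (rule Lim_emeasure_decseq)
      show "decseq (\<lambda>k. ball 0 N - A j k)"
        using inc[of j] by (auto simp: decseq_def incseq_def)
      show "emeasure lborel (ball 0 N - A j k) \<noteq> \<infinity>" for k
      proof -
        have "emeasure lborel (ball 0 N - A j k) \<le> emeasure lborel (ball (0::complex) N)"
          by (rule emeasure_mono) auto
        also have "\<dots> < \<infinity>" by (rule emeasure_lborel_ball_finite)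
        finally show ?thesis by simp
      qed
    qed auto
    moreover have "emeasure lborel (\<Inter>k. ball 0 N - A j k) = 0"
    proof -
      have "AE x in lborel. x \<notin> (\<Inter>k. ball 0 N - A j k)"
        using ae by eventually_elim auto
      moreover have "(\<Inter>k. ball 0 N - A j k) \<in> sets lborel"
        by measurable
      ultimately show ?thesis
        using AE_iff_null_sets[of "\<Inter>k. ball 0 N - A j k" lborel] by (auto simp: null_sets_def)
    qed
    ultimately have "\<forall>\<^sub>F k in sequentially. emeasure lborel (ball 0 N - A j k) < ennreal (e * (1/2) ^ Suc j)"
      using e by (intro order_tendstoD(2)) auto
    then show ?thesis
      by (meson eventually_sequentially less_imp_le order_refl)
  qed
  then obtain \<kappa> where \<kappa>: "\<And>j. emeasure lborel (ball 0 N - A j (\<kappa> j)) \<le> ennreal (e * (1/2) ^ Suc j)" by metis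
  have "emeasure lborel (ball 0 N - (\<Inter>j. A j (\<kappa> j))) \<le> emeasure lborel (\<Union>j. ball 0 N - A j (\<kappa> j))"
    by (rule emeasure_mono) auto
  also have "\<dots> \<le> (\<Sum>j. emeasure lborel (ball 0 N - A j (\<kappa> j)))"
    by (rule emeasure_subadditive_countably) auto
  also have "\<dots> \<le> (\<Sum>j. ennreal (e * (1/2) ^ Suc j))"
    by (rule suminf_le[OF \<kappa>]) auto
  also have "\<dots> = ennreal (\<Sum>j. e * (1/2) ^ Suc j)"
  proof (rule suminf_ennreal2)
    show "summable (\<lambda>j. e * (1/2) ^ Suc j)"
      using sums_mult[OF power_half_series, of e] by (simp add: sums_iff)
  qed (use e in auto)
  also have "(\<Sum>j. e * (1/2) ^ Suc j) = e"
    using sums_mult[OF power_half_series, of e] by (simp add: sums_iff)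
  finally show ?thesis by (rule that)
qed

text \<open>Points whose averages of |g y - g x| over all balls of radius below 1/(k+1) are at most
  about 3/(j+1). The detour through a countable set of constants q makes the set Borel; replacing q
  by g x costs the third summand of size 1/(j+1).\<close>

definition density_set :: "(complex \<Rightarrow> complex) \<Rightarrow> nat \<Rightarrow> nat \<Rightarrow> complex set" where
  "density_set g j k = (\<Union>q\<in>rational_points. {x. cmod (g x - q) < 1 / real (Suc j)} \<inter>
     {x. \<forall>\<rho>. 0 < \<rho> \<and> \<rho> < 1 / real (Suc k) \<longrightarrow>
        ball_mass (\<lambda>y. cmod (g y - q)) x \<rho> \<le> ennreal (2 / real (Suc j) * (pi * \<rho>\<^sup>2))})"

lemma density_set_measurable [measurable]:
  assumes [measurable]: "g \<in> borel_measurable borel"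
  shows "density_set g j k \<in> sets borel"
proof -
  have sets: "{x. \<forall>\<rho>. 0 < \<rho> \<and> \<rho> < 1 / real (Suc k) \<longrightarrow>
        ball_mass (\<lambda>y. cmod (g y - q)) x \<rho> \<le> ennreal (2 / real (Suc j) * (pi * \<rho>\<^sup>2))} \<in> sets borel" for q
  proof -
  let ?\<mu> = "density lborel (\<lambda>y. ennreal (cmod (g y - q)))"
  have mass: "ball_mass (\<lambda>y. cmod (g y - q)) x r = emeasure ?\<mu> (ball x r)" for x r
    by (simp add: ball_mass_def emeasure_density)
  have "open {x. \<exists>r. 0 < r \<and> r < 1 / real (Suc k) \<and> ennreal (2 / real (Suc j) * (pi * r\<^sup>2)) < emeasure ?\<mu> (ball x r)}"
    by (rule open_mass_gt) simp
  moreover have "{x. \<forall>\<rho>. 0 < \<rho> \<and> \<rho> < 1 / real (Suc k) \<longrightarrow>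
        ball_mass (\<lambda>y. cmod (g y - q)) x \<rho> \<le> ennreal (2 / real (Suc j) * (pi * \<rho>\<^sup>2))}
     = - {x. \<exists>r. 0 < r \<and> r < 1 / real (Suc k) \<and> ennreal (2 / real (Suc j) * (pi * r\<^sup>2)) < emeasure ?\<mu> (ball x r)}"
    unfolding mass by (auto simp: not_less)
  ultimately show "{x. \<forall>\<rho>. 0 < \<rho> \<and> \<rho> < 1 / real (Suc k) \<longrightarrow>
        ball_mass (\<lambda>y. cmod (g y - q)) x \<rho> \<le> ennreal (2 / real (Suc j) * (pi * \<rho>\<^sup>2))} \<in> sets borel"
    by simp
  qed
  have "{x. cmod (g x - q) < 1 / real (Suc j)} \<in> sets borel" for q by measurable
  then show ?thesis
    unfolding density_set_def using sets
    by (intro sets.countable_UN'[OF countable_rational_points] image_subsetI sets.Int) auto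
qed

lemma density_setD:
  assumes [measurable]: "g \<in> borel_measurable borel" and x: "x \<in> density_set g j k" and \<rho>: "0 < \<rho>" "\<rho> < 1 / real (Suc k)"
  shows "ball_mass (\<lambda>y. cmod (g y - g x)) x \<rho> \<le> ennreal (3 / real (Suc j) * (pi * \<rho>\<^sup>2))"
proof -
  obtain q where q: "cmod (g x - q) < 1 / real (Suc j)"
    "ball_mass (\<lambda>y. cmod (g y - q)) x \<rho> \<le> ennreal (2 / real (Suc j) * (pi * \<rho>\<^sup>2))"
    using x \<rho> unfolding density_set_def by blast
  have "ball_mass (\<lambda>y. cmod (g y - g x)) x \<rho> \<le> ball_mass (\<lambda>y. cmod (g y - q)) x \<rho> + ennreal (cmod (q - g x) * (pi * \<rho>\<^sup>2))"
    using \<rho> by (intro ball_mass_shift) auto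
  also have "\<dots> \<le> ennreal (2 / real (Suc j) * (pi * \<rho>\<^sup>2)) + ennreal (1 / real (Suc j) * (pi * \<rho>\<^sup>2))"
    using q by (intro add_mono ennreal_leI mult_right_mono) (auto simp: norm_minus_commute)
  also have "\<dots> = ennreal (3 / real (Suc j) * (pi * \<rho>\<^sup>2))"
    by (subst ennreal_plus[symmetric]) (auto simp: add_divide_distrib[symmetric] distrib_right[symmetric])
  finally show ?thesis .
qed

lemma density_set_incseq: "incseq (density_set g j)"
proof (rule incseq_SucI, rule subsetI)
  fix k x assume "x \<in> density_set g j k"
  then obtain q where q: "q \<in> rational_points" "cmod (g x - q) < 1 / real (Suc j)"
    "\<And>\<rho>. 0 < \<rho> \<Longrightarrow> \<rho> < 1 / real (Suc k) \<Longrightarrow> ball_mass (\<lambda>y. cmod (g y - q)) x \<rho> \<le> ennreal (2 / real (Suc j) * (pi * \<rho>\<^sup>2))"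
    unfolding density_set_def by blast
  have "1 / real (Suc (Suc k)) \<le> 1 / real (Suc k)" by (simp add: field_simps)
  then have "ball_mass (\<lambda>y. cmod (g y - q)) x \<rho> \<le> ennreal (2 / real (Suc j) * (pi * \<rho>\<^sup>2))"
    if "0 < \<rho>" "\<rho> < 1 / real (Suc (Suc k))" for \<rho>
    using q(3)[of \<rho>] that by linarith
  then show "x \<in> density_set g j (Suc k)"
    using q unfolding density_set_def by blast
qed

lemma density_set_AE:
  assumes g: "locally_integrable g"
  shows "AE x in lborel. \<forall>j. \<exists>k. x \<in> density_set g j k"
  using lebesgue_points_AE[OF g]
proof eventually_elim
  case (elim x)
  show ?case
  proof
    fix j
    obtain q where q: "q \<in> rational_points" "cmod (g x - q) < 1 / real (Suc j)"
      using rational_points_dense[of "1 / real (Suc j)" "g x"] by auto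
    moreover have "1 / real (Suc j) < 2 / real (Suc j)" by (simp add: divide_strict_right_mono)
    ultimately have "cmod (g x - q) < 2 / real (Suc j)" by linarith
    then obtain \<delta> where \<delta>: "0 < \<delta>" "\<And>r. 0 < r \<Longrightarrow> r < \<delta> \<Longrightarrow>
       ball_mass (\<lambda>y. cmod (g y - q)) x r \<le> ennreal (2 / real (Suc j) * (pi * r\<^sup>2))"
      using elim q(1) unfolding ball_mass_def by meson
    obtain k :: nat where k: "1 / real (Suc k) < \<delta>"
      using reals_Archimedean[OF \<delta>(1)] by (auto simp: inverse_eq_divide)
    have "\<forall>\<rho>. 0 < \<rho> \<and> \<rho> < 1 / real (Suc k) \<longrightarrow>
        ball_mass (\<lambda>y. cmod (g y - q)) x \<rho> \<le> ennreal (2 / real (Suc j) * (pi * \<rho>\<^sup>2))"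
      using \<delta>(2) k by (meson less_trans)
    then have "x \<in> density_set g j k"
      unfolding density_set_def using q by blast
    then show "\<exists>k. x \<in> density_set g j k" ..
  qed
qed

section \<open>Differentiability relative to density sets and the area inequality\<close>

context sobolev_map
begin

definition weak_diff :: "complex \<Rightarrow> complex \<Rightarrow> complex" where
  "weak_diff x v = Re v *\<^sub>R fx x + Im v *\<^sub>R fy x"

definition jac :: "complex \<Rightarrow> real" where
  "jac x = Re (fx x) * Im (fy x) - Re (fy x) * Im (fx x)"

lemma jac_measurable [measurable]: "jac \<in> borel_measurable borel"
  unfolding jac_def by measurable

lemma real_det_weak_diff: "real_det (weak_diff x) = jac x"
  by (simp add: real_det_def weak_diff_def jac_def)

text \<open>Averages over overlapping balls already force the weak derivatives at two nearby points of \<open>E\<close>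
  to be close to each other, so no appeal to Lusin's theorem is needed.\<close>

lemma has_derivative_on_density_sets:
  assumes E: "\<And>j. E \<subseteq> density_set fx j (\<kappa> j) \<inter> density_set fy j (\<kappa> j)" and x: "x \<in> E"
  shows "(f has_derivative weak_diff x) (at x within E)"
  unfolding has_derivative_within_alt
proof (intro conjI allI impI)
  show "bounded_linear (weak_diff x)"
    unfolding weak_diff_def by (intro bounded_linear_add bounded_linear_scaleR_const bounded_linear_Re bounded_linear_Im)
  fix e :: real assume e: "0 < e"
  \<comment> \<open>The two-point estimate will be used with mass constant 54 pi c, so j must give
    96 * 54 pi c <= e. Here 54 is twice 27, for the two partial derivatives, and 27 = 3 + 24:
    averaging over the common half-size ball shows that a partial derivative changes by at most 24 c
    between x and y.\<close>
  obtain j :: nat where j: "96 * (54 * pi) / e < real j"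
    using reals_Archimedean2 by blast
  define c where "c = 1 / real (Suc j)"
  have c: "0 < c" by (simp add: c_def)
  have ce: "96 * (54 * pi * c) \<le> e"
  proof -
    have "96 * (54 * pi) \<le> e * real (Suc j)"
      using j e by (simp add: field_simps)
    then show ?thesis by (simp add: c_def field_simps)
  qed
  define k where "k = \<kappa> j"
  have mass: "ball_mass (\<lambda>y. cmod (g y - g z)) z \<rho> \<le> ennreal (3 * c * (pi * \<rho>\<^sup>2))"
    if "g = fx \<or> g = fy" "z \<in> E" "0 < \<rho>" "\<rho> < 1 / real (Suc k)" for g z \<rho>
    using density_setD[of g z j k \<rho>] that E[of j] by (auto simp: k_def c_def)
  show "\<exists>d>0. \<forall>y\<in>E. norm (y - x) < d \<longrightarrow> norm (f y - f x - weak_diff x (y - x)) \<le> e * norm (y - x)"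
  proof (intro exI[of _ "1 / real (Suc k) / 2"] conjI ballI impI)
    fix y assume y: "y \<in> E" "norm (y - x) < 1 / real (Suc k) / 2"
    define r where "r = dist x y"
    show "norm (f y - f x - weak_diff x (y - x)) \<le> e * norm (y - x)"
    proof (cases "y = x")
      case True
      then show ?thesis by (simp add: weak_diff_def)
    next
      case False
      then have r: "0 < r" "2 * r < 1 / real (Suc k)"
      proof -
        have rr: "r = norm (y - x)" by (simp add: r_def dist_norm norm_minus_commute)
        show "0 < r" using False rr by simp
        show "2 * r < 1 / real (Suc k)" using y(2) rr less_divide_eq_numeral1(1)[of r "1 / real (Suc k)"] by (metis mult.commute)
      qed
      have gy: "ball_mass (\<lambda>z. cmod (g z - g x)) y \<rho> \<le> ennreal (27 * c * (pi * \<rho>\<^sup>2))"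
        if g: "g = fx \<or> g = fy" and \<rho>: "0 < \<rho>" "\<rho> < 1 / real (Suc k)" for g \<rho>
      proof -
        have [measurable]: "g \<in> borel_measurable borel" using g by auto
        have "cmod (g x - g y) * (pi * (r/2)\<^sup>2) \<le> 3 * c * (pi * r\<^sup>2) + 3 * c * (pi * r\<^sup>2)"
        proof (rule ball_mass_two_points[where g=g and x=x and y=y])
          have "r < 1 / real (Suc k)" using r by linarith
          then show "ball_mass (\<lambda>z. cmod (g z - g x)) x r \<le> ennreal (3 * c * (pi * r\<^sup>2))"
            "ball_mass (\<lambda>z. cmod (g z - g y)) y r \<le> ennreal (3 * c * (pi * r\<^sup>2))"
            using mass[OF g] x y(1) r(1) by auto
        qed (use r c in \<open>auto simp: r_def\<close>)
        then have "cmod (g x - g y) * (pi * r\<^sup>2) \<le> (24 * c) * (pi * r\<^sup>2)"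
          by (simp add: power_divide mult_ac)
        then have gxy: "cmod (g x - g y) \<le> 24 * c"
          using r by (simp add: mult_le_cancel_right)
        have "ball_mass (\<lambda>z. cmod (g z - g x)) y \<rho> \<le> ball_mass (\<lambda>z. cmod (g z - g y)) y \<rho> + ennreal (cmod (g y - g x) * (pi * \<rho>\<^sup>2))"
          using \<rho> by (intro ball_mass_shift) auto
        also have "\<dots> \<le> ennreal (3 * c * (pi * \<rho>\<^sup>2)) + ennreal (24 * c * (pi * \<rho>\<^sup>2))"
          using mass[OF g y(1) \<rho>] gxy by (intro add_mono ennreal_leI mult_right_mono) (auto simp: norm_minus_commute)
        also have "\<dots> = ennreal (27 * c * (pi * \<rho>\<^sup>2))"
          using c by (subst ennreal_plus[symmetric]) (auto simp: distrib_right[symmetric])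
        finally show ?thesis .
      qed
      have sum: "ball_mass (\<lambda>z. cmod (fx z - fx x) + cmod (fy z - fy x)) w \<rho>
        = ball_mass (\<lambda>z. cmod (fx z - fx x)) w \<rho> + ball_mass (\<lambda>z. cmod (fy z - fy x)) w \<rho>" for w \<rho>
        unfolding ball_mass_def by (subst nn_integral_add[symmetric]) (auto simp: distrib_right)
      have "cmod (f y - f x - (Re (y - x) *\<^sub>R fx x + Im (y - x) *\<^sub>R fy x)) \<le> 96 * (54 * pi * c) * cmod (y - x)"
      proof (rule two_point_estimate[where r=r])
        fix \<rho> assume \<rho>: "0 < \<rho>" "\<rho> \<le> 2 * r"
        then have \<rho>k: "\<rho> < 1 / real (Suc k)" using r by linarith
        have "ball_mass (\<lambda>z. cmod (g z - g x)) x \<rho> \<le> ennreal (27 * c * (pi * \<rho>\<^sup>2))" if "g = fx \<or> g = fy" for g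
          by (rule order_trans[OF mass[OF that x \<rho>(1) \<rho>k]]) (use c in \<open>auto intro!: ennreal_leI mult_right_mono\<close>)
        then have "ball_mass (\<lambda>z. cmod (fx z - fx x)) w \<rho> + ball_mass (\<lambda>z. cmod (fy z - fy x)) w \<rho>
            \<le> ennreal (27 * c * (pi * \<rho>\<^sup>2)) + ennreal (27 * c * (pi * \<rho>\<^sup>2))" if "w = x \<or> w = y" for w
          using that gy[OF _ \<rho>(1) \<rho>k] by (intro add_mono) auto
        also have "ennreal (27 * c * (pi * \<rho>\<^sup>2)) + ennreal (27 * c * (pi * \<rho>\<^sup>2)) = ennreal (54 * pi * c * \<rho>\<^sup>2)"
          using c by (subst ennreal_plus[symmetric]) (auto simp: mult_ac)
        finally show "ball_mass (\<lambda>z. cmod (fx z - fx x) + cmod (fy z - fy x)) x \<rho> \<le> ennreal (54 * pi * c * \<rho>\<^sup>2)"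
          and "ball_mass (\<lambda>z. cmod (fx z - fx x) + cmod (fy z - fy x)) y \<rho> \<le> ennreal (54 * pi * c * \<rho>\<^sup>2)"
          unfolding sum by auto
      qed (use r c in \<open>auto simp: r_def\<close>)
      also have "\<dots> \<le> e * cmod (y - x)"
        using ce by (intro mult_right_mono) auto
      finally show ?thesis by (simp add: weak_diff_def)
    qed
  qed simp
qed

text \<open>By the Egorov argument \<open>E n\<close> misses measure at most 1/(n+1) of the ball of
  radius n, so the union misses only a null set. On each \<open>E n\<close> the thresholds k are
  uniform for every j, which is what relative differentiability needs.\<close>

lemma differentiable_decomposition:
  obtains E :: "nat \<Rightarrow> complex set" where "\<And>n. E n \<in> sets borel" "AE x in lborel. x \<in> (\<Union>n. E n)"
    "\<And>n x. x \<in> E n \<Longrightarrow> (f has_derivative weak_diff x) (at x within E n)"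
proof -
  define A where "A j k = density_set fx j k \<inter> density_set fy j k" for j k
  have A [measurable]: "A j k \<in> sets borel" for j k
    unfolding A_def by measurable
  have inc: "incseq (A j)" for j
    using density_set_incseq[of fx j] density_set_incseq[of fy j] unfolding incseq_def A_def by blast
  have ae: "AE x in lborel. \<forall>j. \<exists>k. x \<in> A j k"
    using density_set_AE[OF locally_integrable_fx] density_set_AE[OF locally_integrable_fy]
  proof eventually_elim
    case (elim x)
    show ?case
    proof
      fix j
      obtain k k' where "x \<in> density_set fx j k" "x \<in> density_set fy j k'" using elim by metis
      then have "x \<in> A j (max k k')"
        using density_set_incseq[of fx j] density_set_incseq[of fy j]
        by (auto simp: incseq_def A_def) (meson max.cobounded1 max.cobounded2 subsetD)+
      then show "\<exists>k. x \<in> A j k" ..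
    qed
  qed
  have "\<exists>\<kappa>. emeasure lborel (ball 0 (real n) - (\<Inter>j. A j (\<kappa> j))) \<le> ennreal (1 / real (Suc n))" for n :: nat
    using egorov_lborel[OF A inc ae, of "1 / real (Suc n)" "real n"] by auto
  then obtain \<kappa> where \<kappa>: "\<And>n. emeasure lborel (ball 0 (real n) - (\<Inter>j. A j (\<kappa> n j))) \<le> ennreal (1 / real (Suc n))"
    by metis
  define E where "E n = (\<Inter>j. A j (\<kappa> n j))" for n
  have E [measurable]: "E n \<in> sets borel" for n unfolding E_def by measurable
  have null: "emeasure lborel (ball 0 (real N) - (\<Union>n. E n)) = 0" for N
  proof -
    have le: "emeasure lborel (ball 0 (real N) - (\<Union>n. E n)) \<le> ennreal e" if e: "0 < e" for e
    proof -
      obtain n :: nat where n: "1 / real (Suc n) < e" using reals_Archimedean[OF e] by (auto simp: inverse_eq_divide)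
      \<comment> \<open>Taking m at least N makes the ball large enough, and taking it at least n
        makes the error at most e.\<close>
      define m where "m = max n N"
      have "ball 0 (real N) - (\<Union>n. E n) \<subseteq> ball 0 (real m) - E m"
        by (auto simp: m_def)
      then have "emeasure lborel (ball 0 (real N) - (\<Union>n. E n)) \<le> emeasure lborel (ball 0 (real m) - E m)"
        by (rule emeasure_mono) measurable
      also have "\<dots> \<le> ennreal (1 / real (Suc m))"
        using \<kappa>[of m] by (simp add: E_def)
      also have "\<dots> \<le> ennreal e"
      proof (rule ennreal_leI)
        have "1 / real (Suc m) \<le> 1 / real (Suc n)" by (simp add: m_def frac_le)
        then show "1 / real (Suc m) \<le> e" using n by linarith
      qed
      finally show ?thesis .
    qed
    have "emeasure lborel (ball 0 (real N) - (\<Union>n. E n)) \<le> 0"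
    proof (rule ennreal_le_epsilon)
      fix e :: real assume "0 < e"
      with le show "emeasure lborel (ball 0 (real N) - (\<Union>n. E n)) \<le> 0 + ennreal e" by simp
    qed
    then show ?thesis by simp
  qed
  have "AE x in lborel. x \<notin> ball 0 (real N) - (\<Union>n. E n)" for N
    using null by (intro AE_not_in) (auto simp: null_sets_def)
  then have "AE x in lborel. \<forall>N::nat. x \<notin> ball 0 (real N) - (\<Union>n. E n)"
    by (intro AE_all_countable[THEN iffD2] allI)
  then have "AE x in lborel. x \<in> (\<Union>n. E n)"
  proof eventually_elim
    case (elim x)
    obtain N :: nat where "cmod x < real N" using reals_Archimedean2 by blast
    with elim show ?case by auto
  qed
  moreover have "(f has_derivative weak_diff x) (at x within E n)" if "x \<in> E n" for n x
    by (rule has_derivative_on_density_sets[of _ "\<kappa> n"]) (use that in \<open>auto simp: E_def A_def\<close>)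
  ultimately show ?thesis using that E by blast
qed

text \<open>On disjoint pieces where f is relatively differentiable the change of variables is an
  equality, and the images of the pieces are disjoint by injectivity. Only an inequality results,
  because the image of the remaining null set may have positive measure.\<close>

lemma area_inequality:
  assumes hom: "homeomorphism UNIV UNIV f g" and F [measurable]: "F \<in> borel_measurable borel"
  shows "(\<integral>\<^sup>+x. F (f x) * ennreal \<bar>jac x\<bar> \<partial>lborel) \<le> (\<integral>\<^sup>+y. F y \<partial>lborel)"
proof -
  obtain E :: "nat \<Rightarrow> complex set" where E [measurable]: "\<And>n. E n \<in> sets borel" and ae: "AE x in lborel. x \<in> (\<Union>n. E n)"
    and der: "\<And>n x. x \<in> E n \<Longrightarrow> (f has_derivative weak_diff x) (at x within E n)"
    using differentiable_decomposition by blast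
  have inj: "inj f"
    using hom by (auto simp: homeomorphism_def inj_on_def) metis
  have [measurable]: "g \<in> borel_measurable borel"
    using hom by (intro borel_measurable_continuous_onI) (auto simp: homeomorphism_def)
  have im: "f ` S = g -` S" for S
    using hom by (auto simp: homeomorphism_def image_iff) (metis UNIV_I)
  define S where "S = disjointed E"
  have S [measurable]: "S n \<in> sets borel" for n
  proof -
    have "range E \<subseteq> sets borel" using E by blast
    then show ?thesis using sets.range_disjointed_sets[of E borel] by (auto simp: S_def)
  qed
  have SE: "S n \<subseteq> E n" for n by (simp add: S_def disjointed_subset)
  have fS [measurable]: "f ` S n \<in> sets borel" for n
    unfolding im using measurable_sets[of g borel borel "S n"] by simp
  have disj: "disjoint_family S" by (simp add: S_def disjoint_family_disjointed)
  have disjf: "disjoint_family (\<lambda>n. f ` S n)"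
    using disj inj by (auto simp: disjoint_family_on_def inj_def) blast
  have UN: "(\<Union>n. S n) = (\<Union>n. E n)" by (simp add: S_def UN_disjointed_eq)
  have "(\<integral>\<^sup>+x. F (f x) * ennreal \<bar>jac x\<bar> \<partial>lborel) = (\<integral>\<^sup>+x. (\<Sum>n. F (f x) * (ennreal \<bar>jac x\<bar> * indicator (S n) x)) \<partial>lborel)"
  proof (rule nn_integral_cong_AE)
    show "AE x in lborel. F (f x) * ennreal \<bar>jac x\<bar> = (\<Sum>n. F (f x) * (ennreal \<bar>jac x\<bar> * indicator (S n) x))"
      using ae
    proof eventually_elim
      case (elim x)
      then have "(\<Sum>n. indicator (S n) x :: ennreal) = 1"
        using suminf_indicator[OF disj, of x] UN by simp
      then show ?case by simp
    qed
  qed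
  also have "\<dots> = (\<Sum>n. \<integral>\<^sup>+x. F (f x) * (ennreal \<bar>jac x\<bar> * indicator (S n) x) \<partial>lborel)"
    by (rule nn_integral_suminf) measurable
  also have "\<dots> = (\<Sum>n. \<integral>\<^sup>+y. F y * indicator (f ` S n) y \<partial>lborel)"
  proof (intro suminf_cong nn_integral_change_of_variables_complex[where g'=weak_diff])
    show "(f has_derivative weak_diff x) (at x within S n)" if "x \<in> S n" for n x
      using der SE that by (meson has_derivative_subset subsetD)
  qed (use inj in \<open>auto simp: real_det_weak_diff intro: inj_on_subset\<close>)
  also have "\<dots> = (\<integral>\<^sup>+y. (\<Sum>n. F y * indicator (f ` S n) y) \<partial>lborel)"
    by (rule nn_integral_suminf[symmetric]) measurable
  also have "\<dots> \<le> (\<integral>\<^sup>+y. F y \<partial>lborel)"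
  proof (rule nn_integral_mono)
    fix y
    have "(\<Sum>n. F y * indicator (f ` S n) y) = F y * indicator (\<Union>n. f ` S n) y"
      using suminf_indicator[OF disjf, of y] by simp
    also have "\<dots> \<le> F y" by (auto simp: indicator_def)
    finally show "(\<Sum>n. F y * indicator (f ` S n) y) \<le> F y" .
  qed
  finally show ?thesis .
qed

end

subsection \<open>Capacity estimates\<close>

text \<open>Pointwise w <= l \<alpha>/2 + \<beta>/(2l), by the inequality of arithmetic and
  geometric means, and l = sqrt (B/A) balances the two integrals. Only upper bounds for the factors
  and a lower bound for the integral of w enter, so nothing has to be known to be integrable
  beforehand.\<close>

lemma nn_integral_Cauchy_Schwarz:
  fixes w \<alpha> \<beta> :: "'a \<Rightarrow> real"
  assumes [measurable]: "w \<in> borel_measurable M" "\<alpha> \<in> borel_measurable M" "\<beta> \<in> borel_measurable M"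
    and ae: "AE x in M. 0 \<le> \<alpha> x \<and> 0 \<le> \<beta> x \<and> (w x)\<^sup>2 \<le> \<alpha> x * \<beta> x"
    and c: "0 \<le> c" "ennreal c \<le> (\<integral>\<^sup>+x. ennreal (w x) \<partial>M)"
    and A: "0 < A" "(\<integral>\<^sup>+x. ennreal (\<alpha> x) \<partial>M) \<le> ennreal A"
    and B: "0 < B" "(\<integral>\<^sup>+x. ennreal (\<beta> x) \<partial>M) \<le> ennreal B"
  shows "c\<^sup>2 \<le> A * B"
proof -
  define l where "l = sqrt (B / A)"
  have l: "0 < l" using A B by (simp add: l_def)
  have "ennreal c \<le> (\<integral>\<^sup>+x. ennreal (l/2) * ennreal (\<alpha> x) + ennreal (1/(2*l)) * ennreal (\<beta> x) \<partial>M)"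
  proof (rule order_trans[OF c(2)], rule nn_integral_mono_AE)
    show "AE x in M. ennreal (w x) \<le> ennreal (l/2) * ennreal (\<alpha> x) + ennreal (1/(2*l)) * ennreal (\<beta> x)"
      using ae
    proof eventually_elim
      case (elim x)
      define s t where "s = sqrt (l * \<alpha> x)" and "t = sqrt (\<beta> x / l)"
      have st: "s\<^sup>2 = l * \<alpha> x" "t\<^sup>2 = \<beta> x / l" using elim l by (simp_all add: s_def t_def)
      have "(w x)\<^sup>2 \<le> (s * t)\<^sup>2"
        using elim l by (simp add: power_mult_distrib st)
      then have "w x \<le> s * t"
        by (rule power2_le_imp_le) (use elim l in \<open>simp add: s_def t_def\<close>)
      also have "\<dots> \<le> (s\<^sup>2 + t\<^sup>2) / 2"
        using sum_squares_bound[of s t] by simp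
      also have "\<dots> = l/2 * \<alpha> x + 1/(2*l) * \<beta> x"
        unfolding st using l by (simp add: field_simps)
      finally have "ennreal (w x) \<le> ennreal (l/2 * \<alpha> x + 1/(2*l) * \<beta> x)" by (rule ennreal_leI)
      also have "\<dots> = ennreal (l/2) * ennreal (\<alpha> x) + ennreal (1/(2*l)) * ennreal (\<beta> x)"
        using elim l by (simp add: ennreal_mult'[symmetric])
      finally show ?case .
    qed
  qed
  also have "\<dots> = ennreal (l/2) * (\<integral>\<^sup>+x. ennreal (\<alpha> x) \<partial>M) + ennreal (1/(2*l)) * (\<integral>\<^sup>+x. ennreal (\<beta> x) \<partial>M)"
    by (simp add: nn_integral_add nn_integral_cmult)
  also have "\<dots> \<le> ennreal (l/2) * ennreal A + ennreal (1/(2*l)) * ennreal B"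
    by (intro add_mono mult_left_mono A B) auto
  also have "\<dots> = ennreal (l/2 * A + 1/(2*l) * B)"
    using l A B by (simp add: ennreal_mult'[symmetric])
  finally have "c \<le> l/2 * A + 1/(2*l) * B"
    using l A B by (subst (asm) ennreal_le_iff) auto
  also have "l/2 * A + 1/(2*l) * B = sqrt (A * B)"
  proof -
    have "l\<^sup>2 = B / A" using A B by (simp add: l_def)
    then have "1/(2*l) * B = l/2 * A"
      using l A by (simp add: field_simps power2_eq_square)
    moreover have "l * A = sqrt (A * B)"
    proof (rule power2_eq_imp_eq)
      show "(l * A)\<^sup>2 = (sqrt (A * B))\<^sup>2"
        using A B \<open>l\<^sup>2 = B / A\<close> unfolding power_mult_distrib by (simp add: power2_eq_square)
    qed (use l A B in auto)
    ultimately show ?thesis by simp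
  qed
  finally have "c\<^sup>2 \<le> (sqrt (A * B))\<^sup>2" using c(1) by (rule power_mono)
  then show ?thesis using A B by simp
qed

text \<open>On \<open>density_set g j k\<close> the kernel bound 3/h^2 times the mass 3 pi h^2/(j+1)
  gives an error of at most 9 pi/(j+1) once h < 1/(k+1).\<close>

lemma mollify_tendsto_AE:
  assumes g: "locally_integrable g"
  shows "AE y in lborel. (\<lambda>n. mollify (1 / real (Suc n)) g y) \<longlonglongrightarrow> g y"
  using density_set_AE[OF g]
proof eventually_elim
  case (elim y)
  note [measurable] = locally_integrable_measurable[OF g]
  show ?case
  proof (rule LIMSEQ_I)
    fix e :: real assume e: "0 < e"
    obtain j :: nat where j: "9 * pi / e < real j" using reals_Archimedean2 by blast
    have je: "9 * pi / real (Suc j) < e"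
      using j e by (simp add: field_simps)
    obtain k where k: "y \<in> density_set g j k" using elim by blast
    show "\<exists>N. \<forall>n\<ge>N. norm (mollify (1 / real (Suc n)) g y - g y) < e"
    proof (intro exI[of _ "Suc k"] allI impI)
      fix n assume n: "Suc k \<le> n"
      define h where "h = 1 / real (Suc n)"
      have h: "0 < h" "h < 1 / real (Suc k)"
        using n by (auto simp: h_def intro!: divide_strict_left_mono)
      have lg: "locally_integrable (\<lambda>z. g z - g y)"
        by (rule locally_integrable_bound[OF g locally_integrable_const[of "g y"]]) (auto intro: norm_triangle_ineq4)
      have "ennreal (cmod (mollify h g y - g y)) \<le> (\<integral>\<^sup>+z. ennreal (mollifier h (y - z)) * ennreal (cmod (g z - g y)) \<partial>lborel)"
        unfolding mollify_diff_const[OF g h(1)] by (rule norm_mollify_le[OF lg h(1)])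
      also have "\<dots> \<le> (\<integral>\<^sup>+z. ennreal (3 / h\<^sup>2) * (ennreal (cmod (g z - g y)) * indicator (ball y h) z) \<partial>lborel)"
      proof (rule nn_integral_mono)
        fix z
        show "ennreal (mollifier h (y - z)) * ennreal (cmod (g z - g y)) \<le> ennreal (3 / h\<^sup>2) * (ennreal (cmod (g z - g y)) * indicator (ball y h) z)"
          using mollifier_le[OF h(1), of "y - z"] mollifier_eq_0[OF h(1), of "y - z"]
          by (cases "z \<in> ball y h") (auto simp: dist_norm not_less intro!: mult_right_mono ennreal_leI)
      qed
      also have "\<dots> = ennreal (3 / h\<^sup>2) * ball_mass (\<lambda>z. cmod (g z - g y)) y h"
        unfolding ball_mass_def by (rule nn_integral_cmult) measurable
      also have "\<dots> \<le> ennreal (3 / h\<^sup>2) * ennreal (3 / real (Suc j) * (pi * h\<^sup>2))"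
        by (intro mult_left_mono density_setD[OF _ k]) (use h in auto)
      also have "\<dots> = ennreal (9 * pi / real (Suc j))"
        using h by (subst ennreal_mult[symmetric]) auto
      finally have "cmod (mollify h g y - g y) \<le> 9 * pi / real (Suc j)"
        by (subst (asm) ennreal_le_iff) auto
      then show "norm (mollify (1 / real (Suc n)) g y - g y) < e"
        using je by (simp add: h_def)
    qed
  qed
qed

lemma wirtinger: "Re v *\<^sub>R X + Im v *\<^sub>R Y = (X - \<i> * Y) / 2 * v + (X + \<i> * Y) / 2 * cnj v"
  by (simp add: complex_eq_iff) (simp add: field_simps)

lemma locally_integrable_bounded:
  fixes g :: "complex \<Rightarrow> 'b::{banach, second_countable_topology}"
  assumes "g \<in> borel_measurable borel" and "\<And>x. norm (g x) \<le> B"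
  shows "locally_integrable g"
  by (rule locally_integrable_bound[OF locally_integrable_const[of B] locally_integrable_const[of B]])
     (use assms in \<open>auto intro: order_trans[OF assms(2)]\<close>)

section \<open>Mollified compositions and the passage from C1 energies to weak gradients\<close>

context sobolev_map
begin

definition dz :: "complex \<Rightarrow> complex" where "dz x = (fx x - \<i> * fy x) / 2"
definition dzbar :: "complex \<Rightarrow> complex" where "dzbar x = (fx x + \<i> * fy x) / 2"
text \<open>The operator norm of the weak differential v -> a v + b cnj v is |a| + |b|. In this form
  it is bounded under mollification term by term, since \<open>dz\<close> and \<open>dzbar\<close>
  are linear in the partial derivatives.\<close>

definition dnorm :: "complex \<Rightarrow> real" where "dnorm x = cmod (dz x) + cmod (dzbar x)"

lemma dz_dzbar_measurable [measurable]:
  "dz \<in> borel_measurable borel" "dzbar \<in> borel_measurable borel" "dnorm \<in> borel_measurable borel"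
proof -
  show [measurable]: "dz \<in> borel_measurable borel" "dzbar \<in> borel_measurable borel"
    unfolding dz_def dzbar_def by measurable
  show "dnorm \<in> borel_measurable borel"
    unfolding dnorm_def by measurable
qed

lemma dnorm_nonneg [simp]: "0 \<le> dnorm x" by (simp add: dnorm_def)

lemma locally_integrable_dz_dzbar: "locally_integrable dz" "locally_integrable dzbar" "locally_integrable dnorm"
proof -
  have "cmod (dz x) \<le> cmod (fx x) + cmod (fy x)" "cmod (dzbar x) \<le> cmod (fx x) + cmod (fy x)" for x
    using norm_triangle_ineq4[of "fx x" "\<i> * fy x"] norm_triangle_ineq[of "fx x" "\<i> * fy x"]
    by (auto simp: dz_def dzbar_def norm_divide norm_mult)
      (smt (verit) norm_ge_zero field_sum_of_halves)+
  then show *: "locally_integrable dz" "locally_integrable dzbar"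
    by (auto intro: locally_integrable_bound[OF locally_integrable_fx locally_integrable_fy])
  show "locally_integrable dnorm"
    by (rule locally_integrable_bound[OF *]) (auto simp: dnorm_def)
qed

lemma mollify_dz_dzbar:
  assumes h: "0 < h"
  shows "mollify h dz x = (mollify h fx x - \<i> * mollify h fy x) / 2"
    "mollify h dzbar x = (mollify h fx x + \<i> * mollify h fy x) / 2"
proof -
  have i: "integrable lborel (\<lambda>y. mollifier h (x - y) *\<^sub>R fx y)" "integrable lborel (\<lambda>y. mollifier h (x - y) *\<^sub>R fy y)"
    by (intro integrable_mollifier_scaleR locally_integrable_fx locally_integrable_fy h)+
  have "mollify h dz x = (\<integral>y. (mollifier h (x - y) *\<^sub>R fx y - \<i> * (mollifier h (x - y) *\<^sub>R fy y)) / 2 \<partial>lborel)"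
    unfolding mollify_def dz_def by (simp add: scaleR_conv_of_real algebra_simps)
  also have "\<dots> = ((\<integral>y. mollifier h (x - y) *\<^sub>R fx y \<partial>lborel) - \<i> * (\<integral>y. mollifier h (x - y) *\<^sub>R fy y \<partial>lborel)) / 2"
    by (simp only: integral_divide_zero Bochner_Integration.integral_diff[OF i(1) integrable_mult_right[OF i(2)]]
        integral_mult_right_zero)
  finally show "mollify h dz x = (mollify h fx x - \<i> * mollify h fy x) / 2"
    by (simp add: mollify_def)
  have "mollify h dzbar x = (\<integral>y. (mollifier h (x - y) *\<^sub>R fx y + \<i> * (mollifier h (x - y) *\<^sub>R fy y)) / 2 \<partial>lborel)"
    unfolding mollify_def dzbar_def by (simp add: scaleR_conv_of_real algebra_simps)
  also have "\<dots> = ((\<integral>y. mollifier h (x - y) *\<^sub>R fx y \<partial>lborel) + \<i> * (\<integral>y. mollifier h (x - y) *\<^sub>R fy y \<partial>lborel)) / 2"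
    by (simp only: integral_divide_zero Bochner_Integration.integral_add[OF i(1) integrable_mult_right[OF i(2)]]
        integral_mult_right_zero)
  finally show "mollify h dzbar x = (mollify h fx x + \<i> * mollify h fy x) / 2"
    by (simp add: mollify_def)
qed

text \<open>The chain rule for S after the mollified map. The gradient is bounded by the gradient of
  S times the operator norm of the mollified differential, stated through the mollified Wirtinger
  derivatives so that \<open>mollify_pair_le\<close> applies.\<close>

lemma mollified_composition:
  fixes S :: "complex \<Rightarrow> real" and \<sigma> :: "complex \<Rightarrow> complex"
  assumes S: "\<And>y. (S has_derivative (\<lambda>v. \<sigma> y \<bullet> v)) (at y)" and c\<sigma>: "continuous_on UNIV \<sigma>" and h: "0 < h"
  obtains \<tau> where "continuous_on UNIV \<tau>"
    "\<And>x. ((\<lambda>x. S (mollify h f x)) has_derivative (\<lambda>v. \<tau> x \<bullet> v)) (at x)"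
    "\<And>x. cmod (\<tau> x) \<le> cmod (\<sigma> (mollify h f x)) * (cmod (mollify h dz x) + cmod (mollify h dzbar x))"
proof
  define X Y where "X = mollify h fx" and "Y = mollify h fy"
  have cX: "continuous_on UNIV X" and cY: "continuous_on UNIV Y" and cf: "continuous_on UNIV (mollify h f)"
    unfolding X_def Y_def
    by (intro continuous_on_mollify h locally_integrable_fx locally_integrable_fy locally_integrable_continuous cont)+
  define \<tau> where "\<tau> x = complex_of_real (\<sigma> (mollify h f x) \<bullet> X x) + \<i> * complex_of_real (\<sigma> (mollify h f x) \<bullet> Y x)" for x
  have \<tau>: "\<tau> x \<bullet> v = \<sigma> (mollify h f x) \<bullet> (Re v *\<^sub>R X x + Im v *\<^sub>R Y x)" for x v
  proof -
    have "\<tau> x \<bullet> v = (\<sigma> (mollify h f x) \<bullet> X x) * Re v + (\<sigma> (mollify h f x) \<bullet> Y x) * Im v"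
      by (simp add: \<tau>_def inner_complex_def)
    then show ?thesis by (simp add: inner_add_right mult.commute)
  qed
  show "continuous_on UNIV \<tau>"
    unfolding \<tau>_def by (intro continuous_intros cX cY continuous_on_compose2[OF c\<sigma> cf]) auto
  show "((\<lambda>x. S (mollify h f x)) has_derivative (\<lambda>v. \<tau> x \<bullet> v)) (at x)" for x
    unfolding \<tau> X_def Y_def
    by (rule has_derivative_compose[OF mollify_has_derivative[OF h] S])
  show "cmod (\<tau> x) \<le> cmod (\<sigma> (mollify h f x)) * (cmod (mollify h dz x) + cmod (mollify h dzbar x))" for x
  proof (cases "\<tau> x = 0")
    case False
    have gen: "cmod (a * v + b * cnj v) \<le> (cmod a + cmod b) * cmod v" for a b v
      using norm_triangle_ineq[of "a * v" "b * cnj v"] by (simp add: norm_mult distrib_right)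
    have "cmod (Re v *\<^sub>R X x + Im v *\<^sub>R Y x) \<le> (cmod (mollify h dz x) + cmod (mollify h dzbar x)) * cmod v" for v
      unfolding wirtinger mollify_dz_dzbar[OF h] X_def Y_def
      by (rule gen)
    \<comment> \<open>Testing the derivative in the direction of the gradient itself yields the
      bound for its length.\<close>
    note * = this[of "\<tau> x"]
    have "cmod (\<tau> x) * cmod (\<tau> x) = \<tau> x \<bullet> \<tau> x"
      by (simp add: dot_square_norm power2_eq_square)
    also have "\<dots> \<le> cmod (\<sigma> (mollify h f x)) * cmod (Re (\<tau> x) *\<^sub>R X x + Im (\<tau> x) *\<^sub>R Y x)"
      unfolding \<tau> by (rule norm_cauchy_schwarz)
    also have "\<dots> \<le> cmod (\<sigma> (mollify h f x)) * ((cmod (mollify h dz x) + cmod (mollify h dzbar x)) * cmod (\<tau> x))"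
      by (intro mult_left_mono *) auto
    finally show ?thesis using False by (simp add: mult.assoc[symmetric])
  qed simp
qed

text \<open>A lower bound for the weighted energy of all \<open>C\<^sup>1\<close> functions close to \<open>S \<circ> f\<close> is inherited by
  the weak gradient of \<open>S \<circ> f\<close>: moving the mollification onto the weight avoids strong convergence
  of the mollified derivatives.\<close>

lemma capacity_bound:
  fixes S H :: "complex \<Rightarrow> real" and \<sigma> :: "complex \<Rightarrow> complex"
  assumes S: "\<And>y. (S has_derivative (\<lambda>v. \<sigma> y \<bullet> v)) (at y)" and c\<sigma>: "continuous_on UNIV \<sigma>"
    and H [measurable]: "H \<in> borel_measurable borel" and H0: "\<And>x. 0 \<le> H x" "\<And>x. H x \<le> B"
    and HR: "\<And>x. R < cmod x \<Longrightarrow> H x = 0" and M: "0 \<le> M"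
    and hyp: "\<And>u \<tau> e. 0 < e \<Longrightarrow> continuous_on UNIV \<tau> \<Longrightarrow> (\<And>x. (u has_derivative (\<lambda>v. \<tau> x \<bullet> v)) (at x)) \<Longrightarrow>
      (\<And>x. cmod x \<le> R \<Longrightarrow> \<bar>u x - S (f x)\<bar> \<le> e) \<Longrightarrow> ennreal (c - M * e) \<le> (\<integral>\<^sup>+x. ennreal (H x * cmod (\<tau> x)) \<partial>lborel)"
  shows "ennreal c \<le> (\<integral>\<^sup>+x. ennreal (H x * cmod (\<sigma> (f x)) * dnorm x) \<partial>lborel)"
proof -
  have B0: "0 \<le> B" using H0 order_trans by blast
  have [measurable]: "\<sigma> \<in> borel_measurable borel" by (rule borel_measurable_continuous_onI[OF c\<sigma>])
  have cS: "continuous_on UNIV S"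
    by (meson S continuous_at_imp_continuous_on has_derivative_continuous)
  define h where "h n = 1 / real (Suc n)" for n
  have h: "0 < h n" "h n \<le> 1" for n by (auto simp: h_def)
  have hlim: "h \<longlonglongrightarrow> 0" unfolding h_def using LIMSEQ_inverse_real_of_nat by (simp add: inverse_eq_divide)
  obtain Sg where Sg: "0 < Sg" "\<And>x. cmod x \<le> R \<Longrightarrow> cmod (\<sigma> (f x)) \<le> Sg"
  proof -
    have "compact ((\<lambda>x. \<sigma> (f x)) ` cball 0 R)"
      by (intro compact_continuous_image continuous_on_compose2[OF c\<sigma>] continuous_on_subset[OF cont]) auto
    then have "bounded ((\<lambda>x. \<sigma> (f x)) ` cball 0 R)" by (rule compact_imp_bounded)
    then show ?thesis using that by (auto simp: bounded_pos)
  qed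
  define Z where "Z = (\<integral>\<^sup>+x. ennreal (H x) * ennreal (dnorm x) \<partial>lborel)"
  have Z: "Z < \<infinity>"
  proof -
    have "Z \<le> (\<integral>\<^sup>+x. ennreal B * (ennreal (norm (dnorm x)) * indicator (ball 0 (R + 1)) x) \<partial>lborel)"
      unfolding Z_def
    proof (rule nn_integral_mono)
      fix x
      show "ennreal (H x) * ennreal (dnorm x) \<le> ennreal B * (ennreal (norm (dnorm x)) * indicator (ball 0 (R + 1)) x)"
        using HR[of x] H0[of x] by (cases "cmod x \<le> R") (auto simp: indicator_def intro!: mult_right_mono ennreal_leI)
    qed
    also have "\<dots> = ennreal B * (\<integral>\<^sup>+x. ennreal (norm (dnorm x)) * indicator (ball 0 (R + 1)) x \<partial>lborel)"
      by (rule nn_integral_cmult) measurable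
    also have "\<dots> < \<infinity>"
      using locally_integrable_ball[OF locally_integrable_dz_dzbar(3), of 0 "R + 1"] by (simp add: ennreal_mult_less_top)
    finally show ?thesis .
  qed
  define I where "I = (\<integral>\<^sup>+x. ennreal (H x * cmod (\<sigma> (f x)) * dnorm x) \<partial>lborel)"
  have main: "ennreal (c - M * e) \<le> I + ennreal e * Z" if e: "0 < e" for e
  proof -
    \<comment> \<open>The summand e absorbs the uniform difference between the gradient of S at the
      mollified map and at f.\<close>
    define W where "W x = H x * (cmod (\<sigma> (f x)) + e)" for x
    have W [measurable]: "W \<in> borel_measurable borel" unfolding W_def by measurable
    have W0: "0 \<le> W x" for x using H0 e by (simp add: W_def)
    define BW where "BW = B * (Sg + e)"
    have WB: "W x \<le> BW" for x
      using HR[of x] H0[of x] Sg e B0 unfolding W_def BW_def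
      by (cases "cmod x \<le> R") (auto intro!: mult_mono)
    have lW: "locally_integrable (\<lambda>x. complex_of_real (W x))"
      by (rule locally_integrable_bounded[where B=BW]) (use W0 WB in auto)
    \<comment> \<open>The weight W mollified at scale \<open>h n\<close>. It is bounded, supported
      in a fixed ball and converges almost everywhere, so dominated convergence with the integrable
      factor \<open>dnorm\<close> applies.\<close>
    define A where "A n y = (\<integral>\<^sup>+x. ennreal (W x) * ennreal (mollifier (h n) (x - y)) \<partial>lborel)" for n y
    have A_eq: "A n y = ennreal (cmod (mollify (h n) (\<lambda>x. complex_of_real (W x)) y))" for n y
    proof -
      have r: "mollifier (h n) (x - y) = mollifier (h n) (y - x)" for x
        by (metis minus_diff_eq mollifier_even)
      have int: "integrable lborel (\<lambda>x. mollifier (h n) (y - x) * W x)"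
        using integrable_mollifier_scaleR[OF lW h(1), of n y, THEN integrable_Re] by simp
      have "A n y = (\<integral>\<^sup>+x. ennreal (mollifier (h n) (y - x) * W x) \<partial>lborel)"
        unfolding A_def r using W0 by (simp add: ennreal_mult mollifier_nonneg[OF h(1)] mult.commute)
      also have "\<dots> = ennreal (\<integral>x. mollifier (h n) (y - x) * W x \<partial>lborel)"
        using int W0 by (intro nn_integral_eq_integral) (auto simp: mollifier_nonneg[OF h(1)])
      also have "(\<integral>x. mollifier (h n) (y - x) * W x \<partial>lborel) = cmod (mollify (h n) (\<lambda>x. complex_of_real (W x)) y)"
      proof -
        have "mollify (h n) (\<lambda>x. complex_of_real (W x)) y = complex_of_real (\<integral>x. mollifier (h n) (y - x) * W x \<partial>lborel)"
          unfolding mollify_def by (simp add: scaleR_conv_of_real flip: of_real_mult)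
        moreover have "0 \<le> (\<integral>x. mollifier (h n) (y - x) * W x \<partial>lborel)"
          using W0 by (intro Bochner_Integration.integral_nonneg) (auto simp: mollifier_nonneg[OF h(1)])
        ultimately show ?thesis by simp
      qed
      finally show ?thesis .
    qed
    have A_meas [measurable]: "A n \<in> borel_measurable borel" for n
      unfolding A_def by measurable
    have A_lim: "AE y in lborel. (\<lambda>n. A n y) \<longlonglongrightarrow> ennreal (W y)"
      using mollify_tendsto_AE[OF lW]
    proof eventually_elim
      case (elim y)
      then have "(\<lambda>n. cmod (mollify (h n) (\<lambda>x. complex_of_real (W x)) y)) \<longlonglongrightarrow> cmod (complex_of_real (W y))"
        unfolding h_def by (rule tendsto_norm)
      then show ?case unfolding A_eq using W0[of y] by (intro tendsto_ennrealI) simp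
    qed
    have A_bound: "A n y \<le> ennreal BW * indicator (ball 0 (R + 2)) y" for n y
    proof (cases "y \<in> ball 0 (R + 2)")
      case True
      have "A n y \<le> (\<integral>\<^sup>+x. ennreal BW * ennreal (mollifier (h n) (x - y)) \<partial>lborel)"
        unfolding A_def using WB by (intro nn_integral_mono mult_right_mono ennreal_leI) auto
      also have "\<dots> = ennreal BW * (\<integral>\<^sup>+x. ennreal (mollifier (h n) (y - x)) \<partial>lborel)"
        by (subst nn_integral_cmult) (auto simp: mollifier_even[of _ "y - _", simplified])
      also have "(\<integral>\<^sup>+x. ennreal (mollifier (h n) (y - x)) \<partial>lborel) = 1"
        by (simp add: nn_integral_reflect_complex[of "\<lambda>y. ennreal (mollifier (h n) y)"] nn_integral_mollifier h)
      finally show ?thesis using True by simp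
    next
      case False
      have "ennreal (W x) * ennreal (mollifier (h n) (x - y)) = 0" for x
      proof (cases "cmod x \<le> R")
        case True
        have "h n \<le> cmod (x - y)"
          using False True h(2)[of n] norm_triangle_ineq2[of y x] by (simp add: norm_minus_commute)
        then show ?thesis using mollifier_eq_0[OF h(1)] by simp
      qed (use HR[of x] in \<open>simp add: W_def\<close>)
      then have "A n y = 0" unfolding A_def by (simp only: nn_integral_const mult_zero_left)
      then show ?thesis by simp
    qed
    have lim: "(\<lambda>n. \<integral>\<^sup>+y. ennreal (dnorm y) * A n y \<partial>lborel) \<longlonglongrightarrow> (\<integral>\<^sup>+y. ennreal (dnorm y) * ennreal (W y) \<partial>lborel)"
    proof (rule nn_integral_dominated_convergence[where w="\<lambda>y. ennreal (dnorm y) * (ennreal BW * indicator (ball 0 (R + 2)) y)"])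
      show "AE y in lborel. ennreal (dnorm y) * A n y \<le> ennreal (dnorm y) * (ennreal BW * indicator (ball 0 (R + 2)) y)" for n
        using A_bound by (auto intro!: mult_left_mono)
      have "(\<integral>\<^sup>+y. ennreal (dnorm y) * (ennreal BW * indicator (ball 0 (R + 2)) y) \<partial>lborel)
        = (\<integral>\<^sup>+y. ennreal BW * (ennreal (norm (dnorm y)) * indicator (ball 0 (R + 2)) y) \<partial>lborel)"
        by (intro nn_integral_cong) (simp add: mult_ac)
      also have "\<dots> = ennreal BW * (\<integral>\<^sup>+x. ennreal (norm (dnorm x)) * indicator (ball 0 (R + 2)) x \<partial>lborel)"
        by (rule nn_integral_cmult) measurable
      also have "\<dots> < \<infinity>"
        using locally_integrable_ball[OF locally_integrable_dz_dzbar(3), of 0 "R + 2"] by (simp add: ennreal_mult_less_top)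
      finally show "(\<integral>\<^sup>+y. ennreal (dnorm y) * (ennreal BW * indicator (ball 0 (R + 2)) y) \<partial>lborel) < \<infinity>" .
      show "AE y in lborel. (\<lambda>n. ennreal (dnorm y) * A n y) \<longlonglongrightarrow> ennreal (dnorm y) * ennreal (W y)"
        using A_lim by eventually_elim (intro ennreal_tendsto_cmult, auto)
    qed measurable
    have "\<forall>\<^sub>F n in sequentially. ennreal (c - M * e) \<le> (\<integral>\<^sup>+y. ennreal (dnorm y) * A n y \<partial>lborel)"
    proof -
      obtain d1 where d1: "0 < d1" "\<And>x y. cmod x \<le> R \<Longrightarrow> cmod (y - f x) \<le> d1 \<Longrightarrow> \<bar>S y - S (f x)\<bar> \<le> e \<and> cmod (\<sigma> y - \<sigma> (f x)) \<le> e"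
      proof -
        have "compact (f ` cball 0 R)"
          by (intro compact_continuous_image continuous_on_subset[OF cont]) auto
        then obtain Q where "\<forall>y\<in>f ` cball 0 R. cmod y \<le> Q"
          by (meson bounded_iff compact_imp_bounded)
        then have Q: "\<And>x. cmod x \<le> R \<Longrightarrow> cmod (f x) \<le> Q" by auto
        have "uniformly_continuous_on (cball 0 (Q + 1)) S" "uniformly_continuous_on (cball 0 (Q + 1)) \<sigma>"
          by (intro compact_uniformly_continuous continuous_on_subset[OF cS] continuous_on_subset[OF c\<sigma>]; simp)+
        then obtain da db where dab: "0 < da" "0 < db"
          "\<And>x y. x \<in> cball 0 (Q + 1) \<Longrightarrow> y \<in> cball 0 (Q + 1) \<Longrightarrow> dist y x < da \<Longrightarrow> dist (S y) (S x) < e"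
          "\<And>x y. x \<in> cball 0 (Q + 1) \<Longrightarrow> y \<in> cball 0 (Q + 1) \<Longrightarrow> dist y x < db \<Longrightarrow> dist (\<sigma> y) (\<sigma> x) < e"
          using e unfolding uniformly_continuous_on_def by metis
        show ?thesis
        proof (rule that[of "min 1 (min (da/2) (db/2))"])
          fix x y assume x: "cmod x \<le> R" and y: "cmod (y - f x) \<le> min 1 (min (da/2) (db/2))"
          have "f x \<in> cball 0 (Q + 1)" using Q[OF x] by simp
          moreover have "y \<in> cball 0 (Q + 1)"
            using Q[OF x] y norm_triangle_sub[of y "f x"] by simp
          moreover have "dist y (f x) < da" "dist y (f x) < db" using y dab by (auto simp: dist_norm)
          ultimately show "\<bar>S y - S (f x)\<bar> \<le> e \<and> cmod (\<sigma> y - \<sigma> (f x)) \<le> e"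
            using dab(3)[of "f x" y] dab(4)[of "f x" y] by (auto simp: dist_norm)
        qed (use dab in auto)
      qed
      obtain h0 where h0: "0 < h0" "\<And>h x. 0 < h \<Longrightarrow> h < h0 \<Longrightarrow> cmod x \<le> R \<Longrightarrow> cmod (mollify h f x - f x) \<le> d1"
        using mollify_approx[OF cont d1(1)] by metis
      have "\<forall>\<^sub>F n in sequentially. h n < h0"
        using hlim h0(1) by (rule order_tendstoD)
      then show ?thesis
      proof eventually_elim
        case (elim n)
        obtain \<tau> where \<tau>: "continuous_on UNIV \<tau>"
          "\<And>x. ((\<lambda>x. S (mollify (h n) f x)) has_derivative (\<lambda>v. \<tau> x \<bullet> v)) (at x)"
          "\<And>x. cmod (\<tau> x) \<le> cmod (\<sigma> (mollify (h n) f x)) * (cmod (mollify (h n) dz x) + cmod (mollify (h n) dzbar x))"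
          using mollified_composition[OF S c\<sigma> h(1)] by metis
        have close: "\<bar>S (mollify (h n) f x) - S (f x)\<bar> \<le> e \<and> cmod (\<sigma> (mollify (h n) f x) - \<sigma> (f x)) \<le> e" if "cmod x \<le> R" for x
          using d1(2)[OF that h0(2)[OF h(1) elim that]] .
        have "ennreal (c - M * e) \<le> (\<integral>\<^sup>+x. ennreal (H x * cmod (\<tau> x)) \<partial>lborel)"
          by (rule hyp[OF e \<tau>(1) \<tau>(2)]) (use close in auto)
        also have "\<dots> \<le> (\<integral>\<^sup>+x. ennreal (W x) * (\<integral>\<^sup>+y. ennreal (mollifier (h n) (x - y)) * ennreal (dnorm y) \<partial>lborel) \<partial>lborel)"
        proof (rule nn_integral_mono)
          fix x
          show "ennreal (H x * cmod (\<tau> x)) \<le> ennreal (W x) * (\<integral>\<^sup>+y. ennreal (mollifier (h n) (x - y)) * ennreal (dnorm y) \<partial>lborel)"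
          proof (cases "cmod x \<le> R")
            case True
            have "cmod (\<sigma> (mollify (h n) f x)) \<le> cmod (\<sigma> (f x)) + e"
              using close[OF True] norm_triangle_sub[of "\<sigma> (mollify (h n) f x)" "\<sigma> (f x)"] by linarith
            then have "H x * cmod (\<tau> x) \<le> W x * (cmod (mollify (h n) dz x) + cmod (mollify (h n) dzbar x))"
              unfolding W_def mult.assoc
              by (intro mult_left_mono H0 order_trans[OF \<tau>(3)] mult_right_mono) auto
            then have "ennreal (H x * cmod (\<tau> x)) \<le> ennreal (W x) * ennreal (cmod (mollify (h n) dz x) + cmod (mollify (h n) dzbar x))"
              using W0 by (metis ennreal_leI ennreal_mult')
            also have "\<dots> \<le> ennreal (W x) * (\<integral>\<^sup>+y. ennreal (mollifier (h n) (x - y)) * ennreal (dnorm y) \<partial>lborel)"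
              unfolding dnorm_def by (intro mult_left_mono mollify_pair_le locally_integrable_dz_dzbar h) auto
            finally show ?thesis .
          qed (simp add: HR)
        qed
        \<comment> \<open>Fubini transfers the kernel from the derivatives of f to the
          weight.\<close>
        also have "\<dots> = (\<integral>\<^sup>+x. \<integral>\<^sup>+y. ennreal (W x) * (ennreal (mollifier (h n) (x - y)) * ennreal (dnorm y)) \<partial>lborel \<partial>lborel)"
          by (intro nn_integral_cong nn_integral_cmult[symmetric]) measurable
        also have "\<dots> = (\<integral>\<^sup>+y. \<integral>\<^sup>+x. ennreal (W x) * (ennreal (mollifier (h n) (x - y)) * ennreal (dnorm y)) \<partial>lborel \<partial>lborel)"
          by (rule lborel_pair.Fubini') measurable
        also have "\<dots> = (\<integral>\<^sup>+y. ennreal (dnorm y) * A n y \<partial>lborel)"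
          unfolding A_def by (subst nn_integral_cmult[symmetric]) (auto simp: mult_ac intro!: nn_integral_cong)
        finally show ?case .
      qed
    qed
    then have "ennreal (c - M * e) \<le> (\<integral>\<^sup>+y. ennreal (dnorm y) * ennreal (W y) \<partial>lborel)"
      by (intro tendsto_lowerbound[OF lim]) auto
    also have "\<dots> = (\<integral>\<^sup>+y. ennreal (H y * cmod (\<sigma> (f y)) * dnorm y) + ennreal e * (ennreal (H y) * ennreal (dnorm y)) \<partial>lborel)"
    proof (rule nn_integral_cong)
      fix y
      show "ennreal (dnorm y) * ennreal (W y) = ennreal (H y * cmod (\<sigma> (f y)) * dnorm y) + ennreal e * (ennreal (H y) * ennreal (dnorm y))"
        using H0[of y] e by (simp add: W_def ennreal_mult[symmetric] ennreal_plus[symmetric] algebra_simps del: ennreal_plus)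
    qed
    also have "\<dots> = I + ennreal e * Z"
      unfolding I_def Z_def by (simp add: nn_integral_add nn_integral_cmult)
    finally show ?thesis .
  qed
  obtain z where z: "0 \<le> z" "Z = ennreal z" using Z by (cases Z) auto
  show ?thesis
    unfolding I_def[symmetric]
  proof (rule ennreal_le_epsilon)
    fix e :: real assume e: "0 < e"
    \<comment> \<open>The two errors are d z from the weighted energy and M d from the hypothesis;
      with this d they sum to at most e.\<close>
    define d where "d = e / (M + z + 1)"
    have d: "0 < d" "d * (M + z) \<le> e"
      using e M z by (auto simp: d_def field_simps)
    have "ennreal c \<le> ennreal (c - M * d) + ennreal (M * d)"
      using d M by (cases "0 \<le> c - M * d") (auto simp: ennreal_plus[symmetric] ennreal_neg intro!: ennreal_leI simp del: ennreal_plus)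
    also have "\<dots> \<le> I + ennreal d * Z + ennreal (M * d)"
      by (intro add_right_mono main d)
    also have "\<dots> = I + ennreal (d * z + M * d)"
      using d z M by (simp add: ennreal_mult[symmetric] ennreal_plus add.assoc)
    also have "\<dots> \<le> I + ennreal e"
      using d by (intro add_left_mono ennreal_leI) (simp add: algebra_simps)
    finally show "ennreal c \<le> I + ennreal e" .
  qed
qed

end

section \<open>Polar coordinates about p with axis b, and estimates along arcs, radii and
  circles\<close>

definition pol :: "complex \<Rightarrow> complex \<Rightarrow> real \<Rightarrow> real \<Rightarrow> complex" where
  "pol p b t \<phi> = p + b * (of_real t * cis \<phi>)"

lemma norm_pol_diff: "cmod b = 1 \<Longrightarrow> cmod (pol p b t \<phi> - p) = \<bar>t\<bar>"
  by (simp add: pol_def norm_mult)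

lemma pol_surj:
  assumes "cmod b = 1"
  obtains \<phi> where "-pi < \<phi>" "\<phi> \<le> pi" "x = pol p b (cmod (x - p)) \<phi>"
proof -
  have b: "b \<noteq> 0" using assms by auto
  have "cmod ((x - p) / b) = cmod (x - p)" using assms by (simp add: norm_divide)
  then have "(x - p) / b = of_real (cmod (x - p)) * cis (Arg ((x - p) / b))"
    using rcis_cmod_Arg[of "(x - p) / b"] by (simp add: rcis_def)
  then have "x = pol p b (cmod (x - p)) (Arg ((x - p) / b))"
    using b by (simp add: pol_def field_simps)
  then show ?thesis
    using that mpi_less_Arg Arg_le_pi by blast
qed

lemma continuous_on_pol [continuous_intros]:
  assumes "continuous_on S s" "continuous_on S r"
  shows "continuous_on S (\<lambda>x. pol p b (s x) (r x))"
  unfolding pol_def cis_conv_exp by (intro continuous_intros assms)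

lemma pol_measurable [measurable]: "(\<lambda>t. pol p b t \<phi>) \<in> borel_measurable borel"
  by (intro borel_measurable_continuous_onI continuous_intros)

lemma pol_pair_measurable [measurable]: "(\<lambda>(t, \<phi>). pol p b t \<phi>) \<in> borel_measurable (borel \<Otimes>\<^sub>M borel)"
  unfolding borel_prod case_prod_beta by (intro borel_measurable_continuous_onI continuous_intros)

lemma has_vector_derivative_pol_angle:
  "((\<lambda>\<phi>. pol p b t \<phi>) has_vector_derivative b * (of_real t * (\<i> * cis \<phi>))) (at \<phi> within A)"
proof -
  have "(cis has_vector_derivative \<i> * cis \<phi>) (at \<phi> within A)"
    unfolding has_vector_derivative_def cis_conv_exp
    by (rule has_derivative_eq_rhs[OF has_derivative_compose[OF _ DERIV_exp[unfolded has_field_derivative_def]]])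
       (auto intro!: derivative_eq_intros simp: scaleR_conv_of_real mult_ac)
  then show ?thesis
    unfolding pol_def by (auto intro!: derivative_eq_intros)
qed

lemma has_vector_derivative_pol_radius:
  "((\<lambda>t. pol p b t \<phi>) has_vector_derivative b * cis \<phi>) (at t within A)"
  unfolding pol_def by (auto intro!: derivative_eq_intros)

lemma curve_estimate:
  fixes u :: "complex \<Rightarrow> real" and \<tau> :: "complex \<Rightarrow> complex" and \<gamma> :: "real \<Rightarrow> complex"
  assumes \<tau>: "continuous_on UNIV \<tau>" and u: "\<And>x. (u has_derivative (\<lambda>v. \<tau> x \<bullet> v)) (at x)"
    and ab: "a \<le> b" and \<gamma>: "\<And>t. (\<gamma> has_vector_derivative \<gamma>' t) (at t within {a..b})"
    and c\<gamma>: "continuous_on {a..b} \<gamma>'" and l: "\<And>t. cmod (\<gamma>' t) \<le> l"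
  shows "ennreal \<bar>u (\<gamma> b) - u (\<gamma> a)\<bar> \<le> (\<integral>\<^sup>+t. ennreal (cmod (\<tau> (\<gamma> t)) * l) * indicator {a..b} t \<partial>lborel)"
proof -
  have "ennreal (norm (u (\<gamma> b) - u (\<gamma> a))) \<le> (\<integral>\<^sup>+t. ennreal (cmod (\<tau> (\<gamma> t)) * l) * indicator {a..b} t \<partial>lborel)"
  proof (rule norm_diff_le_nn_integral[OF ab, of "\<lambda>t. u (\<gamma> t)" "\<lambda>t. \<tau> (\<gamma> t) \<bullet> \<gamma>' t"])
    show "((\<lambda>t. u (\<gamma> t)) has_vector_derivative \<tau> (\<gamma> t) \<bullet> \<gamma>' t) (at t within {a..b})" for t
      using has_derivative_compose[OF \<gamma>[unfolded has_vector_derivative_def] u]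
      unfolding has_vector_derivative_def by (rule has_derivative_eq_rhs) auto
    have "continuous_on {a..b} \<gamma>"
      using \<gamma> by (meson continuous_on_eq_continuous_within has_vector_derivative_continuous)
    then show "continuous_on {a..b} (\<lambda>t. \<tau> (\<gamma> t) \<bullet> \<gamma>' t)"
      by (intro continuous_intros continuous_on_compose2[OF \<tau>] c\<gamma>) auto
    show "norm (\<tau> (\<gamma> t) \<bullet> \<gamma>' t) \<le> cmod (\<tau> (\<gamma> t)) * l" for t
      using Cauchy_Schwarz_ineq2[of "\<tau> (\<gamma> t)" "\<gamma>' t"] mult_left_mono[OF l[of t], of "cmod (\<tau> (\<gamma> t))"] by simp
  qed
  then show ?thesis by simp
qed

lemma arc_estimate:
  fixes u :: "complex \<Rightarrow> real" and \<tau> :: "complex \<Rightarrow> complex"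
  assumes \<tau>: "continuous_on UNIV \<tau>" and u: "\<And>x. (u has_derivative (\<lambda>v. \<tau> x \<bullet> v)) (at x)"
    and b: "cmod b = 1" and t: "0 \<le> t"
  shows "ennreal \<bar>u (pol p b t \<phi>2) - u (pol p b t \<phi>1)\<bar> \<le>
    (\<integral>\<^sup>+\<phi>. ennreal (cmod (\<tau> (pol p b t \<phi>)) * t) * indicator {min \<phi>1 \<phi>2..max \<phi>1 \<phi>2} \<phi> \<partial>lborel)"
proof -
  have *: "ennreal \<bar>u (pol p b t y) - u (pol p b t x)\<bar> \<le>
    (\<integral>\<^sup>+\<phi>. ennreal (cmod (\<tau> (pol p b t \<phi>)) * t) * indicator {x..y} \<phi> \<partial>lborel)" if "x \<le> y" for x y
    by (rule curve_estimate[OF \<tau> u that, of "pol p b t" "\<lambda>\<phi>. b * (of_real t * (\<i> * cis \<phi>))"])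
       (use b t in \<open>auto simp: norm_mult cis_conv_exp intro!: has_vector_derivative_pol_angle[unfolded cis_conv_exp] continuous_intros\<close>)
  show ?thesis
  proof (cases "\<phi>1 \<le> \<phi>2")
    case True
    then show ?thesis using *[of \<phi>1 \<phi>2] by simp
  next
    case False
    then show ?thesis using *[of \<phi>2 \<phi>1] by (simp add: abs_minus_commute min_def max_def)
  qed
qed

lemma radius_estimate:
  fixes u :: "complex \<Rightarrow> real" and \<tau> :: "complex \<Rightarrow> complex"
  assumes \<tau>: "continuous_on UNIV \<tau>" and u: "\<And>x. (u has_derivative (\<lambda>v. \<tau> x \<bullet> v)) (at x)"
    and b: "cmod b = 1" and st: "s \<le> t"
  shows "ennreal \<bar>u (pol p b t \<phi>) - u (pol p b s \<phi>)\<bar> \<le>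
    (\<integral>\<^sup>+r. ennreal (cmod (\<tau> (pol p b r \<phi>))) * indicator {s..t} r \<partial>lborel)"
  using curve_estimate[OF \<tau> u st, of "\<lambda>r. pol p b r \<phi>" "\<lambda>r. b * cis \<phi>" 1] b
  by (auto simp: norm_mult intro!: has_vector_derivative_pol_radius)

lemma nn_integral_pol:
  fixes F :: "complex \<Rightarrow> ennreal"
  assumes "F \<in> borel_measurable borel" "cmod b = 1"
  shows "(\<integral>\<^sup>+z. F z \<partial>lborel) =
    (\<integral>\<^sup>+t. \<integral>\<^sup>+\<phi>. F (pol p b t \<phi>) * (ennreal t * indicator {0<..} t * indicator {-pi<..<pi} \<phi>) \<partial>lborel \<partial>lborel)"
  unfolding pol_def by (rule nn_integral_polar[OF assms])

lemma square_max_has_derivative: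
  "((\<lambda>s. (max 0 s)\<^sup>2) has_real_derivative 2 * max 0 s) (at s)"
proof -
  consider "s > 0" | "s < 0" | "s = 0" by linarith
  then show ?thesis
  proof cases
    case 1
    have "((\<lambda>s. s\<^sup>2) has_real_derivative 2 * max 0 s) (at s)"
      using 1 by (auto intro!: derivative_eq_intros)
    then show ?thesis
      by (rule has_field_derivative_transform_within[where d=s]) (use 1 in \<open>auto simp: dist_real_def max_def\<close>)
  next
    case 2
    have "((\<lambda>s. 0) has_real_derivative 2 * max 0 s) (at s)"
      using 2 by (auto intro!: derivative_eq_intros)
    then show ?thesis
      by (rule has_field_derivative_transform_within[where d="-s"]) (use 2 in \<open>auto simp: dist_real_def max_def\<close>)
  next
    case 3
    have "((\<lambda>h::real. (max 0 h)\<^sup>2 / h) \<longlongrightarrow> 0) (at 0)"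
    proof (rule Lim_null_comparison)
      have "norm ((max 0 h)\<^sup>2 / h) \<le> \<bar>h\<bar>" for h :: real
        by (cases "0 < h") (auto simp: max_def power2_eq_square)
      then show "\<forall>\<^sub>F h in at 0. norm ((max 0 h)\<^sup>2 / h) \<le> \<bar>h::real\<bar>" by simp
      show "((\<lambda>h::real. \<bar>h\<bar>) \<longlongrightarrow> 0) (at 0)" by (intro tendsto_rabs_zero tendsto_ident_at)
    qed
    then show ?thesis using 3 by (simp add: DERIV_def)
  qed
qed

context sobolev_map
begin

text \<open>A C1 bump S on the ball of radius \<kappa> about c varies by at least 9/16 \<kappa>^4
  along each circle of radius t in (r/4, r/2). Integration over t gives 9/64 \<kappa>^4 r. By
  Cauchy-Schwarz and the area inequality the square of this is at most the distortion integral times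
  16 \<kappa>^6 * pi \<kappa>^2, which yields 81/(65536 pi) r^2 with \<kappa> cancelled.\<close>

lemma ball_crossing:
  assumes hom: "homeomorphism UNIV UNIV f g"
    and kk [measurable]: "kk \<in> borel_measurable borel" and kk0: "\<And>x. 0 \<le> kk x"
    and dist: "AE x in lborel. (dnorm x)\<^sup>2 \<le> kk x * jac x"
    and \<kappa>: "0 < \<kappa>" and r: "0 < r"
    and cross: "\<And>t. r / 4 < t \<Longrightarrow> t < r / 2 \<Longrightarrow>
      \<exists>x y. cmod (x - z) = t \<and> cmod (y - z) = t \<and> cmod (f x - c) \<le> \<kappa> / 2 \<and> \<kappa> \<le> cmod (f y - c)"
  shows "ennreal (81 / (65536 * pi) * r\<^sup>2) \<le> (\<integral>\<^sup>+x. ennreal (kk x) * indicator (ball z r \<inter> f -` ball c \<kappa>) x \<partial>lborel)"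
proof (rule ccontr)
  \<comment> \<open>The outer square makes the truncation at the boundary of the ball continuously
    differentiable.\<close>
  define S where "S y = (max 0 (\<kappa>\<^sup>2 - (cmod (y - c))\<^sup>2))\<^sup>2" for y
  define \<sigma> where "\<sigma> y = (-4 * max 0 (\<kappa>\<^sup>2 - (cmod (y - c))\<^sup>2)) *\<^sub>R (y - c)" for y
  define Ann where "Ann = {x. r/4 < cmod (x - z) \<and> cmod (x - z) < r/2}"
  define U where "U = ball z r \<inter> f -` ball c \<kappa>"
  have [measurable]: "Ann \<in> sets borel" unfolding Ann_def by measurable
  have [measurable]: "f -` ball c \<kappa> \<in> sets borel"
    using measurable_sets[of f borel borel "ball c \<kappa>"] by simp
  have [measurable]: "U \<in> sets borel" unfolding U_def by measurable
  have c\<sigma>: "continuous_on UNIV \<sigma>" unfolding \<sigma>_def by (intro continuous_intros)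
  have [measurable]: "\<sigma> \<in> borel_measurable borel" by (rule borel_measurable_continuous_onI[OF c\<sigma>])
  have S: "(S has_derivative (\<lambda>v. \<sigma> y \<bullet> v)) (at y)" for y
  proof -
    have "((\<lambda>y. \<kappa>\<^sup>2 - (cmod (y - c))\<^sup>2) has_derivative (\<lambda>v. - 2 * ((y - c) \<bullet> v))) (at y)"
      unfolding power2_norm_eq_inner by (auto intro!: derivative_eq_intros simp: inner_commute)
    from has_derivative_compose[OF this square_max_has_derivative[unfolded has_field_derivative_def]]
    show ?thesis unfolding S_def \<sigma>_def by (rule has_derivative_eq_rhs) (auto simp: fun_eq_iff)
  qed
  have \<sigma>_le: "cmod (\<sigma> y) \<le> 4 * \<kappa> ^ 3 * indicator (ball c \<kappa>) y" for y
  proof (cases "cmod (y - c) < \<kappa>")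
    case True
    have "cmod (\<sigma> y) = 4 * max 0 (\<kappa>\<^sup>2 - (cmod (y - c))\<^sup>2) * cmod (y - c)"
      by (simp add: \<sigma>_def)
    also have "\<dots> \<le> 4 * \<kappa>\<^sup>2 * \<kappa>"
      using True \<kappa> by (intro mult_mono) auto
    finally show ?thesis using True by (simp add: dist_norm norm_minus_commute power2_eq_square power3_eq_cube)
  next
    case False
    then have "\<kappa>\<^sup>2 \<le> (cmod (y - c))\<^sup>2" using \<kappa> by (intro power_mono) auto
    then show ?thesis using \<kappa> by (simp add: \<sigma>_def max_def)
  qed
  have energy: "ennreal (9 / 64 * \<kappa> ^ 4 * r) \<le> (\<integral>\<^sup>+x. ennreal (indicator Ann x * cmod (\<sigma> (f x)) * dnorm x) \<partial>lborel)"
  proof (rule capacity_bound[OF S c\<sigma>, of "indicator Ann" 1 "cmod z + r" "r / 2"])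
    show "indicator Ann x = (0::real)" if "cmod z + r < cmod x" for x
      using that norm_triangle_sub[of x z] r by (auto simp: Ann_def indicator_def)
    fix u :: "complex \<Rightarrow> real" and \<tau> :: "complex \<Rightarrow> complex" and e :: real
    assume e: "0 < e" and \<tau>: "continuous_on UNIV \<tau>" and u: "\<And>x. (u has_derivative (\<lambda>v. \<tau> x \<bullet> v)) (at x)"
      and close: "\<And>x. cmod x \<le> cmod z + r \<Longrightarrow> \<bar>u x - S (f x)\<bar> \<le> e"
    have [measurable]: "\<tau> \<in> borel_measurable borel" by (rule borel_measurable_continuous_onI[OF \<tau>])
    define F where "F x = ennreal (indicator Ann x * cmod (\<tau> x))" for x
    have [measurable]: "F \<in> borel_measurable borel" unfolding F_def by measurable
    \<comment> \<open>S is at least (3/4 \<kappa>^2)^2 = 9/16 \<kappa>^4 at the inner point and 0 at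
      the outer one; u differs from S o f by at most e at each of the two.\<close>
    define c1 where "c1 = 9 / 16 * \<kappa> ^ 4 - 2 * e"
    have circ: "ennreal c1 \<le> (\<integral>\<^sup>+\<phi>. F (pol z 1 t \<phi>) * (ennreal t * indicator {0<..} t * indicator {-pi<..<pi} \<phi>) \<partial>lborel)"
      if t: "r / 4 < t" "t < r / 2" for t
    proof -
      obtain x y where xy: "cmod (x - z) = t" "cmod (y - z) = t" "cmod (f x - c) \<le> \<kappa> / 2" "\<kappa> \<le> cmod (f y - c)"
        using cross[OF t] by blast
      obtain \<phi>1 where \<phi>1: "-pi < \<phi>1" "\<phi>1 \<le> pi" "x = pol z 1 t \<phi>1"
        using pol_surj[of 1 x z] xy by auto
      obtain \<phi>2 where \<phi>2: "-pi < \<phi>2" "\<phi>2 \<le> pi" "y = pol z 1 t \<phi>2"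
        using pol_surj[of 1 y z] xy by auto
      have nx: "cmod x \<le> cmod z + r" "cmod y \<le> cmod z + r"
        using xy t r norm_triangle_sub[of x z] norm_triangle_sub[of y z] by auto
      have "9 / 16 * \<kappa> ^ 4 \<le> S (f x)"
      proof -
        have "(cmod (f x - c))\<^sup>2 \<le> (\<kappa> / 2)\<^sup>2" using xy by (intro power_mono) auto
        then have "3 / 4 * \<kappa>\<^sup>2 \<le> max 0 (\<kappa>\<^sup>2 - (cmod (f x - c))\<^sup>2)"
          by (simp add: power_divide le_max_iff_disj)
        then have "(3 / 4 * \<kappa>\<^sup>2)\<^sup>2 \<le> S (f x)"
          unfolding S_def by (rule power_mono) simp
        then show ?thesis by (simp add: power_mult_distrib power_divide)
      qed
      moreover have "S (f y) = 0"
      proof -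
        have "\<kappa>\<^sup>2 \<le> (cmod (f y - c))\<^sup>2" using xy \<kappa> by (intro power_mono) auto
        then show ?thesis by (simp add: S_def max_def)
      qed
      ultimately have "c1 \<le> \<bar>u y - u x\<bar>"
        using close[OF nx(1)] close[OF nx(2)] unfolding c1_def by linarith
      then have "ennreal c1 \<le> ennreal \<bar>u (pol z 1 t \<phi>2) - u (pol z 1 t \<phi>1)\<bar>"
        using \<phi>1 \<phi>2 by (intro ennreal_leI) simp
      also have "\<dots> \<le> (\<integral>\<^sup>+\<phi>. ennreal (cmod (\<tau> (pol z 1 t \<phi>)) * t) * indicator {min \<phi>1 \<phi>2..max \<phi>1 \<phi>2} \<phi> \<partial>lborel)"
        by (rule arc_estimate[OF \<tau> u]) (use t r in auto)
      also have "\<dots> \<le> (\<integral>\<^sup>+\<phi>. F (pol z 1 t \<phi>) * (ennreal t * indicator {0<..} t * indicator {-pi<..<pi} \<phi>) \<partial>lborel)"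
      proof (rule nn_integral_mono_AE)
        \<comment> \<open>The arc may end at the angle pi, which the open angular interval of the
          polar formula omits.\<close>
        have "AE \<phi> in lborel. \<phi> \<noteq> pi" by (rule AE_lborel_singleton)
        then show "AE \<phi> in lborel. ennreal (cmod (\<tau> (pol z 1 t \<phi>)) * t) * indicator {min \<phi>1 \<phi>2..max \<phi>1 \<phi>2} \<phi>
          \<le> F (pol z 1 t \<phi>) * (ennreal t * indicator {0<..} t * indicator {-pi<..<pi} \<phi>)"
        proof eventually_elim
          case (elim \<phi>)
          have "pol z 1 t \<phi> \<in> Ann"
            using t r by (simp add: Ann_def norm_pol_diff)
          moreover have "\<phi> \<in> {min \<phi>1 \<phi>2..max \<phi>1 \<phi>2} \<Longrightarrow> \<phi> \<in> {-pi<..<pi}"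
            using \<phi>1 \<phi>2 elim by (auto simp: min_def max_def split: if_splits)
          ultimately show ?case
            using t r by (auto simp: F_def indicator_def ennreal_mult)
        qed
      qed
      finally show ?thesis .
    qed
    have "ennreal (9 / 64 * \<kappa> ^ 4 * r - r / 2 * e) = ennreal (c1 * (r / 4))"
      by (simp add: c1_def algebra_simps)
    also have "\<dots> = ennreal c1 * ennreal (r / 4)"
      by (rule ennreal_mult'') (use r in simp)
    also have "\<dots> = (\<integral>\<^sup>+t. ennreal c1 * indicator {r/4<..<r/2} t \<partial>lborel)"
      using r by (simp add: nn_integral_cmult_indicator)
    also have "\<dots> \<le> (\<integral>\<^sup>+t. \<integral>\<^sup>+\<phi>. F (pol z 1 t \<phi>) * (ennreal t * indicator {0<..} t * indicator {-pi<..<pi} \<phi>) \<partial>lborel \<partial>lborel)"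
      using circ by (intro nn_integral_mono) (auto simp: indicator_def)
    also have "\<dots> = (\<integral>\<^sup>+x. F x \<partial>lborel)"
      by (rule nn_integral_pol[symmetric]) auto
    finally show "ennreal (9 / 64 * \<kappa> ^ 4 * r - r / 2 * e) \<le> (\<integral>\<^sup>+x. ennreal (indicator Ann x * cmod (\<tau> x)) \<partial>lborel)"
      by (simp add: F_def)
  qed (use r in \<open>auto simp: indicator_def\<close>)
  assume "\<not> ennreal (81 / (65536 * pi) * r\<^sup>2) \<le> (\<integral>\<^sup>+x. ennreal (kk x) * indicator (ball z r \<inter> f -` ball c \<kappa>) x \<partial>lborel)"
  then have "(\<integral>\<^sup>+x. ennreal (kk x) * indicator U x \<partial>lborel) < ennreal (81 / (65536 * pi) * r\<^sup>2)"
    by (simp add: U_def)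
  \<comment> \<open>An intermediate value is positive and finite, as required by the Cauchy-Schwarz
    lemma, and still leaves a strict inequality for the contradiction.\<close>
  then obtain A' where A': "(\<integral>\<^sup>+x. ennreal (kk x) * indicator U x \<partial>lborel) < A'" "A' < ennreal (81 / (65536 * pi) * r\<^sup>2)"
    using dense by blast
  then obtain A where A: "A' = ennreal A" "0 \<le> A" by (cases A') auto
  have A0: "0 < A"
  proof -
    have "(0::ennreal) < A'" using A'(1) by (rule le_less_trans[rotated]) simp
    then show ?thesis using A by simp
  qed
  have A2: "A < 81 / (65536 * pi) * r\<^sup>2"
    using A'(2) A by (simp add: ennreal_less_iff)
  define B where "B = 16 * \<kappa> ^ 6 * (pi * \<kappa>\<^sup>2)"
  have "(9 / 64 * \<kappa> ^ 4 * r)\<^sup>2 \<le> A * B"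
  proof (rule nn_integral_Cauchy_Schwarz[where M=lborel and w="\<lambda>x. indicator Ann x * cmod (\<sigma> (f x)) * dnorm x"
      and \<alpha>="\<lambda>x. kk x * indicator U x" and \<beta>="\<lambda>x. (cmod (\<sigma> (f x)))\<^sup>2 * \<bar>jac x\<bar>"])
    show "AE x in lborel. 0 \<le> kk x * indicator U x \<and> 0 \<le> (cmod (\<sigma> (f x)))\<^sup>2 * \<bar>jac x\<bar> \<and>
        (indicator Ann x * cmod (\<sigma> (f x)) * dnorm x)\<^sup>2 \<le> kk x * indicator U x * ((cmod (\<sigma> (f x)))\<^sup>2 * \<bar>jac x\<bar>)"
      using dist
    proof eventually_elim
      case (elim x)
      have "(indicator Ann x * cmod (\<sigma> (f x)) * dnorm x)\<^sup>2 \<le> kk x * indicator U x * ((cmod (\<sigma> (f x)))\<^sup>2 * \<bar>jac x\<bar>)"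
      proof (cases "x \<in> Ann \<and> \<sigma> (f x) \<noteq> 0")
        case True
        then have "f x \<in> ball c \<kappa>"
          using \<sigma>_le[of "f x"] by (cases "f x \<in> ball c \<kappa>") auto
        then have "x \<in> U"
          using True r by (auto simp: U_def Ann_def dist_norm norm_minus_commute)
        have "(dnorm x)\<^sup>2 \<le> kk x * \<bar>jac x\<bar>"
          using elim kk0[of x] by (smt (verit) abs_ge_self mult_left_mono)
        then have "(cmod (\<sigma> (f x)))\<^sup>2 * (dnorm x)\<^sup>2 \<le> (cmod (\<sigma> (f x)))\<^sup>2 * (kk x * \<bar>jac x\<bar>)"
          by (rule mult_left_mono) simp
        then show ?thesis using True \<open>x \<in> U\<close> by (simp add: power_mult_distrib mult_ac)
      qed (use kk0 in \<open>auto simp: indicator_def\<close>)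
      then show ?case using kk0 by simp
    qed
    have "(\<integral>\<^sup>+x. ennreal (kk x * indicator U x) \<partial>lborel) = (\<integral>\<^sup>+x. ennreal (kk x) * indicator U x \<partial>lborel)"
      by (intro nn_integral_cong) (auto simp: indicator_def)
    then show "(\<integral>\<^sup>+x. ennreal (kk x * indicator U x) \<partial>lborel) \<le> ennreal A"
      using A'(1) A(1) by simp
    have "(\<integral>\<^sup>+x. ennreal ((cmod (\<sigma> (f x)))\<^sup>2 * \<bar>jac x\<bar>) \<partial>lborel) = (\<integral>\<^sup>+x. ennreal ((cmod (\<sigma> (f x)))\<^sup>2) * ennreal \<bar>jac x\<bar> \<partial>lborel)"
      by (simp add: ennreal_mult)
    also have "\<dots> \<le> (\<integral>\<^sup>+y. ennreal ((cmod (\<sigma> y))\<^sup>2) \<partial>lborel)"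
      by (rule area_inequality[OF hom, of "\<lambda>y. ennreal ((cmod (\<sigma> y))\<^sup>2)"]) measurable
    also have "\<dots> \<le> (\<integral>\<^sup>+y. ennreal (16 * \<kappa> ^ 6) * indicator (ball c \<kappa>) y \<partial>lborel)"
    proof (rule nn_integral_mono)
      fix y
      have "(cmod (\<sigma> y))\<^sup>2 \<le> (4 * \<kappa> ^ 3 * indicator (ball c \<kappa>) y)\<^sup>2"
        by (rule power_mono[OF \<sigma>_le]) simp
      also have "\<dots> = 16 * \<kappa> ^ 6 * indicator (ball c \<kappa>) y"
        by (simp add: power_mult_distrib indicator_def flip: power_mult)
      finally show "ennreal ((cmod (\<sigma> y))\<^sup>2) \<le> ennreal (16 * \<kappa> ^ 6) * indicator (ball c \<kappa>) y"
        by (auto simp: indicator_def intro: ennreal_leI split: if_splits)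
    qed
    also have "\<dots> = ennreal B"
      using \<kappa> by (simp add: B_def nn_integral_cmult_indicator measure_lborel_ball_complex ennreal_mult)
    finally show "(\<integral>\<^sup>+x. ennreal ((cmod (\<sigma> (f x)))\<^sup>2 * \<bar>jac x\<bar>) \<partial>lborel) \<le> ennreal B" .
  qed (use energy A0 r \<kappa> in \<open>auto simp: B_def\<close>)
  also have "A * B < 81 / (65536 * pi) * r\<^sup>2 * B"
    using A2 \<kappa> by (intro mult_strict_right_mono) (auto simp: B_def)
  also have "\<dots> = (9 / 64 * \<kappa> ^ 4 * r)\<^sup>2"
    by (simp add: B_def power_mult_distrib power_divide flip: power_mult)
  finally show False by simp
qed

end

subsection \<open>Compression inside the disk\<close>

lemma cmod_pol_sq:
  assumes b: "cmod b = 1" and p: "p = - (of_real q * b)"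
  shows "(cmod (pol p b t \<phi>))\<^sup>2 = q\<^sup>2 + t\<^sup>2 - 2 * q * t * cos \<phi>"
proof -
  have "pol p b t \<phi> = b * (of_real t * cis \<phi> - of_real q)"
    by (simp add: pol_def p algebra_simps)
  then have "cmod (pol p b t \<phi>) = cmod (of_real t * cis \<phi> - of_real q)"
    using b by (simp add: norm_mult)
  also have "(\<dots>)\<^sup>2 = (t * cos \<phi> - q)\<^sup>2 + (t * sin \<phi>)\<^sup>2"
    by (simp add: cmod_power2)
  also have "\<dots> = q\<^sup>2 + t\<^sup>2 * ((cos \<phi>)\<^sup>2 + (sin \<phi>)\<^sup>2) - 2 * q * t * cos \<phi>"
  proof -
    have "(t * c - q)\<^sup>2 + (t * s)\<^sup>2 = q\<^sup>2 + t\<^sup>2 * (c\<^sup>2 + s\<^sup>2) - 2 * q * t * c" for c s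
      by (simp add: power2_eq_square algebra_simps)
    then show ?thesis .
  qed
  finally show ?thesis by simp
qed

text \<open>When the axis points from p through the origin, the law of cosines makes the modulus an
  increasing function of |\<phi>| on [0, pi]. An angle between two angles is no larger in modulus
  than one of them.\<close>

lemma pol_in_cball_arc:
  assumes b: "cmod b = 1" and p: "p = - (of_real q * b)" and q: "0 \<le> q" and t: "0 \<le> t"
    and 1: "pol p b t \<phi>1 \<in> cball 0 1" "\<bar>\<phi>1\<bar> \<le> pi" and 2: "pol p b t \<phi>2 \<in> cball 0 1" "\<bar>\<phi>2\<bar> \<le> pi"
    and \<psi>: "min \<phi>1 \<phi>2 \<le> \<psi>" "\<psi> \<le> max \<phi>1 \<phi>2"
  shows "pol p b t \<psi> \<in> cball 0 1"
proof -
  have *: "pol p b t \<psi> \<in> cball 0 1" if "\<bar>\<psi>\<bar> \<le> \<bar>\<phi>\<bar>" "\<bar>\<phi>\<bar> \<le> pi" "pol p b t \<phi> \<in> cball 0 1" for \<phi>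
  proof -
    have "cos \<bar>\<phi>\<bar> \<le> cos \<bar>\<psi>\<bar>"
      using that by (intro cos_monotone_0_pi_le) auto
    then have "2 * q * t * cos \<phi> \<le> 2 * q * t * cos \<psi>"
      using q t by (intro mult_left_mono) auto
    then have "(cmod (pol p b t \<psi>))\<^sup>2 \<le> (cmod (pol p b t \<phi>))\<^sup>2"
      by (simp add: cmod_pol_sq[OF b p])
    then have "cmod (pol p b t \<psi>) \<le> cmod (pol p b t \<phi>)"
      by (rule power2_le_imp_le) simp
    then show ?thesis using that by simp
  qed
  have "\<bar>\<psi>\<bar> \<le> \<bar>\<phi>1\<bar> \<or> \<bar>\<psi>\<bar> \<le> \<bar>\<phi>2\<bar>" using \<psi> by (auto simp: min_def max_def split: if_splits)
  then show ?thesis using * 1 2 by blast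
qed

text \<open>With R = cos \<Phi> these are the points w of modulus at most R in the cone of
  half-angle \<Phi>. There |w|^2 <= R |w| <= Re w, so the squared modulus of the shifted point is at
  most |w|^2 (1 - 2q) + q^2 <= 1, uniformly up to p on the unit circle.\<close>

lemma sector_in_cball:
  fixes w :: complex
  assumes b: "cmod b = 1" and p: "p = - (of_real q * b)" and q: "0 \<le> q" "q \<le> 1"
    and R: "0 \<le> R" "R \<le> 1" and w: "cmod w \<le> R" and re: "cmod w * R \<le> Re w"
  shows "p + b * w \<in> cball 0 1"
proof -
  have "p + b * w = b * (w - of_real q)" by (simp add: p algebra_simps)
  then have "cmod (p + b * w) = cmod (w - of_real q)" using b by (simp add: norm_mult)
  then have "(cmod (p + b * w))\<^sup>2 = (Re w - q)\<^sup>2 + (Im w)\<^sup>2" by (simp add: cmod_power2)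
  also have "\<dots> = (cmod w)\<^sup>2 + q\<^sup>2 - 2 * q * Re w"
    unfolding cmod_power2 by (simp add: power2_eq_square algebra_simps)
  also have "\<dots> \<le> (cmod w)\<^sup>2 + q\<^sup>2 - 2 * q * (cmod w)\<^sup>2"
  proof -
    have "(cmod w)\<^sup>2 \<le> cmod w * R" unfolding power2_eq_square using w by (intro mult_left_mono) auto
    then have "2 * q * (cmod w)\<^sup>2 \<le> 2 * q * Re w" using re q by (intro mult_left_mono) auto
    then show ?thesis by simp
  qed
  also have "\<dots> \<le> 1\<^sup>2"
  proof -
    have w1: "(cmod w)\<^sup>2 \<le> 1" using w R power_mono[of "cmod w" 1 2] by simp
    have "(cmod w)\<^sup>2 * (1 - 2 * q) + q\<^sup>2 \<le> 1"
    proof (cases "2 * q \<le> 1")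
      case True
      then have "(cmod w)\<^sup>2 * (1 - 2 * q) \<le> 1 * (1 - 2 * q)" using w1 by (intro mult_right_mono) auto
      moreover have "q\<^sup>2 \<le> 2 * q" using q by (simp add: power2_eq_square mult_right_mono)
      ultimately have "(cmod w)\<^sup>2 * (1 - 2 * q) + q\<^sup>2 \<le> 1 * (1 - 2 * q) + 2 * q" by (rule add_mono)
      then show ?thesis by simp
    next
      case False
      then have "(cmod w)\<^sup>2 * (1 - 2 * q) \<le> 0" by (intro mult_nonneg_nonpos) auto
      moreover have "q\<^sup>2 \<le> 1" using q by (simp add: power_le_one)
      ultimately have "(cmod w)\<^sup>2 * (1 - 2 * q) + q\<^sup>2 \<le> 0 + 1" by (rule add_mono)
      then show ?thesis by simp
    qed
    then show ?thesis by (simp add: algebra_simps)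
  qed
  finally have "cmod (p + b * w) \<le> 1" by (rule power2_le_imp_le) simp
  then show ?thesis by simp
qed

text \<open>The integrand is the squared gradient of (1/2) ln (|y - c|^2 + \<delta>^2), a logarithm
  regularised at scale \<delta>. In polar coordinates it is bounded by t/(t^2 + \<delta>^2), whose
  primitive is explicit.\<close>

lemma log_gradient_energy:
  assumes \<delta>: "0 < \<delta>" and M: "0 \<le> M"
  shows "(\<integral>\<^sup>+y. ennreal ((cmod (y - c) / ((cmod (y - c))\<^sup>2 + \<delta>\<^sup>2))\<^sup>2) * indicator (cball c M) y \<partial>lborel)
    \<le> ennreal (pi * ln ((M\<^sup>2 + \<delta>\<^sup>2) / \<delta>\<^sup>2))"
proof -
  have pos: "0 < t\<^sup>2 + \<delta>\<^sup>2" for t using \<delta> by (simp add: add_nonneg_pos)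
  define F where "F y = ennreal ((cmod (y - c) / ((cmod (y - c))\<^sup>2 + \<delta>\<^sup>2))\<^sup>2) * indicator (cball c M) y" for y
  have [measurable]: "F \<in> borel_measurable borel" unfolding F_def by measurable
  have "(\<integral>\<^sup>+y. F y \<partial>lborel) = (\<integral>\<^sup>+t. \<integral>\<^sup>+\<phi>. F (pol c 1 t \<phi>) * (ennreal t * indicator {0<..} t * indicator {-pi<..<pi} \<phi>) \<partial>lborel \<partial>lborel)"
    by (rule nn_integral_pol) auto
  also have "\<dots> \<le> (\<integral>\<^sup>+t. \<integral>\<^sup>+\<phi>. ennreal (t / (t\<^sup>2 + \<delta>\<^sup>2)) * indicator {0..M} t * indicator {-pi<..<pi} (\<phi>::real) \<partial>lborel \<partial>lborel)"
  proof (intro nn_integral_mono)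
    fix t \<phi> :: real
    show "F (pol c 1 t \<phi>) * (ennreal t * indicator {0<..} t * indicator {-pi<..<pi} \<phi>)
      \<le> ennreal (t / (t\<^sup>2 + \<delta>\<^sup>2)) * indicator {0..M} t * indicator {-pi<..<pi} \<phi>"
    proof (cases "0 < t \<and> t \<le> M")
      case True
      have "(t / (t\<^sup>2 + \<delta>\<^sup>2))\<^sup>2 * t = t / (t\<^sup>2 + \<delta>\<^sup>2) * (t\<^sup>2 / (t\<^sup>2 + \<delta>\<^sup>2))"
        by (simp add: power2_eq_square)
      also have "\<dots> \<le> t / (t\<^sup>2 + \<delta>\<^sup>2) * 1"
        using True pos[of t] by (intro mult_left_mono) auto
      finally have "ennreal ((t / (t\<^sup>2 + \<delta>\<^sup>2))\<^sup>2 * t) \<le> ennreal (t / (t\<^sup>2 + \<delta>\<^sup>2))" by (simp add: ennreal_leI)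
      then show ?thesis
        using True by (simp add: F_def norm_pol_diff indicator_def ennreal_mult)
    next
      case False
      then have "F (pol c 1 t \<phi>) = 0 \<or> t \<le> 0"
        using norm_pol_diff[of 1 c t \<phi>] by (auto simp: F_def indicator_def dist_norm norm_minus_commute)
      then show ?thesis by auto
    qed
  qed
  also have "\<dots> = (\<integral>\<^sup>+t. ennreal (t / (t\<^sup>2 + \<delta>\<^sup>2)) * indicator {0..M} t * ennreal (2 * pi) \<partial>lborel)"
    by (intro nn_integral_cong) (simp add: nn_integral_cmult_indicator)
  also have "\<dots> = (\<integral>\<^sup>+t. ennreal (t / (t\<^sup>2 + \<delta>\<^sup>2)) * indicator {0..M} t \<partial>lborel) * ennreal (2 * pi)"
    by (rule nn_integral_multc) measurable
  also have "(\<integral>\<^sup>+t. ennreal (t / (t\<^sup>2 + \<delta>\<^sup>2)) * indicator {0..M} t \<partial>lborel)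
      = ennreal (ln (M\<^sup>2 + \<delta>\<^sup>2) / 2 - ln (0\<^sup>2 + \<delta>\<^sup>2) / 2)"
  proof (rule nn_integral_FTC_Icc[OF _ _ _ M])
    show "DERIV (\<lambda>t. ln (t\<^sup>2 + \<delta>\<^sup>2) / 2) t :> t / (t\<^sup>2 + \<delta>\<^sup>2)" for t
    proof -
      have "DERIV (\<lambda>t. ln (t\<^sup>2 + \<delta>\<^sup>2)) t :> 2 * t / (t\<^sup>2 + \<delta>\<^sup>2)"
        using pos[of t] by (auto intro!: derivative_eq_intros)
      from DERIV_cdivide[OF this, of 2] show ?thesis by (simp del: distrib_left_numeral distrib_right_numeral)
    qed
  qed (use pos in \<open>auto intro!: divide_nonneg_pos\<close>)
  also have "\<dots> * ennreal (2 * pi) = ennreal (pi * ln ((M\<^sup>2 + \<delta>\<^sup>2) / \<delta>\<^sup>2))"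
    using pos[of M] \<delta> by (subst ennreal_mult''[symmetric]) (auto simp: ln_div algebra_simps diff_divide_distrib)
  finally show ?thesis by (simp add: F_def)
qed

context sobolev_map
begin

text \<open>The test curves start at a point of \<open>E\<close> on the circle of radius \<open>t \<in> (r/4, r/2)\<close> about \<open>p\<close>, follow that
  circle inside the disk, and then a radius in the cone of half-angle \<open>\<Phi>\<close> about the direction from \<open>p\<close> to the origin;
  the exponent tends to \<open>2K\<close> as \<open>\<Phi>\<close> tends to \<open>\<pi>/2\<close>.\<close>

lemma compression_core:
  assumes hom: "homeomorphism UNIV UNIV f g"
    and K: "0 < K" and dist: "AE x in lborel. x \<in> ball 0 1 \<longrightarrow> (dnorm x)\<^sup>2 \<le> K * jac x"
    and \<Phi>: "0 < \<Phi>" "\<Phi> < pi / 2"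
    and E: "connected E" "E \<subseteq> cball 0 1" and pq: "p \<in> E" "q \<in> E" "cmod (p - q) = r"
    and r: "0 < r" "r \<le> cos \<Phi>"
    and m0: "0 < m0" "\<And>x. x \<in> cball 0 1 \<Longrightarrow> cmod (x - p) = cos \<Phi> \<Longrightarrow> m0 \<le> cmod (f x - f p)"
    and M0: "0 \<le> M0" "\<And>x. x \<in> cball 0 1 \<Longrightarrow> cmod (f x - f p) \<le> M0"
    and \<delta>: "0 < \<delta>" "2 * \<delta>\<^sup>2 \<le> m0\<^sup>2" "\<And>x. x \<in> E \<Longrightarrow> cmod (f x - f p) \<le> \<delta>"
  shows "(\<Phi> * ln (m0\<^sup>2 / (2 * \<delta>\<^sup>2)))\<^sup>2 \<le> (2 * \<Phi> * ln (4 / r) + 68 * pi) * (K * (pi * ln ((M0\<^sup>2 + \<delta>\<^sup>2) / \<delta>\<^sup>2)))"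
proof -
  define c where "c = f p"
  define R1 where "R1 = cos \<Phi>"
  have R1: "0 < R1" "R1 \<le> 1" using \<Phi> r by (auto simp: R1_def cos_gt_zero)
  have pi4: "\<Phi> < pi" using \<Phi> pi_gt_zero by linarith
  \<comment> \<open>The direction from p to the origin; for p = 0 every direction serves and 1 is
    taken.\<close>
  define b where "b = (if p = 0 then 1 else - (p / of_real (cmod p)))"
  define q' where "q' = cmod p"
  have b: "cmod b = 1" by (simp add: b_def norm_divide)
  have pb: "p = - (of_real q' * b)" by (simp add: b_def q'_def)
  have p1: "cmod p \<le> 1" using pq E by auto
  then have q': "0 \<le> q'" "q' \<le> 1" by (auto simp: q'_def)
  have b0: "b \<noteq> 0" using b by auto
  have pos: "0 < t + \<delta>\<^sup>2" if "0 \<le> t" for t using \<delta> that by (simp add: add_nonneg_pos)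
  \<comment> \<open>A logarithmic potential smoothed at scale \<delta>: it is almost constant where
    the image lies within \<delta> of \<open>f p\<close>, and its gradient spreads the energy evenly
    over all scales.\<close>
  define S where "S y = ln ((cmod (y - c))\<^sup>2 + \<delta>\<^sup>2) / 2" for y
  define \<sigma> where "\<sigma> y = (1 / ((cmod (y - c))\<^sup>2 + \<delta>\<^sup>2)) *\<^sub>R (y - c)" for y
  have c\<sigma>: "continuous_on UNIV \<sigma>"
    unfolding \<sigma>_def by (intro continuous_intros ballI) (metis pos less_irrefl zero_le_power2)
  have [measurable]: "\<sigma> \<in> borel_measurable borel" by (rule borel_measurable_continuous_onI[OF c\<sigma>])
  have S: "(S has_derivative (\<lambda>v. \<sigma> y \<bullet> v)) (at y)" for y
  proof -
    have 1: "((\<lambda>y. (cmod (y - c))\<^sup>2 + \<delta>\<^sup>2) has_derivative (\<lambda>v. 2 * ((y - c) \<bullet> v))) (at y)"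
      unfolding power2_norm_eq_inner by (auto intro!: derivative_eq_intros simp: inner_commute)
    have 2: "((\<lambda>t. ln t / 2) has_real_derivative 1 / (2 * ((cmod (y - c))\<^sup>2 + \<delta>\<^sup>2))) (at ((cmod (y - c))\<^sup>2 + \<delta>\<^sup>2))"
    proof -
      have "inverse t / 2 = 1 / (2 * t)" for t :: real by (simp add: inverse_eq_divide)
      then show ?thesis
        using DERIV_cdivide[OF DERIV_ln[OF pos[of "(cmod (y - c))\<^sup>2"]], of 2] by (simp only: zero_le_power2)
    qed
    from has_derivative_compose[OF 1 2[unfolded has_field_derivative_def]]
    show ?thesis unfolding S_def \<sigma>_def
      by (rule has_derivative_eq_rhs) (auto simp: fun_eq_iff simp del: distrib_left_numeral distrib_right_numeral)
  qed
  have \<sigma>_norm: "cmod (\<sigma> y) = cmod (y - c) / ((cmod (y - c))\<^sup>2 + \<delta>\<^sup>2)" for y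
    using pos[of "(cmod (y - c))\<^sup>2"] by (simp add: \<sigma>_def)
  \<comment> \<open>\<open>Ann\<close> carries the circular parts of the test curves and
    \<open>Sec\<close> the radial parts. Both lie in the closed disk, where the distortion is at
    most K.\<close>
  define Ann where "Ann = {x. r/4 < cmod (x - p) \<and> cmod (x - p) < r/2} \<inter> cball 0 1"
  define Sec where "Sec = {x. r/4 \<le> cmod (x - p) \<and> cmod (x - p) \<le> R1 \<and> cmod (x - p) * R1 < Re ((x - p) / b)}"
  have [measurable]: "Ann \<in> sets borel"
    unfolding Ann_def
    by (intro sets.Int borel_open borel_closed open_Collect_conj open_Collect_less continuous_intros closed_cball)
  have [measurable]: "Sec \<in> sets borel"
  proof -
    have "Sec = {x. r/4 \<le> cmod (x - p)} \<inter> {x. cmod (x - p) \<le> R1} \<inter> {x. cmod (x - p) * R1 < Re ((x - p) / b)}"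
      by (auto simp: Sec_def)
    moreover have "open {x. cmod (x - p) * R1 < Re ((x - p) / b)}"
      using b0 by (intro open_Collect_less continuous_intros) auto
    moreover have "closed {x. r/4 \<le> cmod (x - p)}" "closed {x. cmod (x - p) \<le> R1}"
      by (intro closed_Collect_le continuous_intros)+
    ultimately show ?thesis by auto
  qed
  have Sec_sub: "Sec \<subseteq> cball 0 1"
  proof
    fix x assume x: "x \<in> Sec"
    have "p + b * ((x - p) / b) \<in> cball 0 1"
      by (rule sector_in_cball[OF b pb q', of R1]) (use R1 x b in \<open>auto simp: Sec_def norm_divide\<close>)
    then show "x \<in> cball 0 1" using b0 by simp
  qed
  have pol_Sec: "pol p b s \<phi> \<in> Sec \<longleftrightarrow> r/4 \<le> s \<and> s \<le> R1 \<and> \<bar>\<phi>\<bar> < \<Phi>" if s: "0 < s" and \<phi>: "\<bar>\<phi>\<bar> \<le> pi" for s \<phi>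
  proof -
    have "(pol p b s \<phi> - p) / b = of_real s * cis \<phi>" using b0 by (simp add: pol_def)
    then have "Re ((pol p b s \<phi> - p) / b) = s * cos \<phi>" by simp
    moreover have "s * R1 < s * cos \<phi> \<longleftrightarrow> \<bar>\<phi>\<bar> < \<Phi>"
    proof -
      have "s * R1 < s * cos \<phi> \<longleftrightarrow> cos \<Phi> < cos \<bar>\<phi>\<bar>" using s by (simp add: R1_def)
      also have "\<dots> \<longleftrightarrow> \<bar>\<phi>\<bar> < \<Phi>" using \<phi> \<Phi> pi4 by (intro cos_mono_less_eq) auto
      finally show ?thesis .
    qed
    ultimately show ?thesis using s b by (simp add: Sec_def norm_pol_diff)
  qed
  \<comment> \<open>The density of the test curves, indexed by t and \<phi>. Each arc is counted for
    all angles, of total length 2 \<Phi>; each radius is counted for all t, of total length r/4, and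
    1/|x - p| compensates the polar area element.\<close>
  define H where "H x = 2 * \<Phi> * indicator Ann x + r / 4 / cmod (x - p) * indicator Sec x" for x
  have H [measurable]: "H \<in> borel_measurable borel" unfolding H_def by measurable
  have H0: "0 \<le> H x" for x using \<Phi> r by (simp add: H_def)
  have sec1: "r / 4 / cmod (x - p) * indicator Sec x \<le> 1" for x
  proof (cases "x \<in> Sec")
    case True
    then have "0 < cmod (x - p)" "r / 4 \<le> cmod (x - p)" using r by (auto simp: Sec_def)
    then show ?thesis by (simp add: indicator_def divide_le_eq)
  qed simp
  \<comment> \<open>The rise of S from E, where it is at most ln (2 \<delta>^2)/2, to the circle of
    radius cos \<Phi>, where it is at least ln (m0^2)/2.\<close>
  define \<Lambda> where "\<Lambda> = ln (m0\<^sup>2 / (2 * \<delta>\<^sup>2)) / 2"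
  have \<Lambda>0: "0 \<le> \<Lambda>" using \<delta> m0 by (simp add: \<Lambda>_def)
  have energy: "ennreal (r / 4 * (2 * \<Phi>) * \<Lambda>) \<le> (\<integral>\<^sup>+x. ennreal (H x * cmod (\<sigma> (f x)) * dnorm x) \<partial>lborel)"
  proof (rule capacity_bound[OF S c\<sigma> H H0, of "2 * \<Phi> + 1" 1 "r * \<Phi>"])
    show "H x \<le> 2 * \<Phi> + 1" for x
      using sec1[of x] \<Phi> by (simp add: H_def indicator_def split: if_splits)
    show "H x = 0" if "1 < cmod x" for x
      using that Sec_sub by (auto simp: H_def Ann_def indicator_def)
    fix u :: "complex \<Rightarrow> real" and \<tau> :: "complex \<Rightarrow> complex" and e :: real
    assume e: "0 < e" and \<tau>: "continuous_on UNIV \<tau>" and u: "\<And>x. (u has_derivative (\<lambda>v. \<tau> x \<bullet> v)) (at x)"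
      and close: "\<And>x. cmod x \<le> 1 \<Longrightarrow> \<bar>u x - S (f x)\<bar> \<le> e"
    have [measurable]: "\<tau> \<in> borel_measurable borel" by (rule borel_measurable_continuous_onI[OF \<tau>])
    define F1 where "F1 x = ennreal (indicator Ann x * cmod (\<tau> x))" for x
    define F2 where "F2 x = ennreal (1 / cmod (x - p) * indicator Sec x * cmod (\<tau> x))" for x
    have [measurable]: "F1 \<in> borel_measurable borel" "F2 \<in> borel_measurable borel"
      unfolding F1_def F2_def by measurable
    define X where "X t = (\<integral>\<^sup>+\<phi>. F1 (pol p b t \<phi>) * (ennreal t * indicator {0<..} t * indicator {-pi<..<pi} \<phi>) \<partial>lborel)" for t
    define Y where "Y \<phi> = (\<integral>\<^sup>+s. F2 (pol p b s \<phi>) * (ennreal s * indicator {0<..} s * indicator {-pi<..<pi} \<phi>) \<partial>lborel)" for \<phi>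
    have [measurable]: "X \<in> borel_measurable borel" "Y \<in> borel_measurable borel"
      unfolding X_def Y_def by measurable
    \<comment> \<open>Connectedness gives a point of E on every circle of radius t < r about p. From
      it one follows the circle to the angle \<phi> and then the radius outwards; \<open>X t\<close>
      and \<open>Y \<phi>\<close> bound the variation on the two parts.\<close>
    have pt: "ennreal (\<Lambda> - 2 * e) \<le> X t + Y \<phi>" if t: "r / 4 < t" "t < r / 2" and \<phi>: "- \<Phi> < \<phi>" "\<phi> < \<Phi>" for t \<phi>
    proof -
      have tR: "0 < t" "t \<le> R1" using t r by (auto simp: R1_def)
      obtain x where x: "x \<in> E" "cmod (x - p) = t"
      proof -
        have "connected ((\<lambda>x. cmod (x - p)) ` E)"
          by (intro connected_continuous_image E continuous_intros)
        moreover have "0 \<in> (\<lambda>x. cmod (x - p)) ` E" "r \<in> (\<lambda>x. cmod (x - p)) ` E"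
          using pq by (auto simp: image_iff norm_minus_commute intro!: bexI[of _ p] bexI[of _ q])
        ultimately have "t \<in> (\<lambda>x. cmod (x - p)) ` E"
          using t tR r by (auto dest!: connectedD_interval[of _ 0 r t])
        then show ?thesis using that by auto
      qed
      obtain \<phi>1 where \<phi>1: "-pi < \<phi>1" "\<phi>1 \<le> pi" "x = pol p b t \<phi>1"
        using pol_surj[OF b, of x p] x by metis
      have xb: "x \<in> cball 0 1" using x E by auto
      have \<phi>pi: "\<bar>\<phi>\<bar> < \<Phi>" "\<bar>\<phi>\<bar> \<le> pi" using \<phi> pi4 by auto
      have sec: "pol p b s \<phi> \<in> Sec" if "r / 4 \<le> s" "s \<le> R1" for s
        using pol_Sec[of s \<phi>] that r \<phi>pi by auto
      have out: "pol p b R1 \<phi> \<in> cball 0 1" and mid: "pol p b t \<phi> \<in> cball 0 1"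
        using sec[of R1] sec[of t] t tR Sec_sub r by auto
      have A: "ennreal \<bar>u (pol p b t \<phi>) - u x\<bar> \<le> X t"
      proof -
        have "ennreal \<bar>u (pol p b t \<phi>) - u x\<bar> \<le>
          (\<integral>\<^sup>+\<psi>. ennreal (cmod (\<tau> (pol p b t \<psi>)) * t) * indicator {min \<phi>1 \<phi>..max \<phi>1 \<phi>} \<psi> \<partial>lborel)"
          unfolding \<phi>1(3) by (rule arc_estimate[OF \<tau> u b]) (use tR in auto)
        also have "\<dots> \<le> X t"
          unfolding X_def
        proof (rule nn_integral_mono_AE)
          have "AE \<psi> in lborel. \<psi> \<noteq> pi" by (rule AE_lborel_singleton)
          then show "AE \<psi> in lborel. ennreal (cmod (\<tau> (pol p b t \<psi>)) * t) * indicator {min \<phi>1 \<phi>..max \<phi>1 \<phi>} \<psi>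
            \<le> F1 (pol p b t \<psi>) * (ennreal t * indicator {0<..} t * indicator {-pi<..<pi} \<psi>)"
          proof eventually_elim
            case (elim \<psi>)
            show ?case
            proof (cases "\<psi> \<in> {min \<phi>1 \<phi>..max \<phi>1 \<phi>}")
              case True
              have "pol p b t \<psi> \<in> cball 0 1"
                by (rule pol_in_cball_arc[OF b pb q'(1) _ _ _ mid \<phi>pi(2)])
                   (use True xb \<phi>1 tR in auto)
              then have "pol p b t \<psi> \<in> Ann" using t tR b by (simp add: Ann_def norm_pol_diff)
              moreover have "\<psi> \<in> {-pi<..<pi}"
                using True \<phi>1 \<phi> pi4 elim by (auto simp: min_def max_def split: if_splits)
              ultimately show ?thesis using tR True by (simp add: F1_def ennreal_mult)
            qed simp
          qed
        qed
        finally show ?thesis .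
      qed
      have B: "ennreal \<bar>u (pol p b R1 \<phi>) - u (pol p b t \<phi>)\<bar> \<le> Y \<phi>"
      proof -
        have "ennreal \<bar>u (pol p b R1 \<phi>) - u (pol p b t \<phi>)\<bar> \<le> (\<integral>\<^sup>+s. ennreal (cmod (\<tau> (pol p b s \<phi>))) * indicator {t..R1} s \<partial>lborel)"
          by (rule radius_estimate[OF \<tau> u b tR(2)])
        also have "\<dots> \<le> Y \<phi>"
          unfolding Y_def
        proof (rule nn_integral_mono)
          fix s
          show "ennreal (cmod (\<tau> (pol p b s \<phi>))) * indicator {t..R1} s
            \<le> F2 (pol p b s \<phi>) * (ennreal s * indicator {0<..} s * indicator {-pi<..<pi} \<phi>)"
          proof (cases "s \<in> {t..R1}")
            case True
            then have s: "0 < s" "pol p b s \<phi> \<in> Sec" using tR t sec[of s] by auto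
            have "\<phi> \<in> {-pi<..<pi}" using \<phi> pi4 by auto
            then show ?thesis
              using True s b by (simp add: F2_def norm_pol_diff ennreal_mult[symmetric])
          qed simp
        qed
        finally show ?thesis .
      qed
      have "\<Lambda> - 2 * e \<le> \<bar>u (pol p b t \<phi>) - u x\<bar> + \<bar>u (pol p b R1 \<phi>) - u (pol p b t \<phi>)\<bar>"
      proof -
        have "S (f x) \<le> ln (2 * \<delta>\<^sup>2) / 2"
        proof -
          have "(cmod (f x - c))\<^sup>2 \<le> \<delta>\<^sup>2" unfolding c_def using \<delta> x by (intro power_mono) auto
          then show ?thesis using pos[of "(cmod (f x - c))\<^sup>2"] by (simp add: S_def ln_mono)
        qed
        moreover have "ln (m0\<^sup>2) / 2 \<le> S (f (pol p b R1 \<phi>))"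
        proof -
          have "m0 \<le> cmod (f (pol p b R1 \<phi>) - c)"
            unfolding c_def using out R1 b by (intro m0) (auto simp: norm_pol_diff R1_def)
          then have "m0\<^sup>2 \<le> (cmod (f (pol p b R1 \<phi>) - c))\<^sup>2" using m0 by (intro power_mono) auto
          then show ?thesis using m0 \<delta> by (simp add: S_def ln_mono add_increasing2)
        qed
        moreover have "\<Lambda> = ln (m0\<^sup>2) / 2 - ln (2 * \<delta>\<^sup>2) / 2"
          using m0 \<delta> by (simp add: \<Lambda>_def ln_div diff_divide_distrib)
        moreover have "\<bar>u x - S (f x)\<bar> \<le> e" "\<bar>u (pol p b R1 \<phi>) - S (f (pol p b R1 \<phi>))\<bar> \<le> e"
          using close xb out by auto
        ultimately show ?thesis by linarith
      qed
      then have "ennreal (\<Lambda> - 2 * e) \<le> ennreal \<bar>u (pol p b t \<phi>) - u x\<bar> + ennreal \<bar>u (pol p b R1 \<phi>) - u (pol p b t \<phi>)\<bar>"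
        by (simp add: ennreal_plus[symmetric] ennreal_leI del: ennreal_plus)
      also have "\<dots> \<le> X t + Y \<phi>" by (rule add_mono[OF A B])
      finally show ?thesis .
    qed
    let ?I = "indicator {r/4<..<r/2} :: real \<Rightarrow> ennreal" and ?J = "indicator {-\<Phi><..<\<Phi>} :: real \<Rightarrow> ennreal"
    have "ennreal (r / 4 * (2 * \<Phi>) * \<Lambda> - r * \<Phi> * e) = ennreal ((\<Lambda> - 2 * e) * (2 * \<Phi>) * (r / 4))"
      by (simp add: algebra_simps)
    also have "\<dots> = ennreal (\<Lambda> - 2 * e) * ennreal (2 * \<Phi>) * ennreal (r / 4)"
      using r \<Phi> by (simp only: ennreal_mult'')
    also have "\<dots> = (\<integral>\<^sup>+t. (\<integral>\<^sup>+\<phi>. ennreal (\<Lambda> - 2 * e) * ?J \<phi> \<partial>lborel) * ?I t \<partial>lborel)"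
      using r \<Phi> by (simp add: nn_integral_cmult_indicator)
    also have "\<dots> \<le> (\<integral>\<^sup>+t. (\<integral>\<^sup>+\<phi>. (X t + Y \<phi>) * ?J \<phi> \<partial>lborel) * ?I t \<partial>lborel)"
    proof (rule nn_integral_mono)
      fix t :: real
      show "(\<integral>\<^sup>+\<phi>. ennreal (\<Lambda> - 2 * e) * ?J \<phi> \<partial>lborel) * ?I t \<le> (\<integral>\<^sup>+\<phi>. (X t + Y \<phi>) * ?J \<phi> \<partial>lborel) * ?I t"
      proof (cases "t \<in> {r/4<..<r/2}")
        case True
        have "(\<integral>\<^sup>+\<phi>. ennreal (\<Lambda> - 2 * e) * ?J \<phi> \<partial>lborel) \<le> (\<integral>\<^sup>+\<phi>. (X t + Y \<phi>) * ?J \<phi> \<partial>lborel)"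
          using pt True by (intro nn_integral_mono) (auto simp: indicator_def)
        then show ?thesis by (rule mult_right_mono) simp
      qed simp
    qed
    also have "\<dots> = (\<integral>\<^sup>+t. (X t * ennreal (2 * \<Phi>) + (\<integral>\<^sup>+\<phi>. Y \<phi> * ?J \<phi> \<partial>lborel)) * ?I t \<partial>lborel)"
    proof (intro nn_integral_cong arg_cong2[where f=times] refl)
      fix t
      have "(\<integral>\<^sup>+\<phi>. (X t + Y \<phi>) * ?J \<phi> \<partial>lborel) = (\<integral>\<^sup>+\<phi>. X t * ?J \<phi> + Y \<phi> * ?J \<phi> \<partial>lborel)"
        by (simp add: distrib_right)
      also have "\<dots> = (\<integral>\<^sup>+\<phi>. X t * ?J \<phi> \<partial>lborel) + (\<integral>\<^sup>+\<phi>. Y \<phi> * ?J \<phi> \<partial>lborel)"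
        by (rule nn_integral_add) measurable
      finally show "(\<integral>\<^sup>+\<phi>. (X t + Y \<phi>) * ?J \<phi> \<partial>lborel) = X t * ennreal (2 * \<Phi>) + (\<integral>\<^sup>+\<phi>. Y \<phi> * ?J \<phi> \<partial>lborel)"
        using \<Phi> by (simp add: nn_integral_cmult_indicator)
    qed
    also have "\<dots> = (\<integral>\<^sup>+t. X t * ?I t \<partial>lborel) * ennreal (2 * \<Phi>) + (\<integral>\<^sup>+\<phi>. Y \<phi> * ?J \<phi> \<partial>lborel) * ennreal (r / 4)"
    proof -
      have "(\<integral>\<^sup>+t. (X t * ennreal (2 * \<Phi>) + (\<integral>\<^sup>+\<phi>. Y \<phi> * ?J \<phi> \<partial>lborel)) * ?I t \<partial>lborel)
        = (\<integral>\<^sup>+t. X t * ?I t * ennreal (2 * \<Phi>) + (\<integral>\<^sup>+\<phi>. Y \<phi> * ?J \<phi> \<partial>lborel) * ?I t \<partial>lborel)"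
        by (intro nn_integral_cong) (simp add: distrib_left distrib_right mult_ac)
      also have "\<dots> = (\<integral>\<^sup>+t. X t * ?I t * ennreal (2 * \<Phi>) \<partial>lborel) + (\<integral>\<^sup>+t. (\<integral>\<^sup>+\<phi>. Y \<phi> * ?J \<phi> \<partial>lborel) * ?I t \<partial>lborel)"
        by (rule nn_integral_add) measurable
      finally show ?thesis
        using r by (simp add: nn_integral_multc nn_integral_cmult_indicator)
    qed
    also have "\<dots> \<le> (\<integral>\<^sup>+x. F1 x \<partial>lborel) * ennreal (2 * \<Phi>) + (\<integral>\<^sup>+x. F2 x \<partial>lborel) * ennreal (r / 4)"
    proof (intro add_mono mult_right_mono)
      have "(\<integral>\<^sup>+t. X t * ?I t \<partial>lborel) \<le> (\<integral>\<^sup>+t. X t \<partial>lborel)"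
        by (intro nn_integral_mono) (auto simp: indicator_def)
      also have "\<dots> = (\<integral>\<^sup>+x. F1 x \<partial>lborel)"
        unfolding X_def by (rule nn_integral_pol[symmetric]) (use b in auto)
      finally show "(\<integral>\<^sup>+t. X t * ?I t \<partial>lborel) \<le> (\<integral>\<^sup>+x. F1 x \<partial>lborel)" .
      have "(\<integral>\<^sup>+\<phi>. Y \<phi> * ?J \<phi> \<partial>lborel) \<le> (\<integral>\<^sup>+\<phi>. Y \<phi> \<partial>lborel)"
        by (intro nn_integral_mono) (auto simp: indicator_def)
      also have "\<dots> = (\<integral>\<^sup>+s. \<integral>\<^sup>+\<phi>. F2 (pol p b s \<phi>) * (ennreal s * indicator {0<..} s * indicator {-pi<..<pi} \<phi>) \<partial>lborel \<partial>lborel)"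
        unfolding Y_def by (rule lborel_pair.Fubini') measurable
      also have "\<dots> = (\<integral>\<^sup>+x. F2 x \<partial>lborel)"
        by (rule nn_integral_pol[symmetric]) (use b in auto)
      finally show "(\<integral>\<^sup>+\<phi>. Y \<phi> * ?J \<phi> \<partial>lborel) \<le> (\<integral>\<^sup>+x. F2 x \<partial>lborel)" .
    qed auto
    also have "\<dots> = (\<integral>\<^sup>+x. F1 x * ennreal (2 * \<Phi>) + F2 x * ennreal (r / 4) \<partial>lborel)"
      by (simp add: nn_integral_add nn_integral_multc)
    also have "\<dots> = (\<integral>\<^sup>+x. ennreal (H x * cmod (\<tau> x)) \<partial>lborel)"
    proof (rule nn_integral_cong)
      fix x
      show "F1 x * ennreal (2 * \<Phi>) + F2 x * ennreal (r / 4) = ennreal (H x * cmod (\<tau> x))"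
        using r \<Phi> by (simp add: F1_def F2_def H_def ennreal_mult[symmetric] ennreal_plus[symmetric] algebra_simps del: ennreal_plus)
    qed
    finally show "ennreal (r / 4 * (2 * \<Phi>) * \<Lambda> - r * \<Phi> * e) \<le> (\<integral>\<^sup>+x. ennreal (H x * cmod (\<tau> x)) \<partial>lborel)" .
  qed (use r \<Phi> in auto)
  \<comment> \<open>A bounds the squared L2 norm of H. The radial part gives r^2/16 * 2 \<Phi> ln
    (4/r); the part involving \<open>Ann\<close> is at most 17 on a disk of radius r/2, that is 68
    pi r^2/16. The 17 comes from pi (pi + 2) <= 3.2 * 5.2.\<close>
  define A where "A = r\<^sup>2 / 16 * (2 * \<Phi> * ln (4 / r) + 68 * pi)"
  define B where "B = K * (pi * ln ((M0\<^sup>2 + \<delta>\<^sup>2) / \<delta>\<^sup>2))"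
  have r1: "r \<le> 1" using r R1 unfolding R1_def by linarith
  have ln4: "0 \<le> ln (4 / r)" using r r1 by (intro ln_ge_zero) auto
  have A0: "0 < A" unfolding A_def using r \<Phi> ln4 by (intro mult_pos_pos add_nonneg_pos mult_nonneg_nonneg) auto
  have M0': "0 < M0"
  proof -
    have "pol p b R1 0 \<in> cball 0 1"
      using pol_Sec[of R1 0] R1 r \<Phi> Sec_sub by (auto simp: R1_def)
    then show ?thesis using m0(2)[of "pol p b R1 0"] M0(2)[of "pol p b R1 0"] m0(1) R1 b
      by (simp add: norm_pol_diff R1_def)
  qed
  have B0: "0 < B"
    unfolding B_def using K M0' \<delta> by (intro mult_pos_pos ln_gt_zero) (auto simp: divide_simps)
  have H2: "(\<integral>\<^sup>+x. ennreal ((H x)\<^sup>2) \<partial>lborel) \<le> ennreal A"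
  proof -
    define F where "F x = ennreal ((r / 4 / cmod (x - p))\<^sup>2 * indicator Sec x)" for x
    have [measurable]: "F \<in> borel_measurable borel" unfolding F_def by measurable
    have "(H x)\<^sup>2 \<le> (r / 4 / cmod (x - p))\<^sup>2 * indicator Sec x + 17 * indicator (ball p (r / 2)) x" for x
    proof -
      define a' b' where "a' = 2 * \<Phi> * indicat_real Ann x" and "b' = r / 4 / cmod (x - p) * indicator Sec x"
      have b'1: "0 \<le> b'" "b' \<le> 1" using sec1[of x] r by (auto simp: b'_def)
      have "a' * (a' + 2 * b') \<le> 17 * indicator (ball p (r / 2)) x"
      proof (cases "x \<in> Ann")
        case True
        have "2 * \<Phi> * (2 * \<Phi> + 2 * b') \<le> pi * (pi + 2)"
          using \<Phi> b'1 by (intro mult_mono add_mono) auto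
        also have "\<dots> \<le> 3.2 * (3.2 + 2)"
          using pi_approx(2) by (intro mult_mono) auto
        finally show ?thesis using True by (simp add: a'_def Ann_def dist_norm norm_minus_commute)
      qed (simp add: a'_def)
      moreover have "(H x)\<^sup>2 = b'\<^sup>2 + a' * (a' + 2 * b')"
        unfolding H_def a'_def[symmetric] b'_def[symmetric] by (simp add: power2_eq_square algebra_simps)
      moreover have "b'\<^sup>2 = (r / 4 / cmod (x - p))\<^sup>2 * indicator Sec x"
        by (simp add: b'_def indicator_def)
      ultimately show ?thesis by simp
    qed
    then have "(\<integral>\<^sup>+x. ennreal ((H x)\<^sup>2) \<partial>lborel) \<le> (\<integral>\<^sup>+x. F x + ennreal 17 * indicator (ball p (r / 2)) x \<partial>lborel)"
    proof (intro nn_integral_mono)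
      fix x
      assume *: "\<And>x. (H x)\<^sup>2 \<le> (r / 4 / cmod (x - p))\<^sup>2 * indicator Sec x + 17 * indicator (ball p (r / 2)) x"
      have "ennreal ((H x)\<^sup>2) \<le> ennreal ((r / 4 / cmod (x - p))\<^sup>2 * indicator Sec x + 17 * indicator (ball p (r / 2)) x)"
        by (rule ennreal_leI[OF *])
      also have "\<dots> = F x + ennreal 17 * indicator (ball p (r / 2)) x"
        by (subst ennreal_plus) (auto simp: F_def indicator_def)
      finally show "ennreal ((H x)\<^sup>2) \<le> F x + ennreal 17 * indicator (ball p (r / 2)) x" .
    qed
    also have "\<dots> = (\<integral>\<^sup>+x. F x \<partial>lborel) + ennreal (17 * (pi * (r / 2)\<^sup>2))"
      using r by (subst nn_integral_add) (auto simp: nn_integral_cmult_indicator measure_lborel_ball_complex ennreal_mult)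
    also have "(\<integral>\<^sup>+x. F x \<partial>lborel) = (\<integral>\<^sup>+s. \<integral>\<^sup>+\<phi>. F (pol p b s \<phi>) * (ennreal s * indicator {0<..} s * indicator {-pi<..<pi} \<phi>) \<partial>lborel \<partial>lborel)"
      by (rule nn_integral_pol) (use b in auto)
    also have "\<dots> \<le> (\<integral>\<^sup>+s. \<integral>\<^sup>+\<phi>. ennreal (r\<^sup>2 / 16 * (1 / s)) * indicator {r/4..R1} s * indicator {-\<Phi><..<\<Phi>} (\<phi>::real) \<partial>lborel \<partial>lborel)"
    proof (intro nn_integral_mono)
      fix s \<phi> :: real
      show "F (pol p b s \<phi>) * (ennreal s * indicator {0<..} s * indicator {-pi<..<pi} \<phi>)
        \<le> ennreal (r\<^sup>2 / 16 * (1 / s)) * indicator {r/4..R1} s * indicator {-\<Phi><..<\<Phi>} \<phi>"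
      proof (cases "0 < s \<and> \<bar>\<phi>\<bar> < pi \<and> pol p b s \<phi> \<in> Sec")
        case True
        then have *: "r/4 \<le> s" "s \<le> R1" "\<bar>\<phi>\<bar> < \<Phi>" using pol_Sec[of s \<phi>] by auto
        have "(r / 4 / s)\<^sup>2 * s = r\<^sup>2 / 16 * (1 / s)" using True by (simp add: power2_eq_square field_simps)
        then have "ennreal ((r / 4 / s)\<^sup>2) * ennreal s = ennreal (r\<^sup>2 / 16 * (1 / s))"
          using True by (simp add: ennreal_mult[symmetric])
        moreover have "\<phi> \<in> {-pi<..<pi}" "\<phi> \<in> {-\<Phi><..<\<Phi>}" using True * by auto
        ultimately show ?thesis using True * b by (simp add: F_def norm_pol_diff)
      next
        case False
        then show ?thesis by (auto simp: F_def indicator_def)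
      qed
    qed
    also have "\<dots> = (\<integral>\<^sup>+s. ennreal (r\<^sup>2 / 16 * (1 / s)) * indicator {r/4..R1} s * ennreal (2 * \<Phi>) \<partial>lborel)"
      using \<Phi> by (intro nn_integral_cong) (simp add: nn_integral_cmult_indicator)
    also have "\<dots> = (\<integral>\<^sup>+s. ennreal (r\<^sup>2 / 16 * (1 / s)) * indicator {r/4..R1} s \<partial>lborel) * ennreal (2 * \<Phi>)"
      by (rule nn_integral_multc) measurable
    also have "(\<integral>\<^sup>+s. ennreal (r\<^sup>2 / 16 * (1 / s)) * indicator {r/4..R1} s \<partial>lborel)
       = ennreal (r\<^sup>2 / 16 * ln R1 - r\<^sup>2 / 16 * ln (r / 4))"
    proof (rule nn_integral_FTC_Icc[where F="\<lambda>s. r\<^sup>2 / 16 * ln s"])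
      show "DERIV (\<lambda>s. r\<^sup>2 / 16 * ln s) s :> r\<^sup>2 / 16 * (1 / s)" if "s \<in> {r / 4..R1}" for s
        using that r by (auto intro!: derivative_eq_intros)
    qed (use r R1 in \<open>auto simp: R1_def\<close>)
    also have "\<dots> \<le> ennreal (r\<^sup>2 / 16 * ln (4 / r))"
    proof (rule ennreal_leI)
      have "ln R1 \<le> 0" using R1 by simp
      then have "r\<^sup>2 / 16 * ln R1 \<le> 0" by (intro mult_nonneg_nonpos) auto
      moreover have "ln (4 / r) = - ln (r / 4)" using r by (simp add: ln_div)
      ultimately show "r\<^sup>2 / 16 * ln R1 - r\<^sup>2 / 16 * ln (r / 4) \<le> r\<^sup>2 / 16 * ln (4 / r)" by simp
    qed
    finally have "(\<integral>\<^sup>+x. ennreal ((H x)\<^sup>2) \<partial>lborel) \<le> ennreal (r\<^sup>2 / 16 * ln (4 / r)) * ennreal (2 * \<Phi>) + ennreal (17 * (pi * (r / 2)\<^sup>2))"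
      by (simp add: mult_right_mono add_right_mono)
    also have "\<dots> = ennreal (r\<^sup>2 / 16 * ln (4 / r) * (2 * \<Phi>) + 17 * (pi * (r / 2)\<^sup>2))"
      using r \<Phi> ln4 by (simp add: ennreal_mult[symmetric] ennreal_plus[symmetric] del: ennreal_plus)
    also have "r\<^sup>2 / 16 * ln (4 / r) * (2 * \<Phi>) + 17 * (pi * (r / 2)\<^sup>2) = A"
      by (simp add: A_def power_divide algebra_simps)
    finally show ?thesis .
  qed
  have "(r / 4 * (2 * \<Phi>) * \<Lambda>)\<^sup>2 \<le> A * B"
  proof (rule nn_integral_Cauchy_Schwarz[where M=lborel and w="\<lambda>x. H x * cmod (\<sigma> (f x)) * dnorm x"
      and \<alpha>="\<lambda>x. (H x)\<^sup>2" and \<beta>="\<lambda>x. K * ((cmod (\<sigma> (f x)))\<^sup>2 * indicator (cball c M0) (f x) * \<bar>jac x\<bar>)"])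
    \<comment> \<open>The weight lives on the closed disk while the distortion bound holds on the
      open one; the circle between them is null.\<close>
    have "AE x in lborel. x \<notin> sphere (0::complex) 1"
      using negligible_sphere[of "0::complex" 1]
      by (intro AE_not_in) (auto simp: negligible_iff_null_sets null_sets_completion_iff)
    then show "AE x in lborel. 0 \<le> (H x)\<^sup>2 \<and> 0 \<le> K * ((cmod (\<sigma> (f x)))\<^sup>2 * indicator (cball c M0) (f x) * \<bar>jac x\<bar>) \<and>
        (H x * cmod (\<sigma> (f x)) * dnorm x)\<^sup>2 \<le> (H x)\<^sup>2 * (K * ((cmod (\<sigma> (f x)))\<^sup>2 * indicator (cball c M0) (f x) * \<bar>jac x\<bar>))"
      using dist
    proof eventually_elim
      case (elim x)
      have "(H x * cmod (\<sigma> (f x)) * dnorm x)\<^sup>2 \<le> (H x)\<^sup>2 * (K * ((cmod (\<sigma> (f x)))\<^sup>2 * indicator (cball c M0) (f x) * \<bar>jac x\<bar>))"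
      proof (cases "x \<in> cball 0 1")
        case True
        then have "x \<in> ball 0 1" using elim by auto
        then have "(dnorm x)\<^sup>2 \<le> K * \<bar>jac x\<bar>"
          using elim K by (smt (verit) mult_le_cancel_left_pos)
        then have "((H x)\<^sup>2 * (cmod (\<sigma> (f x)))\<^sup>2) * (dnorm x)\<^sup>2 \<le> ((H x)\<^sup>2 * (cmod (\<sigma> (f x)))\<^sup>2) * (K * \<bar>jac x\<bar>)"
          by (rule mult_left_mono) simp
        moreover have "f x \<in> cball c M0" using M0(2)[OF True] by (simp add: c_def dist_norm norm_minus_commute)
        ultimately show ?thesis by (simp add: power_mult_distrib mult_ac)
      next
        case False
        then have "H x = 0" using Sec_sub by (auto simp: H_def Ann_def indicator_def)
        then show ?thesis by simp
      qed
      then show ?case using K by simp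
    qed
    have "(\<integral>\<^sup>+x. ennreal (K * ((cmod (\<sigma> (f x)))\<^sup>2 * indicator (cball c M0) (f x) * \<bar>jac x\<bar>)) \<partial>lborel)
      = (\<integral>\<^sup>+x. ennreal K * ((ennreal ((cmod (\<sigma> (f x)))\<^sup>2) * indicator (cball c M0) (f x)) * ennreal \<bar>jac x\<bar>) \<partial>lborel)"
      using K by (intro nn_integral_cong) (auto simp: ennreal_mult indicator_def)
    also have "\<dots> = ennreal K * (\<integral>\<^sup>+x. (ennreal ((cmod (\<sigma> (f x)))\<^sup>2) * indicator (cball c M0) (f x)) * ennreal \<bar>jac x\<bar> \<partial>lborel)"
      by (rule nn_integral_cmult) measurable
    also have "\<dots> \<le> ennreal K * (\<integral>\<^sup>+y. ennreal ((cmod (\<sigma> y))\<^sup>2) * indicator (cball c M0) y \<partial>lborel)"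
      by (intro mult_left_mono area_inequality[OF hom, of "\<lambda>y. ennreal ((cmod (\<sigma> y))\<^sup>2) * indicator (cball c M0) y"]) measurable
    also have "\<dots> \<le> ennreal K * ennreal (pi * ln ((M0\<^sup>2 + \<delta>\<^sup>2) / \<delta>\<^sup>2))"
      unfolding \<sigma>_norm by (intro mult_left_mono log_gradient_energy \<delta> M0) simp
    also have "\<dots> = ennreal B"
      using K by (simp add: B_def ennreal_mult')
    finally show "(\<integral>\<^sup>+x. ennreal (K * ((cmod (\<sigma> (f x)))\<^sup>2 * indicator (cball c M0) (f x) * \<bar>jac x\<bar>)) \<partial>lborel) \<le> ennreal B" .
  qed (use energy A0 B0 r \<Phi> \<Lambda>0 H2 in auto)
  then have "r\<^sup>2 / 16 * (2 * \<Phi> * \<Lambda>)\<^sup>2 \<le> r\<^sup>2 / 16 * ((2 * \<Phi> * ln (4 / r) + 68 * pi) * B)"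
    by (simp add: A_def power_mult_distrib power_divide mult_ac)
  then have "(2 * \<Phi> * \<Lambda>)\<^sup>2 \<le> (2 * \<Phi> * ln (4 / r) + 68 * pi) * B"
    by (rule mult_left_le_imp_le) (use r in simp)
  then show ?thesis by (simp add: \<Lambda>_def B_def)
qed

end

lemma quadratic_eventually_pos:
  fixes \<alpha> \<beta> \<gamma> :: real
  assumes "0 < \<alpha>"
  obtains X0 where "\<And>X. X0 \<le> X \<Longrightarrow> 0 < \<alpha> * X\<^sup>2 + \<beta> * X + \<gamma>"
proof
  fix X assume X: "(\<bar>\<beta>\<bar> + \<bar>\<gamma>\<bar>) / \<alpha> + 1 \<le> X"
  have "0 \<le> (\<bar>\<beta>\<bar> + \<bar>\<gamma>\<bar>) / \<alpha>" using assms by (intro divide_nonneg_pos) auto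
  then have X1: "1 \<le> X" using X by linarith
  have "\<alpha> * ((\<bar>\<beta>\<bar> + \<bar>\<gamma>\<bar>) / \<alpha> + 1) \<le> \<alpha> * X" using X assms by (intro mult_left_mono) auto
  then have "\<bar>\<beta>\<bar> + \<bar>\<gamma>\<bar> + \<alpha> \<le> \<alpha> * X" using assms by (simp add: distrib_left add_divide_distrib)
  then have "(\<bar>\<beta>\<bar> + \<bar>\<gamma>\<bar> + \<alpha>) * X \<le> \<alpha> * X * X" using X1 by (intro mult_right_mono) auto
  moreover have "\<bar>\<gamma>\<bar> * 1 \<le> \<bar>\<gamma>\<bar> * X" using X1 by (intro mult_left_mono) auto
  moreover have "(- \<bar>\<beta>\<bar>) * X \<le> \<beta> * X" using X1 by (intro mult_right_mono) auto
  moreover have "0 < \<alpha> * X" using assms X1 by simp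
  ultimately show "0 < \<alpha> * X\<^sup>2 + \<beta> * X + \<gamma>"
    unfolding power2_eq_square distrib_right mult_minus_left by linarith
qed

lemma power_less_scaled_power_eventually:
  fixes c K' a :: real
  assumes "0 < c" "K' < a"
  obtains \<tau>0 where "0 < \<tau>0" "\<And>\<tau>. 0 < \<tau> \<Longrightarrow> \<tau> < \<tau>0 \<Longrightarrow> \<tau> powr a \<le> c * \<tau> powr K'"
proof
  show "0 < c powr (1 / (a - K'))" using assms by simp
  fix \<tau> :: real assume \<tau>: "0 < \<tau>" "\<tau> < c powr (1 / (a - K'))"
  have "\<tau> powr (a - K') \<le> (c powr (1 / (a - K'))) powr (a - K')"
    using \<tau> assms by (intro powr_mono2) auto
  also have "\<dots> = c" using assms by (simp add: powr_powr)
  finally have "\<tau> powr (a - K') * \<tau> powr K' \<le> c * \<tau> powr K'" by (intro mult_right_mono) auto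
  then show "\<tau> powr a \<le> c * \<tau> powr K'" by (simp flip: powr_add)
qed

section \<open>Compression exponents inside the disk and the boundary estimate\<close>

context sobolev_map
begin

text \<open>If E reached distance \<rho> from p, put X = - K' ln \<rho>, so that \<delta> =
  \<rho>^K' = exp (-X). The core inequality is then quadratic in X, with leading coefficients 4
  \<Phi>^2 on the left and 4 \<Phi> pi K / K' on the right. It fails for large X because \<Phi> > pi
  K / K'.\<close>

lemma compression:
  assumes hom: "homeomorphism UNIV UNIV f g"
    and K: "1 \<le> K" and dist: "AE x in lborel. x \<in> ball 0 1 \<longrightarrow> (dnorm x)\<^sup>2 \<le> K * jac x"
    and K': "2 * K < K'"
  obtains r0 where "0 < r0" "r0 \<le> 1"
    "\<And>E p \<rho>. connected E \<Longrightarrow> E \<subseteq> cball 0 1 \<Longrightarrow> p \<in> E \<Longrightarrow> 0 < \<rho> \<Longrightarrow> \<rho> < r0 \<Longrightarrow>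
       (\<And>x. x \<in> E \<Longrightarrow> cmod (f x - f p) \<le> \<rho> powr K') \<Longrightarrow> E \<subseteq> ball p \<rho>"
proof -
  have inj: "inj f"
    using hom by (auto simp: homeomorphism_def inj_on_def) metis
  \<comment> \<open>The midpoint between the critical angle pi K / K' and pi/2; the interval is
    nonempty because K' > 2K.\<close>
  define \<Phi> where "\<Phi> = (pi * K / K' + pi / 2) / 2"
  have KK: "pi * K / K' < pi / 2" using K K' by (simp add: field_simps)
  have "0 < pi * K / K'" using K K' by simp
  then have \<Phi>: "0 < \<Phi>" "\<Phi> < pi / 2" "pi * K / K' < \<Phi>"
  proof -
    define A where "A = pi * K / K'"
    have "0 < A" "A < pi / 2" using \<open>0 < pi * K / K'\<close> KK by (auto simp: A_def)
    then have "0 < (A + pi / 2) / 2" "(A + pi / 2) / 2 < pi / 2" "A < (A + pi / 2) / 2" by (simp_all add: field_simps)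
    then show "0 < \<Phi>" "\<Phi> < pi / 2" "pi * K / K' < \<Phi>" by (simp_all only: \<Phi>_def A_def)
  qed
  \<comment> \<open>Pairs of points at the fixed distance cos \<Phi>: compactness and injectivity
    give a separation m0 that is uniform in p.\<close>
  define D2 where "D2 = {z \<in> cball 0 1 \<times> cball (0::complex) 1. cmod (fst z - snd z) = cos \<Phi>}"
  have cD: "continuous_on S (\<lambda>z. cmod (f (fst z) - f (snd z)))" for S
    by (intro continuous_intros continuous_on_compose2[OF cont]) auto
  have compD: "compact D2"
  proof -
    have "closed {z::complex \<times> complex. cmod (fst z - snd z) = cos \<Phi>}"
      by (intro closed_Collect_eq continuous_intros)
    then have "compact ((cball 0 1 \<times> cball (0::complex) 1) \<inter> {z. cmod (fst z - snd z) = cos \<Phi>})"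
      by (intro compact_Int_closed compact_Times) auto
    then show ?thesis by (simp add: D2_def Int_def)
  qed
  have cos0: "0 < cos \<Phi>" using \<Phi> by (intro cos_gt_zero) auto
  obtain m0 where m0: "0 < m0" "\<And>x p. x \<in> cball 0 1 \<Longrightarrow> p \<in> cball 0 1 \<Longrightarrow> cmod (x - p) = cos \<Phi> \<Longrightarrow> m0 \<le> cmod (f x - f p)"
  proof (cases "D2 = {}")
    case True
    then show ?thesis by (intro that[of 1]) (auto simp: D2_def)
  next
    case False
    obtain z where z: "z \<in> D2" "\<And>y. y \<in> D2 \<Longrightarrow> cmod (f (fst z) - f (snd z)) \<le> cmod (f (fst y) - f (snd y))"
      using continuous_attains_inf[OF compD False cD] by blast
    have "f (fst z) \<noteq> f (snd z)"
    proof
      assume "f (fst z) = f (snd z)"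
      then have "fst z = snd z" by (rule injD[OF inj])
      then show False using z(1) cos0 by (auto simp: D2_def)
    qed
    then show ?thesis using z(2) by (intro that[of "cmod (f (fst z) - f (snd z))"]) (auto simp: D2_def)
  qed
  obtain M0 where M0: "0 < M0" "\<And>x p. x \<in> cball 0 1 \<Longrightarrow> p \<in> cball 0 1 \<Longrightarrow> cmod (f x - f p) \<le> M0"
  proof -
    have "bounded ((\<lambda>z. f (fst z) - f (snd z)) ` (cball 0 1 \<times> cball 0 1))"
      by (intro compact_imp_bounded compact_continuous_image compact_Times continuous_intros continuous_on_compose2[OF cont]) auto
    then show ?thesis using that by (auto simp: bounded_pos)
  qed
  define \<alpha> where "\<alpha> = 4 * \<Phi> * (\<Phi> - pi * K / K')"
  define l m l4 where "l = ln (m0\<^sup>2 / 2)" and "m = ln (M0\<^sup>2 + 1)" and "l4 = 2 * \<Phi> * ln 4 + 68 * pi"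
  define \<beta> where "\<beta> = 4 * \<Phi>\<^sup>2 * l - (2 * \<Phi> / K' * (K * pi) * m + l4 * (K * pi) * 2)"
  define \<gamma> where "\<gamma> = \<Phi>\<^sup>2 * l\<^sup>2 - l4 * (K * pi) * m"
  have "0 < \<alpha>" using \<Phi> by (simp add: \<alpha>_def)
  then obtain X0 where X0: "\<And>X. X0 \<le> X \<Longrightarrow> 0 < \<alpha> * X\<^sup>2 + \<beta> * X + \<gamma>"
    using quadratic_eventually_pos by blast
  \<comment> \<open>For X beyond \<open>X1\<close> the quadratic is positive, and X >= -l/2 says
    that 2 \<delta>^2 <= m0^2. The two terms of \<open>r0\<close> ensure \<rho> <= cos \<Phi> and X
    > \<open>X1\<close>.\<close>
  define X1 where "X1 = max 0 (max X0 (- l / 2))"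
  define r0 where "r0 = min (cos \<Phi>) (exp (- X1 / K'))"
  have K'0: "0 < K'" using K K' by linarith
  have r0: "0 < r0" "r0 \<le> 1" using cos0 by (auto simp: r0_def min_le_iff_disj)
  show ?thesis
  proof (rule that[OF r0], rule ccontr)
    fix E p \<rho>
    assume E: "connected E" "E \<subseteq> cball 0 1" "p \<in> E" and \<rho>: "0 < \<rho>" "\<rho> < r0"
      and small: "\<And>x. x \<in> E \<Longrightarrow> cmod (f x - f p) \<le> \<rho> powr K'" and sub: "\<not> E \<subseteq> ball p \<rho>"
    obtain q1 where "q1 \<in> E" "q1 \<notin> ball p \<rho>" using sub by blast
    then have q1: "q1 \<in> E" "\<rho> \<le> cmod (q1 - p)" by (auto simp: dist_norm norm_minus_commute)
    have "connected ((\<lambda>x. cmod (p - x)) ` E)"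
      by (intro connected_continuous_image E continuous_intros)
    moreover have "0 \<in> (\<lambda>x. cmod (p - x)) ` E" "cmod (p - q1) \<in> (\<lambda>x. cmod (p - x)) ` E"
      using E q1 by (auto simp: image_iff intro!: bexI[of _ p] bexI[of _ q1])
    ultimately have "\<rho> \<in> (\<lambda>x. cmod (p - x)) ` E"
      using q1 \<rho> by (auto dest!: connectedD_interval[of _ 0 "cmod (p - q1)" \<rho>] simp: norm_minus_commute)
    then obtain q where q: "q \<in> E" "cmod (p - q) = \<rho>" by auto
    define X where "X = - K' * ln \<rho>"
    define \<delta> where "\<delta> = \<rho> powr K'"
    have \<delta>: "\<delta> = exp (- X)" using \<rho> by (simp add: \<delta>_def X_def powr_def)
    have "ln \<rho> < - X1 / K'"
    proof -
      have "ln \<rho> < ln (exp (- X1 / K'))" using \<rho> by (subst ln_less_cancel_iff) (auto simp: r0_def)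
      then show ?thesis by simp
    qed
    then have X: "X1 < X" using K'0 by (simp add: X_def field_simps)
    then have X': "0 < X" "X0 \<le> X" "- l / 2 \<le> X" by (auto simp: X1_def)
    have \<delta>2: "\<delta>\<^sup>2 = exp (- 2 * X)" by (simp add: \<delta> exp_double[symmetric])
    have \<delta>1: "0 < \<delta>" "\<delta>\<^sup>2 \<le> 1" using X' by (simp_all add: \<delta>2) (simp add: \<delta>)
    have lnm: "ln (m0\<^sup>2 / (2 * \<delta>\<^sup>2)) = l + 2 * X"
      using m0 \<delta>1 by (simp add: l_def ln_div ln_mult \<delta>2)
    have le: "2 * \<delta>\<^sup>2 \<le> m0\<^sup>2"
    proof -
      have "ln (\<delta>\<^sup>2) \<le> ln (m0\<^sup>2 / 2)" using X' by (simp add: \<delta>2 l_def)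
      then have "\<delta>\<^sup>2 \<le> m0\<^sup>2 / 2" using \<delta>1 m0 by (subst (asm) ln_le_cancel_iff) auto
      then show ?thesis by simp
    qed
    have "(\<Phi> * ln (m0\<^sup>2 / (2 * \<delta>\<^sup>2)))\<^sup>2 \<le> (2 * \<Phi> * ln (4 / \<rho>) + 68 * pi) * (K * (pi * ln ((M0\<^sup>2 + \<delta>\<^sup>2) / \<delta>\<^sup>2)))"
    proof (rule compression_core[OF hom _ dist \<Phi>(1,2) E(1,2) E(3) q(1) q(2) \<rho>(1) _ m0(1) _ _ _ \<delta>1(1) le])
      show "0 < K" using K by simp
      show "\<rho> \<le> cos \<Phi>" using \<rho> by (simp add: r0_def)
      show "0 \<le> M0" using M0 by simp
    qed (use m0(2) M0(2) E small in \<open>auto simp: \<delta>_def\<close>)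
    also have "\<dots> \<le> (2 * \<Phi> * ln (4 / \<rho>) + 68 * pi) * (K * (pi * (m + 2 * X)))"
    proof -
      have "ln ((M0\<^sup>2 + \<delta>\<^sup>2) / \<delta>\<^sup>2) = ln (M0\<^sup>2 + \<delta>\<^sup>2) + 2 * X"
      proof -
        have "0 < M0\<^sup>2 + \<delta>\<^sup>2" "0 < \<delta>\<^sup>2" using M0 \<delta>1 by (auto simp: add_pos_nonneg)
        then have "ln ((M0\<^sup>2 + \<delta>\<^sup>2) / \<delta>\<^sup>2) = ln (M0\<^sup>2 + \<delta>\<^sup>2) - ln (\<delta>\<^sup>2)" by (simp add: ln_div)
        then show ?thesis by (simp add: \<delta>2)
      qed
      also have "\<dots> \<le> m + 2 * X"
      proof -
        have "0 < M0\<^sup>2 + \<delta>\<^sup>2" using M0 by (simp add: add_pos_nonneg)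
        then show ?thesis using ln_mono[of "M0\<^sup>2 + \<delta>\<^sup>2" "M0\<^sup>2 + 1"] \<delta>1 unfolding m_def by linarith
      qed
      finally have "ln ((M0\<^sup>2 + \<delta>\<^sup>2) / \<delta>\<^sup>2) \<le> m + 2 * X" .
      moreover have "0 \<le> ln (4 / \<rho>)" using \<rho> r0 by (intro ln_ge_zero) auto
      ultimately show ?thesis using K \<Phi> by (intro mult_left_mono) auto
    qed
    also have "ln (4 / \<rho>) = ln 4 + X / K'"
      using \<rho> K'0 by (simp add: ln_div X_def)
    finally have ineq: "(\<Phi> * (l + 2 * X))\<^sup>2 \<le> (2 * \<Phi> * (ln 4 + X / K') + 68 * pi) * (K * (pi * (m + 2 * X)))"
      by (simp add: lnm)
    have "(\<Phi> * (l + 2 * X))\<^sup>2 - (2 * \<Phi> * (ln 4 + X / K') + 68 * pi) * (K * (pi * (m + 2 * X)))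
      = \<alpha> * X\<^sup>2 + \<beta> * X + \<gamma>"
    proof -
      have 1: "2 * \<Phi> * (ln 4 + X / K') + 68 * pi = l4 + 2 * \<Phi> / K' * X"
        by (simp add: l4_def algebra_simps)
      have 2: "\<alpha> = 4 * \<Phi>\<^sup>2 - 2 * \<Phi> / K' * (K * pi) * 2"
        by (simp add: \<alpha>_def power2_eq_square algebra_simps)
      show ?thesis
        unfolding 1 2 \<beta>_def \<gamma>_def by (simp add: power2_eq_square algebra_simps)
    qed
    with ineq X0[OF X'(2)] show False by simp
  qed
qed

text \<open>With \<tau> = |z - w| and d = |f z - f w|, about \<tau>^K'/d disjoint balls of radius
  comparable to d are crossed, each at cost comparable to \<tau>^2. As d <= \<tau>^a this produces
  the exponent 2 + K' - a. The threshold may depend on z, the constant C may not.\<close>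

lemma boundary_estimate:
  fixes b :: "complex \<Rightarrow> complex"
  assumes hom: "homeomorphism UNIV UNIV f g"
    and K: "1 \<le> K" and distK: "AE x in lborel. x \<in> ball 0 1 \<longrightarrow> (dnorm x)\<^sup>2 \<le> K * jac x"
    and K': "2 * K < K'" "K' < a"
    and kk [measurable]: "kk \<in> borel_measurable borel" and kk0: "\<And>x. 0 \<le> kk x"
    and dist: "AE x in lborel. (dnorm x)\<^sup>2 \<le> kk x * jac x"
    and L: "1 \<le> L" and star: "weak_starlike \<Omega>" and lip: "bi_lipschitz L b" and im: "f ` ball 0 1 = b ` \<Omega>"
  obtains C where "0 < C"
    "\<And>z. z \<in> cball 0 1 \<Longrightarrow> \<exists>\<tau>0>0. \<forall>w\<in>cball 0 1. 0 < cmod (z - w) \<and> cmod (z - w) < \<tau>0 \<and> cmod (f z - f w) \<le> cmod (z - w) powr a \<longrightarrow>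
      ennreal (C * cmod (z - w) powr (2 + K' - a)) \<le> (\<integral>\<^sup>+x. ennreal (kk x) * indicator (ball z (cmod (z - w))) x \<partial>lborel)"
proof -
  have cg: "continuous_on UNIV g" and fg [simp]: "f (g y) = y" and gf [simp]: "g (f x) = x" for x y
    using hom by (auto simp: homeomorphism_def)
  have inj: "inj f" by (metis gf injI)
  have gU: "f ` S = g -` S" for S by (auto simp: image_iff) (metis fg)
  have sph: "f ` sphere 0 1 = f ` cball 0 1 - f ` ball 0 1" unfolding gU by auto
  obtain h where h: "homeomorphism UNIV UNIV b h"
    using lip by (auto simp: bi_lipschitz_def)
  have ch: "continuous_on UNIV h" and cb: "continuous_on UNIV b" and bh [simp]: "b (h y) = y" and hb [simp]: "h (b x) = x" for x y
    using h by (auto simp: homeomorphism_def)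
  have bL: "cmod (b x - b y) \<le> L * cmod (x - y)" and bL': "cmod (x - y) \<le> L * cmod (b x - b y)" for x y
  proof -
    show "cmod (b x - b y) \<le> L * cmod (x - y)" using lip by (auto simp: bi_lipschitz_def)
    have "1 / L * cmod (x - y) \<le> cmod (b x - b y)" using lip by (auto simp: bi_lipschitz_def)
    then show "cmod (x - y) \<le> L * cmod (b x - b y)" using L by (simp add: field_simps)
  qed
  have bLm: "cmod (b x - b y) \<le> L * e" if "cmod (x - y) \<le> e" for x y e
    using bL[of x y] mult_left_mono[OF that, of L] L by linarith
  have clos: "f ` cball 0 1 = b ` closure \<Omega>" and front: "f ` sphere 0 1 = b ` frontier \<Omega>"
    and cl_img: "closure (f ` ball 0 1) = f ` cball 0 1"
  proof -
    have homeo: "homeomorphism UNIV UNIV F F' \<Longrightarrow> closure (F ` S) = F ` closure S" for F F' :: "complex \<Rightarrow> complex" and S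
    proof -
      assume H: "homeomorphism UNIV UNIV F F'"
      have "closure (F ` S) \<subseteq> F ` closure S"
      proof (rule closure_minimal)
        have "F ` closure S = F' -` closure S"
          using H by (auto simp: homeomorphism_def image_iff) (metis UNIV_I)
        then show "closed (F ` closure S)"
          using H by (metis closed_closure closed_vimage homeomorphism_def)
      qed (simp add: closure_subset image_mono)
      moreover have "F ` closure S \<subseteq> closure (F ` S)"
        by (rule image_closure_subset) (use H in \<open>auto simp: homeomorphism_def intro: continuous_on_subset closure_subset[THEN subsetD]\<close>)
      ultimately show ?thesis by blast
    qed
    have o: "open \<Omega>" using star by (auto simp: weak_starlike_def planar_domain_def)
    show "closure (f ` ball 0 1) = f ` cball 0 1"
      using homeo[OF hom, of "ball 0 1"] by simp
    then show c: "f ` cball 0 1 = b ` closure \<Omega>" using im homeo[OF h, of \<Omega>] by simp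
    have injb: "inj b" by (metis hb injI)
    note sph
    moreover have "b ` frontier \<Omega> = b ` closure \<Omega> - b ` \<Omega>"
      using injb o by (simp add: frontier_def interior_open image_set_diff)
    ultimately show "f ` sphere 0 1 = b ` frontier \<Omega>" using c im by simp
  qed
  obtain r0 where r0: "0 < r0" "r0 \<le> 1"
    "\<And>E p \<rho>. connected E \<Longrightarrow> E \<subseteq> cball 0 1 \<Longrightarrow> p \<in> E \<Longrightarrow> 0 < \<rho> \<Longrightarrow> \<rho> < r0 \<Longrightarrow>
       (\<And>x. x \<in> E \<Longrightarrow> cmod (f x - f p) \<le> \<rho> powr K') \<Longrightarrow> E \<subseteq> ball p \<rho>"
    using compression[OF hom K distK K'(1)] by metis
  have K'0: "0 < K'" using K K' by linarith
  define c0 where "c0 = 81 / (65536 * pi)"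
  have c0: "0 < c0" by (simp add: c0_def)
  \<comment> \<open>This is c0 (\<tau>/2)^2 times the lower bound (\<tau>/20)^K' / (8 L^4 \<tau>^a)
    for the number of balls, with the powers of \<tau> taken out.\<close>
  define C where "C = c0 / (32 * L ^ 4 * 20 powr K')"
  have C: "0 < C" using c0 L by (simp add: C_def)
  \<comment> \<open>d <= cc \<tau>^K' means 8 L^4 d <= (\<tau>/20)^K', which guarantees Q >= 1 below
    and hence at least two balls.\<close>
  define cc where "cc = (1/20) powr K' / (8 * L ^ 4)"
  have cc: "0 < cc" using L by (simp add: cc_def)
  obtain \<tau>1 where \<tau>1: "0 < \<tau>1" "\<And>\<tau>. 0 < \<tau> \<Longrightarrow> \<tau> < \<tau>1 \<Longrightarrow> \<tau> powr a \<le> cc * \<tau> powr K'"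
    using power_less_scaled_power_eventually[OF cc K'(2)] by metis
  have seg_img: "connected (g ` closed_segment y y')" for y y'
    by (intro connected_continuous_image continuous_on_subset[OF cg]) auto
  show ?thesis
  proof (rule that[OF C])
    fix z assume z: "z \<in> cball (0::complex) 1"
    \<comment> \<open>For interior z, image points at distance below \<tau>2^a from f z stay in the
      image of the open disk. The value is immaterial for boundary points.\<close>
    obtain \<tau>2 where \<tau>2: "0 < \<tau>2" "z \<in> ball 0 1 \<Longrightarrow> ball (f z) (\<tau>2 powr a) \<subseteq> f ` ball 0 1"
    proof (cases "z \<in> ball 0 1")
      case True
      have "open (f ` ball 0 1)" unfolding gU using cg by (metis open_ball open_vimage)
      then obtain e where e: "0 < e" "ball (f z) e \<subseteq> f ` ball 0 1"
        using True by (meson image_eqI open_contains_ball)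
      have a0: "0 < a" using K'0 K' by linarith
      show ?thesis
      proof (rule that[of "e powr (1 / a)"])
        show "ball (f z) ((e powr (1 / a)) powr a) \<subseteq> f ` ball 0 1"
          using e a0 by (simp add: powr_powr)
      qed (use e in simp)
    qed (use that[of 1] in auto)
    show "\<exists>\<tau>0>0. \<forall>w\<in>cball 0 1. 0 < cmod (z - w) \<and> cmod (z - w) < \<tau>0 \<and> cmod (f z - f w) \<le> cmod (z - w) powr a \<longrightarrow>
      ennreal (C * cmod (z - w) powr (2 + K' - a)) \<le> (\<integral>\<^sup>+x. ennreal (kk x) * indicator (ball z (cmod (z - w))) x \<partial>lborel)"
    proof (intro exI[of _ "min (min r0 \<tau>1) \<tau>2"] conjI ballI impI)
      show "0 < min (min r0 \<tau>1) \<tau>2" using r0 \<tau>1 \<tau>2 by simp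
      fix w assume w: "w \<in> cball (0::complex) 1"
        and "0 < cmod (z - w) \<and> cmod (z - w) < min (min r0 \<tau>1) \<tau>2 \<and> cmod (f z - f w) \<le> cmod (z - w) powr a"
      define \<tau> d where "\<tau> = cmod (z - w)" and "d = cmod (f z - f w)"
      then have \<tau>: "0 < \<tau>" "\<tau> < r0" "\<tau> < \<tau>1" "\<tau> < \<tau>2" and d: "d \<le> \<tau> powr a"
        using \<open>0 < cmod (z - w) \<and> cmod (z - w) < min (min r0 \<tau>1) \<tau>2 \<and> cmod (f z - f w) \<le> cmod (z - w) powr a\<close> by auto
      have d0: "0 < d" using \<tau> inj by (auto simp: d_def \<tau>_def inj_def)
      have d1: "d \<le> cc * \<tau> powr K'" using d \<tau>1(2)[OF \<tau>(1) \<tau>(3)] by linarith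
      have sc: "(\<tau> / 20) powr K' = (1/20) powr K' * \<tau> powr K'"
        using \<tau> by (simp add: powr_mult[symmetric])
      \<comment> \<open>The bi-Lipschitz map sends a segment of length at most 2 l1 into a ball of
        radius (\<tau>/20)^K', so the preimage of the resulting curve stays within \<tau>/20 of its
        starting point.\<close>
      define l1 where "l1 = (\<tau> / 20) powr K' / (2 * L)"
      have d2: "d * (4 * L ^ 3) \<le> l1"
      proof -
        have "d * (8 * L ^ 4) \<le> (\<tau> / 20) powr K'"
          using d1 L unfolding sc cc_def by (simp add: field_simps)
        then show ?thesis using L by (simp add: l1_def field_simps power4_eq_xxxx power3_eq_cube)
      qed
      have d3: "d \<le> (\<tau> / 20) powr K'"
      proof -
        have "1 * 1 \<le> 8 * L ^ 4" using L by (intro mult_mono) (auto intro: one_le_power)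
        then have "d * 1 \<le> d * (8 * L ^ 4)" using d0 by (intro mult_left_mono) auto
        also have "\<dots> \<le> (\<tau> / 20) powr K'"
          using d1 L unfolding sc cc_def by (simp add: field_simps)
        finally show ?thesis by simp
      qed
      \<comment> \<open>For interior z the preimage of the segment from f z to f w would be a
        connected subset of the disk joining z to w while staying within \<tau>/20 of z, although |z
        - w| = \<tau>.\<close>
      have znb: "z \<notin> ball 0 1"
      proof
        assume zb: "z \<in> ball 0 1"
        have "a \<noteq> 0" "0 < a" using K'0 K' by auto
        then have "d < \<tau>2 powr a" using d powr_less_mono2[of a \<tau> \<tau>2] \<tau> by linarith
        then have "f w \<in> ball (f z) (\<tau>2 powr a)" by (simp add: d_def dist_norm)
        moreover have "f z \<in> ball (f z) (\<tau>2 powr a)" using \<tau>2(1) by simp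
        ultimately have "closed_segment (f z) (f w) \<subseteq> ball (f z) (\<tau>2 powr a)"
          by (simp add: closed_segment_subset)
        then have sub: "closed_segment (f z) (f w) \<subseteq> f ` ball 0 1" using \<tau>2(2)[OF zb] by blast
        have "g ` closed_segment (f z) (f w) \<subseteq> ball z (\<tau>/20)"
        proof (rule r0(3)[OF seg_img])
          show "g ` closed_segment (f z) (f w) \<subseteq> cball 0 1" using sub by fastforce
          show "z \<in> g ` closed_segment (f z) (f w)" by (metis gf ends_in_segment(1) image_eqI)
          fix x assume "x \<in> g ` closed_segment (f z) (f w)"
          then have "f x \<in> closed_segment (f z) (f w)" by auto
          then have "cmod (f x - f z) \<le> d"
            using segment_bound(1)[of "f x" "f z" "f w"] by (simp add: d_def norm_minus_commute)
          then show "cmod (f x - f z) \<le> (\<tau>/20) powr K'" using d3 by linarith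
        qed (use \<tau> in auto)
        moreover have "w \<in> g ` closed_segment (f z) (f w)" by (metis gf ends_in_segment(2) image_eqI)
        ultimately show False using \<tau> by (auto simp: \<tau>_def dist_norm)
      qed
      then have zs: "z \<in> sphere 0 1" using z by auto
      \<comment> \<open>Follow the segment from f w towards f z up to its first point on the
        boundary of the image. Its preimage \<open>w2\<close> is a boundary point within \<tau>/20
        of w, by the compression lemma.\<close>
      obtain w2 where w2: "w2 \<in> sphere 0 1" "cmod (w - w2) < \<tau>/20" "cmod (f z - f w2) \<le> d"
      proof -
        define T where "T = closed_segment (f w) (f z)"
        define U where "U = f ` ball 0 1"
        have clU: "closure U = f ` cball 0 1" unfolding U_def by (rule cl_img)
        have "open U" unfolding U_def gU by (intro open_vimage cg) auto
        then have frU: "frontier U = f ` sphere 0 1"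
          using clU sph by (simp add: frontier_def interior_open U_def)
        have clT: "closed (T \<inter> frontier U)" unfolding T_def by (intro closed_Int) auto
        have neT: "T \<inter> frontier U \<noteq> {}" using zs unfolding frU T_def by auto
        obtain v where v: "v \<in> T \<inter> frontier U" "\<And>y. y \<in> T \<inter> frontier U \<Longrightarrow> dist (f w) v \<le> dist (f w) y"
          by (rule distance_attains_inf[OF clT neT, of "f w"], rule that)
        have vT: "closed_segment (f w) v \<subseteq> T"
          unfolding T_def using v(1) by (simp add: T_def subset_closed_segment)
        \<comment> \<open>To leave the closure of U the segment would have to meet the frontier of
          that closure, which is contained in the frontier of U, strictly before the nearest
          frontier point v.\<close>
        have sub: "closed_segment (f w) v \<subseteq> closure U"
        proof (rule ccontr)
          assume "\<not> closed_segment (f w) v \<subseteq> closure U"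
          then obtain y where y: "y \<in> closed_segment (f w) v" "y \<notin> closure U" by auto
          have "f w \<in> closure U" using w unfolding clU by auto
          then have "closed_segment (f w) y \<inter> frontier (closure U) \<noteq> {}"
            using y(2) by (intro connected_Int_frontier) auto
          then obtain y' where y': "y' \<in> closed_segment (f w) y" "y' \<in> frontier (closure U)" by auto
          have "y' \<in> frontier U" using y'(2) by (auto simp: frontier_def dest: interior_mono[OF closure_subset, THEN subsetD])
          moreover have "y' \<in> T"
            using y'(1) y(1) vT by (meson subset_closed_segment ends_in_segment(1) subsetD)
          ultimately have "dist (f w) v \<le> dist (f w) y'" using v(2) by blast
          moreover have "y' \<noteq> y" using y'(2) y(2) by (auto simp: frontier_def)
          then have "dist (f w) y' < dist (f w) y"
            using y'(1) by (metis between_mem_segment between dist_pos_lt dist_commute less_add_same_cancel1)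
          moreover have "dist (f w) y \<le> dist (f w) v"
            using segment_bound(1)[OF y(1)] by (simp add: dist_norm norm_minus_commute)
          ultimately show False by linarith
        qed
        have dv: "cmod (v - f z) \<le> d" "cmod (f w - v) \<le> d"
          using v(1) segment_bound[of v "f w" "f z"] by (auto simp: T_def d_def norm_minus_commute)
        have "g ` closed_segment (f w) v \<subseteq> ball w (\<tau>/20)"
        proof (rule r0(3)[OF seg_img])
          show "g ` closed_segment (f w) v \<subseteq> cball 0 1" using sub unfolding clU by fastforce
          show "w \<in> g ` closed_segment (f w) v" by (metis gf ends_in_segment(1) image_eqI)
          fix x assume "x \<in> g ` closed_segment (f w) v"
          then have "f x \<in> closed_segment (f w) v" by auto
          then have "cmod (f x - f w) \<le> cmod (f w - v)"
            using segment_bound(1)[of "f x" "f w" v] by (simp add: norm_minus_commute)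
          then show "cmod (f x - f w) \<le> (\<tau>/20) powr K'" using d3 dv by linarith
        qed (use \<tau> in auto)
        then have "g v \<in> ball w (\<tau>/20)" by auto
        moreover have "g v \<in> sphere 0 1" using v(1) frU by auto
        ultimately show ?thesis using dv by (intro that[of "g v"]) (auto simp: dist_norm norm_minus_commute)
      qed
      define z' w' where "z' = h (f z)" and "w' = h (f w2)"
      have z'w': "z' \<in> frontier \<Omega>" "w' \<in> frontier \<Omega>"
        using front zs w2(1) by (metis (no_types, lifting) hb image_iff z'_def, metis (no_types, lifting) hb image_iff w'_def)
      have bz: "b z' = f z" "b w' = f w2" by (simp_all add: z'_def w'_def)
      have zw: "cmod (z' - w') \<le> L * d"
      proof -
        have "L * cmod (f z - f w2) \<le> L * d" using L w2(3) by (intro mult_left_mono) auto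
        then show ?thesis using bL'[of z' w'] unfolding bz by linarith
      qed
      have Ld: "L * d \<le> l1 / 2"
      proof -
        have "L * d * 1 \<le> L * d * (2 * L\<^sup>2)" using L d0 by (intro mult_left_mono) (auto intro: order_trans[OF one_le_power[of L 2]])
        also have "\<dots> = d * (4 * L ^ 3) / 2" by (simp add: power2_eq_square power3_eq_cube)
        finally show ?thesis using d2 by linarith
      qed
      obtain u where u: "u \<in> \<Omega>" "closed_segment u z' \<subseteq> closure \<Omega>" "closed_segment u w' \<subseteq> closure \<Omega>"
        using star z'w' unfolding weak_starlike_def by blast
      define q where "q x = g (b x)" for x
      have cq: "continuous_on S q" for S
        unfolding q_def by (rule continuous_on_subset[OF continuous_on_compose2[OF cg cb]]) auto
      have fq: "f (q x) = b x" for x by (simp add: q_def)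
      have qz: "q z' = z" "q w' = w2" by (simp_all add: q_def bz)
      have q_in: "q x \<in> cball 0 1" if "x \<in> closure \<Omega>" for x
        using clos that by (metis fq image_iff gf)
      define N where "N = cmod (u - z')"
      have zw2: "cmod (z - w2) \<ge> 19/20 * \<tau>"
        using norm_triangle_ineq[of "z - w2" "w2 - w"] w2(2) by (simp add: \<tau>_def norm_minus_commute)
      \<comment> \<open>The centre u cannot be close to z': otherwise the two segments through u
        would form a short connected set joining z' to w', and its preimage would force z and
        \<open>w2\<close> within \<tau>/20 of each other.\<close>
      have Nl: "l1 \<le> N"
      proof (rule ccontr)
        assume "\<not> l1 \<le> N"
        then have Nl: "N < l1" by simp
        have "q ` (closed_segment u z' \<union> closed_segment u w') \<subseteq> ball z (\<tau>/20)"
        proof (rule r0(3))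
          show "connected (q ` (closed_segment u z' \<union> closed_segment u w'))"
            by (intro connected_continuous_image cq connected_Un) auto
          show "q ` (closed_segment u z' \<union> closed_segment u w') \<subseteq> cball 0 1"
            using u q_in by blast
          show "z \<in> q ` (closed_segment u z' \<union> closed_segment u w')"
            using qz by (metis UnI1 ends_in_segment(2) image_eqI)
          fix x assume "x \<in> q ` (closed_segment u z' \<union> closed_segment u w')"
          then obtain y where y: "y \<in> closed_segment u z' \<union> closed_segment u w'" "x = q y" by auto
          have "0 \<le> L * d" using L d0 by simp
          then have "u \<in> cball z' l1" "z' \<in> cball z' l1" "w' \<in> cball z' l1"
            using Nl zw Ld by (simp_all add: N_def dist_norm norm_minus_commute)
          then have "closed_segment u z' \<subseteq> cball z' l1" "closed_segment u w' \<subseteq> cball z' l1"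
            by (simp_all add: closed_segment_subset)
          then have "cmod (y - z') \<le> l1" using y by (auto simp: dist_norm norm_minus_commute)
          then have "cmod (f x - f z) \<le> L * l1"
            using bLm[of y z' l1] by (simp add: y(2) fq bz)
          also have "\<dots> \<le> (\<tau>/20) powr K'" using L by (simp add: l1_def)
          finally show "cmod (f x - f z) \<le> (\<tau>/20) powr K'" .
        qed (use \<tau> in auto)
        moreover have "w2 \<in> q ` (closed_segment u z' \<union> closed_segment u w')"
          using qz by (metis UnI2 ends_in_segment(2) image_eqI)
        ultimately have "cmod (z - w2) < \<tau>/20" by (auto simp: dist_norm)
        then show False using zw2 \<tau> by linarith
      qed
      have l10: "0 < l1" using \<tau> L by (simp add: l1_def)
      then have N0: "0 < N" using Nl by linarith
      \<comment> \<open>Both segments are parametrised towards their common end u, so the gap X t -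
        Y t only shrinks, by the factor 1 - t.\<close>
      define X Y where "X t = z' + t *\<^sub>R (u - z')" and "Y t = w' + t *\<^sub>R (u - w')" for t
      define t1 where "t1 = l1 / N"
      have t1: "0 < t1" "t1 \<le> 1" using l10 N0 Nl by (auto simp: t1_def)
      have XY: "cmod (X t - Y t) \<le> L * d" if "0 \<le> t" "t \<le> 1" for t
      proof -
        have "X t - Y t = (1 - t) *\<^sub>R (z' - w')" by (simp add: X_def Y_def algebra_simps)
        then have "cmod (X t - Y t) = (1 - t) * cmod (z' - w')" using that by simp
        also have "\<dots> \<le> 1 * cmod (z' - w')" using that by (intro mult_right_mono) auto
        finally show ?thesis using zw by simp
      qed
      have Xseg: "X t \<in> closed_segment z' (X t1)" "Y t \<in> closed_segment w' (Y t1)" if "0 \<le> t" "t \<le> t1" for t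
      proof -
        have *: "v + t *\<^sub>R (u - v) \<in> closed_segment v (v + t1 *\<^sub>R (u - v))" for v
          unfolding in_segment using that t1
          by (intro exI[of _ "t / t1"]) (simp add: algebra_simps)
        show "X t \<in> closed_segment z' (X t1)" "Y t \<in> closed_segment w' (Y t1)"
          using *[of z'] *[of w'] by (simp_all add: X_def Y_def)
      qed
      have Xin: "closed_segment z' (X t1) \<subseteq> closure \<Omega>" "closed_segment w' (Y t1) \<subseteq> closure \<Omega>"
      proof -
        have *: "v + t1 *\<^sub>R (u - v) \<in> closed_segment u v" for v
          unfolding in_segment using t1 by (intro exI[of _ "1 - t1"]) (simp add: algebra_simps)
        show "closed_segment z' (X t1) \<subseteq> closure \<Omega>"
          using *[of z'] by (intro order_trans[OF closed_segment_subset u(2)]) (auto simp: X_def)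
        show "closed_segment w' (Y t1) \<subseteq> closure \<Omega>"
          using *[of w'] by (intro order_trans[OF closed_segment_subset u(3)]) (auto simp: Y_def)
      qed
      have near: "q ` closed_segment v v' \<subseteq> ball (q v) (\<tau>/20)"
        if v: "closed_segment v v' \<subseteq> closure \<Omega>" "cmod (v' - v) \<le> 2 * l1" for v v'
      proof (rule r0(3))
        show "connected (q ` closed_segment v v')" by (intro connected_continuous_image cq) auto
        show "q ` closed_segment v v' \<subseteq> cball 0 1" using v q_in by blast
        fix x assume "x \<in> q ` closed_segment v v'"
        then obtain y where y: "y \<in> closed_segment v v'" "x = q y" by auto
        have "cmod (y - v) \<le> 2 * l1" using segment_bound(1)[OF y(1)] v by linarith
        then have "cmod (f x - f (q v)) \<le> L * (2 * l1)"
          using bLm[of y v "2 * l1"] by (simp add: y(2) fq)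
        also have "\<dots> = (\<tau>/20) powr K'" using L by (simp add: l1_def)
        finally show "cmod (f x - f (q v)) \<le> (\<tau>/20) powr K'" .
      qed (use \<tau> in auto)
      have nearX: "cmod (q (X t) - z) < \<tau>/20" and nearY: "cmod (q (Y t) - w2) < \<tau>/20" if t: "0 \<le> t" "t \<le> t1" for t
      proof -
        have "X t1 - z' = t1 *\<^sub>R (u - z')" by (simp add: X_def)
        then have "cmod (X t1 - z') = l1" using l10 N0 by (simp add: N_def[symmetric] t1_def)
        then have "q ` closed_segment z' (X t1) \<subseteq> ball z (\<tau>/20)"
          using near[OF Xin(1)] l10 by (simp add: qz)
        then show "cmod (q (X t) - z) < \<tau>/20"
          using Xseg(1)[OF t] by (auto simp: dist_norm norm_minus_commute)
        have "cmod (Y t1 - w') = t1 * cmod (u - w')" using t1 by (simp add: Y_def)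
        also have "\<dots> \<le> t1 * (N + L * d)"
          using t1 zw norm_triangle_ineq[of "u - z'" "z' - w'"] by (intro mult_left_mono) (auto simp: N_def)
        also have "\<dots> = l1 + t1 * (L * d)" using N0 by (simp add: t1_def field_simps)
        also have "\<dots> \<le> l1 + 1 * (L * d)" using t1 L d0 by (intro add_left_mono mult_right_mono) auto
        finally have "cmod (Y t1 - w') \<le> 2 * l1" using Ld l10 by linarith
        then have "q ` closed_segment w' (Y t1) \<subseteq> ball w2 (\<tau>/20)"
          using near[OF Xin(2)] by (simp add: qz)
        then show "cmod (q (Y t) - w2) < \<tau>/20"
          using Xseg(2)[OF t] by (auto simp: dist_norm norm_minus_commute)
      qed
      \<comment> \<open>The image under b of the cross segment from X t to Y t, of length at most L
        d, lies within L^2 d = \<kappa>/2 of b (X t).\<close>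
      define \<kappa> where "\<kappa> = 2 * L\<^sup>2 * d"
      have \<kappa>: "0 < \<kappa>" using L d0 by (simp add: \<kappa>_def)
      \<comment> \<open>The preimage of the cross segment runs from within \<tau>/20 of z to within
        \<tau>/20 of \<open>w2\<close>, so it meets every circle about z with radius between
        \<tau>/8 and \<tau>/4.\<close>
      have circle: "\<exists>x. cmod (x - z) = s \<and> cmod (f x - b (X t)) \<le> \<kappa> / 2"
        if t: "0 \<le> t" "t \<le> t1" and s: "\<tau>/8 < s" "s < \<tau>/4" for t s
      proof -
        have "connected ((\<lambda>x. cmod (q x - z)) ` closed_segment (X t) (Y t))"
          by (intro connected_continuous_image continuous_intros cq) auto
        moreover have "cmod (q (X t) - z) \<le> s" using nearX[OF t] s \<tau> by linarith
        moreover have "s \<le> cmod (q (Y t) - z)"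
          using nearY[OF t] zw2 s \<tau> norm_triangle_ineq[of "z - q (Y t)" "q (Y t) - w2"] by (simp add: norm_minus_commute)
        ultimately have "s \<in> (\<lambda>x. cmod (q x - z)) ` closed_segment (X t) (Y t)"
          using connectedD_interval[of "(\<lambda>x. cmod (q x - z)) ` closed_segment (X t) (Y t)" "cmod (q (X t) - z)" "cmod (q (Y t) - z)" s]
          by auto
        then obtain y where y: "y \<in> closed_segment (X t) (Y t)" "cmod (q y - z) = s" by auto
        have "cmod (y - X t) \<le> L * d"
          using segment_bound(1)[OF y(1)] XY[of t] t t1 by (simp add: norm_minus_commute)
        then have "cmod (f (q y) - b (X t)) \<le> L * (L * d)"
          unfolding fq by (rule bLm)
        then show ?thesis using y(2) by (intro exI[of _ "q y"]) (simp add: \<kappa>_def power2_eq_square)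
      qed
      \<comment> \<open>Consecutive points on the first segment are \<eta> N = 2 \<kappa> L apart,
        so their images under b are at least 2 \<kappa> apart and the balls of radius \<kappa> about
        them are disjoint.\<close>
      define \<eta> where "\<eta> = 2 * \<kappa> * L / N"
      have \<eta>: "0 < \<eta>" using \<kappa> L N0 by (simp add: \<eta>_def)
      define Q where "Q = l1 / (4 * L ^ 3 * d)"
      have Q: "t1 / \<eta> = Q" using N0 L d0 by (simp add: t1_def \<eta>_def \<kappa>_def Q_def power2_eq_square power3_eq_cube field_simps)
      have Q1: "1 \<le> Q" using d2 L d0 by (simp add: Q_def field_simps)
      \<comment> \<open>The parameters 0, \<eta>, 2 \<eta>, ... up to t1 = Q \<eta>, the one at 0
        included.\<close>
      define m where "m = nat \<lfloor>Q\<rfloor> + 1"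
      have mQ: "Q \<le> real m" using Q1 by (simp add: m_def) linarith
      have m2: "2 \<le> m" using Q1 by (simp add: m_def le_nat_iff)
      have jt: "0 \<le> real j * \<eta>" "real j * \<eta> \<le> t1" if "j < m" for j
      proof -
        have "real j \<le> Q" using that Q1 by (simp add: m_def less_Suc_eq_le le_nat_iff) linarith
        then show "real j * \<eta> \<le> t1" using Q \<eta> by (simp add: field_simps)
      qed (use \<eta> in simp)
      define c where "c j = b (X (real j * \<eta>))" for j :: nat
      have sep: "2 * \<kappa> \<le> cmod (c j - c k)" if "j \<noteq> k" for j k
      proof -
        have "X (real j * \<eta>) - X (real k * \<eta>) = ((real j - real k) * \<eta>) *\<^sub>R (u - z')"
          by (simp add: X_def algebra_simps)
        then have "cmod (X (real j * \<eta>) - X (real k * \<eta>)) = \<bar>real j - real k\<bar> * (\<eta> * N)"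
          using \<eta> by (simp add: N_def abs_mult)
        moreover have "1 \<le> \<bar>real j - real k\<bar>" using that by linarith
        ultimately have "1 * (\<eta> * N) \<le> cmod (X (real j * \<eta>) - X (real k * \<eta>))"
          using \<eta> N0 by (metis mult_right_mono mult_nonneg_nonneg less_imp_le)
        also have "\<dots> \<le> L * cmod (c j - c k)" unfolding c_def by (rule bL')
        finally have "2 * \<kappa> * L \<le> L * cmod (c j - c k)" using N0 by (simp add: \<eta>_def)
        then show ?thesis using L by (simp add: mult.commute)
      qed
      define r where "r = \<tau> / 2"
      have cross: "ennreal (c0 * r\<^sup>2) \<le> (\<integral>\<^sup>+x. ennreal (kk x) * indicator (ball z r \<inter> f -` ball (c j) \<kappa>) x \<partial>lborel)" if j: "j < m" for j
        unfolding c0_def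
      proof (rule ball_crossing[OF hom kk kk0 dist \<kappa>])
        show "0 < r" using \<tau> by (simp add: r_def)
        fix s assume s: "r / 4 < s" "s < r / 2"
        \<comment> \<open>Any second ball supplies, on the same circle, a point whose image lies
          outside the j-th ball; this is why two balls are needed.\<close>
        obtain k where k: "k < m" "k \<noteq> j" using m2 by (metis One_nat_def less_2_cases_iff less_le_trans zero_less_one n_not_Suc_n)
        obtain x where x: "cmod (x - z) = s" "cmod (f x - c j) \<le> \<kappa> / 2"
          using circle[OF jt[OF j], of s] s by (auto simp: r_def c_def)
        obtain y where y: "cmod (y - z) = s" "cmod (f y - c k) \<le> \<kappa> / 2"
          using circle[OF jt[OF k(1)], of s] s by (auto simp: r_def c_def)
        have "\<kappa> \<le> cmod (f y - c j)"
          using sep[OF k(2)] y(2) \<kappa> norm_triangle_ineq[of "c k - f y" "f y - c j"] by (simp add: norm_minus_commute)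
        then show "\<exists>x y. cmod (x - z) = s \<and> cmod (y - z) = s \<and> cmod (f x - c j) \<le> \<kappa> / 2 \<and> \<kappa> \<le> cmod (f y - c j)"
          using x y by blast
      qed
      have "ennreal (C * \<tau> powr (2 + K' - a)) \<le> ennreal (real m * (c0 * r\<^sup>2))"
      proof (rule ennreal_leI)
        have "C * \<tau> powr (2 + K' - a) = c0 / (32 * L ^ 4 * 20 powr K') * (\<tau>\<^sup>2 * \<tau> powr K' / \<tau> powr a)"
          using \<tau> by (simp add: C_def powr_add powr_diff)
        also have "\<dots> = (\<tau> / 20) powr K' / (8 * L ^ 4 * \<tau> powr a) * (c0 * r\<^sup>2)"
          using \<tau> by (simp add: r_def power_divide powr_divide field_simps)
        also have "\<dots> \<le> (\<tau> / 20) powr K' / (8 * L ^ 4 * d) * (c0 * r\<^sup>2)"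
          using d d0 L c0 by (intro mult_right_mono divide_left_mono mult_left_mono mult_pos_pos) auto
        also have "(\<tau> / 20) powr K' / (8 * L ^ 4 * d) = Q"
          using L d0 by (simp add: Q_def l1_def power4_eq_xxxx power3_eq_cube field_simps)
        also have "Q * (c0 * r\<^sup>2) \<le> real m * (c0 * r\<^sup>2)"
          using mQ c0 by (intro mult_right_mono) auto
        finally show "C * \<tau> powr (2 + K' - a) \<le> real m * (c0 * r\<^sup>2)" .
      qed
      also have "\<dots> = (\<Sum>j<m. ennreal (c0 * r\<^sup>2))"
        using c0 by (simp add: ennreal_mult ennreal_of_nat_eq_real_of_nat)
      also have "\<dots> \<le> (\<Sum>j<m. \<integral>\<^sup>+x. ennreal (kk x) * indicator (ball z r \<inter> f -` ball (c j) \<kappa>) x \<partial>lborel)"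
        using cross by (intro sum_mono) auto
      also have "\<dots> = (\<integral>\<^sup>+x. (\<Sum>j<m. ennreal (kk x) * indicator (ball z r \<inter> f -` ball (c j) \<kappa>) x) \<partial>lborel)"
      proof (rule nn_integral_sum[symmetric])
        fix j
        have [measurable]: "f -` ball (c j) \<kappa> \<in> sets borel"
          using measurable_sets[of f borel borel "ball (c j) \<kappa>"] by simp
        show "(\<lambda>x. ennreal (kk x) * indicator (ball z r \<inter> f -` ball (c j) \<kappa>) x) \<in> borel_measurable lborel"
          by measurable
      qed
      also have "\<dots> \<le> (\<integral>\<^sup>+x. ennreal (kk x) * indicator (ball z \<tau>) x \<partial>lborel)"
      proof (rule nn_integral_mono)
        fix x
        \<comment> \<open>By disjointness of the image balls at most one summand is nonzero at each
          x.\<close>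
        show "(\<Sum>j<m. ennreal (kk x) * indicator (ball z r \<inter> f -` ball (c j) \<kappa>) x) \<le> ennreal (kk x) * indicator (ball z \<tau>) x"
        proof (cases "\<exists>j<m. x \<in> ball z r \<inter> f -` ball (c j) \<kappa>")
          case True
          then obtain j where j: "j < m" "x \<in> ball z r" "f x \<in> ball (c j) \<kappa>" by auto
          have "f x \<notin> ball (c k) \<kappa>" if "k \<noteq> j" for k
            using j(3) sep[OF that] norm_triangle_ineq[of "c k - f x" "f x - c j"] by (auto simp: dist_norm norm_minus_commute)
          then have "(\<Sum>k<m. ennreal (kk x) * indicator (ball z r \<inter> f -` ball (c k) \<kappa>) x)
            = (\<Sum>k<m. if k = j then ennreal (kk x) else 0)"
            using j by (intro sum.cong) (auto simp: indicator_def)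
          also have "\<dots> = ennreal (kk x)" using j by simp
          finally show ?thesis using j(2) \<tau> by (simp add: r_def)
        next
          case False
          then have "(\<Sum>j<m. ennreal (kk x) * indicator (ball z r \<inter> f -` ball (c j) \<kappa>) x) = 0"
            by (intro sum.neutral) (auto simp: indicator_def)
          then show ?thesis by (simp only: zero_le)
        qed
      qed
      finally show "ennreal (C * cmod (z - w) powr (2 + K' - a)) \<le> (\<integral>\<^sup>+x. ennreal (kk x) * indicator (ball z (cmod (z - w))) x \<partial>lborel)"
        by (simp add: \<tau>_def)
    qed
  qed
qed

end

subsection \<open>Hausdorff measure and representatives of weak derivatives\<close>

text \<open>Choose for every point of A a small ball of mass at least M r^s. A disjoint Vitali
  subfamily covers A after enlargement by 5, and its sum of (10 r)^s is at most 10^s/M times the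
  mass of a fixed ball. Radii at most 1 about points of the closed unit disk stay inside the ball of
  radius 3.\<close>

lemma hausdorff_measure_zero_of_density:
  fixes A :: "complex set" and k :: "complex \<Rightarrow> ennreal"
  assumes [measurable]: "k \<in> borel_measurable borel" and A: "A \<subseteq> cball 0 1" and s: "0 < s"
    and fin: "(\<integral>\<^sup>+x. k x * indicator (ball 0 3) x \<partial>lborel) < \<infinity>"
    and dens: "\<And>z M \<delta>. z \<in> A \<Longrightarrow> 0 < M \<Longrightarrow> 0 < \<delta> \<Longrightarrow>
      \<exists>r. 0 < r \<and> r < \<delta> \<and> ennreal (M * r powr s) \<le> (\<integral>\<^sup>+x. k x * indicator (ball z r) x \<partial>lborel)"
  shows "hausdorff_measure s A = 0"
proof -
  define \<nu> where "\<nu> = density lborel k"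
  have [measurable_cong, simp]: "sets \<nu> = sets borel" by (simp add: \<nu>_def)
  have \<nu>: "emeasure \<nu> B = (\<integral>\<^sup>+x. k x * indicator B x \<partial>lborel)" if "B \<in> sets borel" for B
    using that by (simp add: \<nu>_def emeasure_density)
  obtain V where V: "0 \<le> V" "emeasure \<nu> (ball 0 3) = ennreal V"
    using fin by (cases "emeasure \<nu> (ball 0 3)") (auto simp: \<nu>)
  have "hausdorff_content \<delta> s A \<le> ennreal e" if \<delta>: "0 < \<delta>" and e: "0 < e" for \<delta> e
  proof -
    \<comment> \<open>Chosen so that 10^s/M * V <= e; the summand 1 keeps M positive when V =
      0.\<close>
    define M where "M = 10 powr s * (V + 1) / e"
    have M: "0 < M" using V e by (simp add: M_def)
    have "\<exists>r. 0 < r \<and> r < min 1 (\<delta> / 10) \<and> ennreal (M * r powr s) \<le> emeasure \<nu> (ball z r)" if "z \<in> A" for z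
      using dens[OF that M, of "min 1 (\<delta> / 10)"] \<delta> by (simp add: \<nu>)
    then obtain r where r: "\<And>z. z \<in> A \<Longrightarrow> 0 < r z" "\<And>z. z \<in> A \<Longrightarrow> r z < min 1 (\<delta> / 10)"
      "\<And>z. z \<in> A \<Longrightarrow> ennreal (M * r z powr s) \<le> emeasure \<nu> (ball z (r z))" by metis
    have rB: "0 < r z \<and> r z \<le> 1" if "z \<in> A" for z using r(1,2)[OF that] by auto
    have "A \<subseteq> (\<Union>i\<in>A. ball i (r i))" using r(1) by force
    then obtain C where C: "countable C" "C \<subseteq> A" "pairwise (\<lambda>i j. disjnt (ball i (r i)) (ball j (r j))) C"
      "A \<subseteq> (\<Union>i\<in>C. ball i (5 * r i))"
      using Vitali_covering_lemma_balls[where S=A and K=A and a="\<lambda>i. i" and r=r and B=1] rB by blast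
    define N where "N = to_nat_on C ` C"
    have bij: "bij_betw (to_nat_on C) C N"
      using inj_on_to_nat_on[OF C(1)] by (simp add: N_def bij_betw_def)
    \<comment> \<open>The countable family is indexed by natural numbers and padded with empty sets,
      which \<open>diam_pow\<close> counts as 0.\<close>
    define U where "U i = (if i \<in> N then ball (from_nat_into C i) (5 * r (from_nat_into C i)) else {})" for i
    have fni: "from_nat_into C (to_nat_on C c) = c" if "c \<in> C" for c
      using C(1) that by simp
    have Uc: "U (to_nat_on C c) = ball c (5 * r c)" if "c \<in> C" for c
      using that by (simp add: U_def N_def fni)
    have Ui: "U i = {} \<or> (\<exists>c\<in>C. U i = ball c (5 * r c))" for i
      using Uc by (cases "i \<in> N") (auto simp: N_def U_def)
    have cover: "A \<subseteq> (\<Union>i. U i) \<and> (\<forall>i. bounded (U i) \<and> diameter (U i) \<le> \<delta>)"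
    proof safe
      fix x assume "x \<in> A"
      then obtain c where "c \<in> C" "x \<in> ball c (5 * r c)" using C(4) by auto
      then show "x \<in> (\<Union>i. U i)" using Uc by (metis UNIV_I UN_I)
    next
      fix i
      show "bounded (U i)" using Ui[of i] by auto
      show "diameter (U i) \<le> \<delta>"
        using Ui[of i]
      proof
        assume "\<exists>c\<in>C. U i = ball c (5 * r c)"
        then obtain c where c: "c \<in> C" "U i = ball c (5 * r c)" by auto
        then have "diameter (U i) = 10 * r c" using r(1)[of c] C(2) by (auto simp: subset_iff)
        moreover have "r c < \<delta> / 10" using r(2)[of c] c C(2) by auto
        ultimately show ?thesis by simp
      qed (use \<delta> in simp)
    qed
    have disj: "disjoint_family_on (\<lambda>c. ball c (r c)) C"
      using C(3) by (auto simp: disjoint_family_on_def pairwise_def disjnt_def)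
    have "hausdorff_content \<delta> s A \<le> (\<Sum>i. diam_pow s (U i))"
      unfolding hausdorff_content_def by (rule INF_lower) (use cover in simp)
    also have "\<dots> = (\<integral>\<^sup>+i. diam_pow s (U i) \<partial>count_space UNIV)"
      by (rule nn_integral_count_space_nat[symmetric])
    also have "\<dots> = (\<integral>\<^sup>+i. diam_pow s (U i) \<partial>count_space N)"
      by (subst nn_integral_count_space_indicator, simp, intro nn_integral_cong)
         (auto simp: U_def diam_pow_def indicator_def)
    also have "\<dots> = (\<integral>\<^sup>+c. diam_pow s (U (to_nat_on C c)) \<partial>count_space C)"
      by (rule nn_integral_bij_count_space[OF bij, symmetric])
    also have "\<dots> \<le> (\<integral>\<^sup>+c. ennreal (10 powr s / M) * emeasure \<nu> (ball c (r c)) \<partial>count_space C)"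
    proof (rule nn_integral_mono)
      fix c assume "c \<in> space (count_space C)"
      then have c: "c \<in> C" "c \<in> A" using C(2) by auto
      have "diam_pow s (U (to_nat_on C c)) = ennreal ((10 * r c) powr s)"
        using r(1)[OF c(2)] s by (simp add: Uc[OF c(1)] diam_pow_def)
      also have "\<dots> = ennreal (10 powr s / M) * ennreal (M * r c powr s)"
        using M r(1)[OF c(2)] by (simp add: ennreal_mult[symmetric] powr_mult)
      also have "\<dots> \<le> ennreal (10 powr s / M) * emeasure \<nu> (ball c (r c))"
        by (intro mult_left_mono r(3) c) simp
      finally show "diam_pow s (U (to_nat_on C c)) \<le> ennreal (10 powr s / M) * emeasure \<nu> (ball c (r c))" .
    qed
    also have "\<dots> = ennreal (10 powr s / M) * (\<integral>\<^sup>+c. emeasure \<nu> (ball c (r c)) \<partial>count_space C)"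
      by (rule nn_integral_cmult) simp
    also have "(\<integral>\<^sup>+c. emeasure \<nu> (ball c (r c)) \<partial>count_space C) = emeasure \<nu> (\<Union>c\<in>C. ball c (r c))"
      by (rule emeasure_UN_countable[symmetric]) (use C(1) disj in auto)
    also have "\<dots> \<le> emeasure \<nu> (ball 0 3)"
    proof (rule emeasure_mono)
      have "ball c (r c) \<subseteq> ball 0 3" if "c \<in> A" for c
      proof
        fix x assume "x \<in> ball c (r c)"
        moreover have "cmod c \<le> 1" using A that by auto
        ultimately show "x \<in> ball 0 3"
          using rB[OF that] norm_triangle_sub[of x c] by (simp add: dist_norm norm_minus_commute)
      qed
      then show "(\<Union>c\<in>C. ball c (r c)) \<subseteq> ball 0 3" using C(2) by blast
    qed simp
    also have "ennreal (10 powr s / M) * emeasure \<nu> (ball 0 3) \<le> ennreal e"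
    proof -
      have "10 powr s / M * V \<le> e"
      proof -
        have "10 powr s / M * V = e * (V / (V + 1))" using V e by (simp add: M_def)
        also have "\<dots> \<le> e * 1" using V e by (intro mult_left_mono) auto
        finally show ?thesis by simp
      qed
      then show ?thesis unfolding V(2) using V(1) M by (simp add: ennreal_mult[symmetric] ennreal_leI)
    qed
    finally show ?thesis by (simp add: mult_left_mono)
  qed
  then have "hausdorff_content \<delta> s A \<le> 0 + ennreal e" if "0 < \<delta>" "0 < e" for \<delta> e
    using that by simp
  then have "hausdorff_content \<delta> s A \<le> 0" if "0 < \<delta>" for \<delta>
    using that by (metis ennreal_le_epsilon)
  then show ?thesis
    unfolding hausdorff_measure_def by (intro antisym SUP_least) auto
qed

text \<open>A truncated form of Hoelder's inequality: at every level S > 0 the function is at most S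
  + S^(1-p) times its p-th power. S is taken so that its integral over the ball is half of the given
  lower bound, and the other half falls to the p-th power.\<close>

lemma integral_powr_lower_bound:
  fixes kk :: "complex \<Rightarrow> real"
  assumes [measurable]: "kk \<in> borel_measurable borel" and kk0: "\<And>x. 0 \<le> kk x" and p: "1 \<le> p"
    and C: "0 < C" and r: "0 < r"
    and le: "ennreal (C * r powr (2 - \<beta>)) \<le> (\<integral>\<^sup>+x. ennreal (kk x) * indicator (ball z r) x \<partial>lborel)"
  shows "ennreal ((C / (2 * pi)) powr (p - 1) * (C / 2) * r powr (2 - \<beta> * p))
    \<le> (\<integral>\<^sup>+x. ennreal (kk x powr p) * indicator (ball z r) x \<partial>lborel)" (is "_ \<le> ?V")
proof (cases ?V)
  case (real V)
  define S where "S = C / (2 * pi) * r powr (- \<beta>)"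
  have S: "0 < S" using C r by (simp add: S_def)
  have pt: "kk x \<le> S + S powr (1 - p) * kk x powr p" for x
  proof (cases "kk x \<le> S")
    case False
    then have k: "S < kk x" by simp
    have "S powr (p - 1) \<le> kk x powr (p - 1)" using k S p by (intro powr_mono2) auto
    then have "1 \<le> S powr (1 - p) * kk x powr (p - 1)"
    proof -
      have "1 = S powr (1 - p) * S powr (p - 1)" using S by (simp flip: powr_add)
      also have "\<dots> \<le> S powr (1 - p) * kk x powr (p - 1)"
        using \<open>S powr (p - 1) \<le> kk x powr (p - 1)\<close> by (intro mult_left_mono) auto
      finally show ?thesis .
    qed
    then have "kk x * 1 \<le> kk x * (S powr (1 - p) * kk x powr (p - 1))" using k S by (intro mult_left_mono) auto
    also have "\<dots> = S powr (1 - p) * kk x powr p" using k S by (simp add: powr_diff)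
    finally show ?thesis using S by simp
  qed (use S in \<open>simp add: add_increasing2\<close>)
  have "ennreal (C * r powr (2 - \<beta>)) \<le> (\<integral>\<^sup>+x. ennreal S * indicator (ball z r) x + ennreal (S powr (1 - p)) * (ennreal (kk x powr p) * indicator (ball z r) x) \<partial>lborel)"
  proof (rule order_trans[OF le], rule nn_integral_mono)
    fix x
    have "ennreal (kk x) \<le> ennreal S + ennreal (S powr (1 - p)) * ennreal (kk x powr p)"
      using ennreal_leI[OF pt[of x]] S by (simp add: ennreal_mult)
    then show "ennreal (kk x) * indicator (ball z r) x \<le> ennreal S * indicator (ball z r) x + ennreal (S powr (1 - p)) * (ennreal (kk x powr p) * indicator (ball z r) x)"
      by (auto simp: indicator_def)
  qed
  also have "\<dots> = ennreal S * ennreal (pi * r\<^sup>2) + ennreal (S powr (1 - p)) * ennreal V"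
    using r by (subst nn_integral_add) (auto simp: nn_integral_cmult nn_integral_cmult_indicator measure_lborel_ball_complex real)
  also have "\<dots> = ennreal (S * (pi * r\<^sup>2) + S powr (1 - p) * V)"
    using S real by (simp add: ennreal_mult)
  finally have "C * r powr (2 - \<beta>) \<le> S * (pi * r\<^sup>2) + S powr (1 - p) * V"
    using S real by (subst (asm) ennreal_le_iff) auto
  moreover have "S * (pi * r\<^sup>2) = C / 2 * r powr (2 - \<beta>)"
    using r by (simp add: S_def powr_diff powr_minus divide_simps)
  ultimately have "C / 2 * r powr (2 - \<beta>) \<le> S powr (1 - p) * V" by simp
  then have "S powr (p - 1) * (C / 2 * r powr (2 - \<beta>)) \<le> S powr (p - 1) * (S powr (1 - p) * V)"
    by (intro mult_left_mono) auto
  also have "\<dots> = V" using S by (simp flip: powr_add mult.assoc)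
  also have "S powr (p - 1) * (C / 2 * r powr (2 - \<beta>)) = (C / (2 * pi)) powr (p - 1) * (C / 2) * r powr (2 - \<beta> * p)"
  proof -
    have "S powr (p - 1) = (C / (2 * pi)) powr (p - 1) * r powr (- \<beta> * (p - 1))"
    proof -
      have "S powr (p - 1) = (C / (2 * pi)) powr (p - 1) * (r powr (- \<beta>)) powr (p - 1)"
        unfolding S_def by (rule powr_mult)
      then show ?thesis by (simp only: powr_powr)
    qed
    then have "S powr (p - 1) * (C / 2 * r powr (2 - \<beta>)) = (C / (2 * pi)) powr (p - 1) * (C / 2) * (r powr (- \<beta> * (p - 1)) * r powr (2 - \<beta>))"
      by simp
    also have "r powr (- \<beta> * (p - 1)) * r powr (2 - \<beta>) = r powr (2 - \<beta> * p)"
      by (simp add: powr_add[symmetric] algebra_simps)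
    finally show ?thesis .
  qed
  finally show ?thesis using real by (simp add: ennreal_leI)
qed simp

section \<open>Borel representatives and uniqueness of weak derivatives\<close>

lemma borel_representative:
  fixes g :: "complex \<Rightarrow> complex"
  assumes "g \<in> borel_measurable lebesgue"
  obtains g' where "g' \<in> borel_measurable borel" "AE x in lborel. g x = g' x"
proof -
  obtain a where a: "a \<in> borel_measurable lborel" "AE x in lborel. Re (g x) = a x"
    using completion_ex_borel_measurable_real[of "\<lambda>x. Re (g x)" lborel] assms by auto
  obtain b where b: "b \<in> borel_measurable lborel" "AE x in lborel. Im (g x) = b x"
    using completion_ex_borel_measurable_real[of "\<lambda>x. Im (g x)" lborel] assms by auto
  have "AE x in lborel. g x = complex_of_real (a x) + \<i> * complex_of_real (b x)"
    using a(2) b(2) by eventually_elim (simp add: complex_eq_iff)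
  moreover have "(\<lambda>x. complex_of_real (a x) + \<i> * complex_of_real (b x)) \<in> borel_measurable borel"
    using a(1) b(1) by simp
  ultimately show ?thesis using that by blast
qed

lemma test_function_measurable:
  assumes "test_function \<Omega> \<phi>"
  shows "\<phi> \<in> borel_measurable borel"
    and "v \<in> {1, \<i>} \<Longrightarrow> (\<lambda>z. frechet_derivative \<phi> (at z) v) \<in> borel_measurable borel"
proof -
  have C: "C_k 0 \<phi>" "C_k (Suc 0) \<phi>" using assms by (auto simp: test_function_def)
  show "\<phi> \<in> borel_measurable borel"
    using C(1) by (simp add: borel_measurable_continuous_onI)
  show "(\<lambda>z. frechet_derivative \<phi> (at z) v) \<in> borel_measurable borel" if "v \<in> {1, \<i>}"
    using C(2) that by (auto simp: borel_measurable_continuous_onI)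
qed

lemma Lp_loc_nn_integral:
  fixes g :: "complex \<Rightarrow> complex"
  assumes g: "Lp_loc 1 \<Omega> g" and C: "compact C" "C \<subseteq> \<Omega>"
    and ae: "AE x in lborel. x \<in> C \<longrightarrow> g x = g' x"
  shows "(\<integral>\<^sup>+x. ennreal (cmod (g' x)) * indicator C x \<partial>lborel) < \<infinity>"
proof -
  have "set_integrable lebesgue C (\<lambda>z. norm (g z) powr 1)"
    using g C by (simp add: Lp_loc_def)
  then have "(\<integral>\<^sup>+x. ennreal (norm (indicator C x *\<^sub>R (norm (g x) powr 1))) \<partial>lebesgue) < \<infinity>"
    by (simp add: set_integrable_def integrable_iff_bounded)
  also have "(\<integral>\<^sup>+x. ennreal (norm (indicator C x *\<^sub>R (norm (g x) powr 1))) \<partial>lebesgue)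
    = (\<integral>\<^sup>+x. ennreal (norm (indicator C x *\<^sub>R (norm (g x) powr 1))) \<partial>lborel)"
    by (rule nn_integral_completion)
  also have "\<dots> = (\<integral>\<^sup>+x. ennreal (cmod (g' x)) * indicator C x \<partial>lborel)"
    by (rule nn_integral_cong_AE) (use ae in eventually_elim, auto simp: indicator_def)
  finally show ?thesis .
qed

text \<open>Turns a weak derivative, which is measurable only for the completed measure, into data
  of the form required by \<open>sobolev_map\<close>.\<close>

lemma weak_deriv_representative:
  assumes f: "continuous_on UNIV f" and g: "has_weak_deriv v UNIV f g" and v: "v \<in> {1, \<i>}"
  obtains g' where "locally_integrable g'" "AE x in lborel. g x = g' x"
    "\<And>\<phi>. test_function UNIV \<phi> \<Longrightarrow>
      (\<integral>z. frechet_derivative \<phi> (at z) v *\<^sub>R f z \<partial>lborel) = - (\<integral>z. \<phi> z *\<^sub>R g' z \<partial>lborel)"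
proof -
  have gL: "Lp_loc 1 UNIV g" using g by (simp add: has_weak_deriv_def)
  then have gm: "g \<in> borel_measurable lebesgue" by (simp add: Lp_loc_def lebesgue_on_UNIV_eq)
  obtain g' where g' [measurable]: "g' \<in> borel_measurable borel" and ae: "AE x in lborel. g x = g' x"
    using borel_representative[OF gm] by blast
  have [measurable]: "f \<in> borel_measurable borel" by (rule borel_measurable_continuous_onI[OF f])
  show ?thesis
  proof (rule that[OF _ ae])
    show "locally_integrable g'"
      unfolding locally_integrable_def
    proof safe
      fix r :: real
      have "(\<integral>\<^sup>+x. ennreal (cmod (g' x)) * indicator (ball 0 r) x \<partial>lborel) \<le> (\<integral>\<^sup>+x. ennreal (cmod (g' x)) * indicator (cball 0 r) x \<partial>lborel)"
        by (intro nn_integral_mono) (auto simp: indicator_def)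
      also have "\<dots> < \<infinity>"
        by (rule Lp_loc_nn_integral[OF gL]) (use ae in auto)
      finally show "(\<integral>\<^sup>+x. ennreal (norm (g' x)) * indicator (ball 0 r) x \<partial>lborel) < \<infinity>" .
    qed measurable
    fix \<phi> assume t: "test_function UNIV \<phi>"
    note [measurable] = test_function_measurable(1)[OF t] test_function_measurable(2)[OF t v]
    have "(\<integral>z. frechet_derivative \<phi> (at z) v *\<^sub>R f z \<partial>lborel) = (\<integral>z. frechet_derivative \<phi> (at z) v *\<^sub>R f z \<partial>lebesgue)"
      by (rule integral_completion[symmetric]) measurable
    also have "\<dots> = - (\<integral>z. \<phi> z *\<^sub>R g z \<partial>lebesgue)"
      using g t by (simp add: has_weak_deriv_def set_lebesgue_integral_def)
    also have "(\<integral>z. \<phi> z *\<^sub>R g z \<partial>lebesgue) = (\<integral>z. \<phi> z *\<^sub>R g' z \<partial>lebesgue)"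
    proof (rule integral_cong_AE)
      show "(\<lambda>z. \<phi> z *\<^sub>R g z) \<in> borel_measurable lebesgue"
        using gm measurable_completion[of \<phi> lborel borel] by (intro borel_measurable_scaleR) auto
      show "(\<lambda>z. \<phi> z *\<^sub>R g' z) \<in> borel_measurable lebesgue"
        by (rule measurable_completion) measurable
      show "AE x in lebesgue. \<phi> x *\<^sub>R g x = \<phi> x *\<^sub>R g' x"
        using AE_completion[OF ae] by eventually_elim simp
    qed
    also have "\<dots> = (\<integral>z. \<phi> z *\<^sub>R g' z \<partial>lborel)"
      by (rule integral_completion) measurable
    finally show "(\<integral>z. frechet_derivative \<phi> (at z) v *\<^sub>R f z \<partial>lborel) = - (\<integral>z. \<phi> z *\<^sub>R g' z \<partial>lborel)" .
  qed
qed

text \<open>Quasiconformality refers to weak derivatives chosen on the disk, finite distortion to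
  weak derivatives chosen on the plane. Kernels supported in the disk are test functions for both
  domains, so the mollifications agree at small scales and their almost everywhere limits
  coincide.\<close>

lemma weak_deriv_ball_unique:
  assumes f: "continuous_on UNIV f" and g0: "locally_integrable g0" and v: "v \<in> {1, \<i>}"
    and weak: "\<And>\<phi>. test_function UNIV \<phi> \<Longrightarrow>
      (\<integral>z. frechet_derivative \<phi> (at z) v *\<^sub>R f z \<partial>lborel) = - (\<integral>z. \<phi> z *\<^sub>R g0 z \<partial>lborel)"
    and g: "has_weak_deriv v (ball 0 1) f g"
  shows "AE x in lborel. x \<in> ball 0 1 \<longrightarrow> g x = g0 x"
proof -
  have gL: "Lp_loc 1 (ball 0 1) g" using g by (simp add: has_weak_deriv_def)
  have gm: "(\<lambda>x. indicator (ball 0 1) x *\<^sub>R g x) \<in> borel_measurable lebesgue"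
    using gL by (simp add: Lp_loc_def borel_measurable_restrict_space_iff)
  obtain g' where g' [measurable]: "g' \<in> borel_measurable borel" and ae: "AE x in lborel. indicator (ball 0 1) x *\<^sub>R g x = g' x"
    using borel_representative[OF gm] by blast
  have [measurable]: "f \<in> borel_measurable borel" by (rule borel_measurable_continuous_onI[OF f])
  \<comment> \<open>Integrability on the disk is only local, so the comparison is made on an
    exhaustion by smaller disks, where the cut-off derivative is integrable.\<close>
  define R where "R n = 1 - 1 / real (Suc n)" for n
  define gn where "gn n x = indicator (ball 0 (R n)) x *\<^sub>R g' x" for n x
  have R1: "R n < 1" for n by (simp add: R_def)
  have lgn: "locally_integrable (gn n)" for n
    unfolding locally_integrable_def
  proof safe
    show "gn n \<in> borel_measurable borel" unfolding gn_def by measurable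
    fix r :: real
    have "(\<integral>\<^sup>+x. ennreal (cmod (gn n x)) * indicator (ball 0 r) x \<partial>lborel) \<le> (\<integral>\<^sup>+x. ennreal (cmod (g' x)) * indicator (cball 0 (R n)) x \<partial>lborel)"
      by (intro nn_integral_mono) (auto simp: indicator_def gn_def)
    also have "\<dots> < \<infinity>"
    proof (rule Lp_loc_nn_integral[OF gL])
      show "cball 0 (R n) \<subseteq> ball (0::complex) 1" using R1[of n] by auto
      then show "AE x in lborel. x \<in> cball 0 (R n) \<longrightarrow> g x = g' x"
        using ae by eventually_elim (use R1[of n] in \<open>auto simp: indicator_def\<close>)
    qed simp
    finally show "(\<integral>\<^sup>+x. ennreal (norm (gn n x)) * indicator (ball 0 r) x \<partial>lborel) < \<infinity>" .
  qed
  have eq: "mollify h (gn n) x = mollify h g0 x" if h: "0 < h" and x: "cball x h \<subseteq> ball 0 (R n)" for h x n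
  proof -
    define \<phi> where "\<phi> y = mollifier h (x - y)" for y
    have x1: "cball x h \<subseteq> ball 0 1" using x R1[of n] by (meson less_imp_le subset_ball order_trans)
    have t: "test_function UNIV \<phi>" "test_function (ball 0 1) \<phi>"
      unfolding \<phi>_def by (auto intro!: test_function_mollifier h x1)
    note [measurable] = test_function_measurable(1)[OF t(1)] test_function_measurable(2)[OF t(1) v]
    have \<phi>0: "\<phi> y = 0" if "y \<notin> cball x h" for y
      using that mollifier_eq_0[OF h, of "x - y"] by (simp add: \<phi>_def dist_norm)
    have d0: "frechet_derivative \<phi> (at y) = (\<lambda>_. 0)" if "y \<notin> cball x h" for y
    proof -
      have "((\<lambda>_. 0) has_derivative (\<lambda>_. 0)) (at y)" by simp
      then have "(\<phi> has_derivative (\<lambda>_. 0)) (at y)"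
        by (rule has_derivative_transform_within_open[of _ _ _ _ "- cball x h"]) (use that \<phi>0 in auto)
      then show ?thesis by (rule frechet_derivative_at[symmetric])
    qed
    have "mollify h (gn n) x = (\<integral>y. \<phi> y *\<^sub>R g' y \<partial>lborel)"
      unfolding mollify_def \<phi>_def[symmetric]
    proof (rule Bochner_Integration.integral_cong)
      fix y
      show "\<phi> y *\<^sub>R gn n y = \<phi> y *\<^sub>R g' y"
        using \<phi>0[of y] x by (cases "y \<in> cball x h") (auto simp: gn_def)
    qed simp
    also have "\<dots> = (\<integral>y. \<phi> y *\<^sub>R g' y \<partial>lebesgue)"
      by (rule integral_completion[symmetric]) measurable
    also have "\<dots> = (\<integral>y. indicator (ball 0 1) y *\<^sub>R (\<phi> y *\<^sub>R g y) \<partial>lebesgue)"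
    proof (rule integral_cong_AE)
      show "(\<lambda>y. \<phi> y *\<^sub>R g' y) \<in> borel_measurable lebesgue"
        by (rule measurable_completion) measurable
      have "(\<lambda>y. \<phi> y *\<^sub>R (indicator (ball 0 1) y *\<^sub>R g y)) \<in> borel_measurable lebesgue"
        by (rule borel_measurable_scaleR[OF _ gm]) (rule measurable_completion, measurable)
      then show "(\<lambda>y. indicator (ball 0 1) y *\<^sub>R (\<phi> y *\<^sub>R g y)) \<in> borel_measurable lebesgue"
        by (simp add: mult.commute)
      show "AE y in lebesgue. \<phi> y *\<^sub>R g' y = indicator (ball 0 1) y *\<^sub>R (\<phi> y *\<^sub>R g y)"
        using AE_completion[OF ae]
      proof eventually_elim
        case (elim y)
        then show ?case by (simp add: elim[symmetric] mult.commute)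
      qed
    qed
    also have "\<dots> = - (\<integral>y. indicator (ball 0 1) y *\<^sub>R (frechet_derivative \<phi> (at y) v *\<^sub>R f y) \<partial>lebesgue)"
      using g t(2) by (simp add: has_weak_deriv_def set_lebesgue_integral_def)
    also have "(\<integral>y. indicator (ball 0 1) y *\<^sub>R (frechet_derivative \<phi> (at y) v *\<^sub>R f y) \<partial>lebesgue)
      = (\<integral>y. frechet_derivative \<phi> (at y) v *\<^sub>R f y \<partial>lebesgue)"
    proof (rule Bochner_Integration.integral_cong)
      fix y
      show "indicator (ball 0 1) y *\<^sub>R (frechet_derivative \<phi> (at y) v *\<^sub>R f y) = frechet_derivative \<phi> (at y) v *\<^sub>R f y"
        using d0[of y] x1 by (cases "y \<in> cball x h") auto
    qed simp
    also have "\<dots> = (\<integral>y. frechet_derivative \<phi> (at y) v *\<^sub>R f y \<partial>lborel)"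
      by (rule integral_completion) measurable
    also have "- \<dots> = (\<integral>y. \<phi> y *\<^sub>R g0 y \<partial>lborel)"
      using weak[OF t(1)] by simp
    finally show ?thesis by (simp add: mollify_def \<phi>_def)
  qed
  have "AE x in lborel. x \<in> ball 0 (R n) \<longrightarrow> g x = g0 x" for n
    using mollify_tendsto_AE[OF g0] mollify_tendsto_AE[OF lgn[of n]] ae
  proof eventually_elim
    case (elim x)
    show ?case
    proof
      assume x: "x \<in> ball 0 (R n)"
      then obtain e where e: "0 < e" "cball x e \<subseteq> ball 0 (R n)"
        using open_contains_cball open_ball by blast
      have lim0: "(\<lambda>k. 1 / real (Suc k)) \<longlonglongrightarrow> 0"
        using LIMSEQ_inverse_real_of_nat by (simp add: inverse_eq_divide)
      have "\<forall>\<^sub>F k in sequentially. mollify (1 / real (Suc k)) (gn n) x = mollify (1 / real (Suc k)) g0 x"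
        using order_tendstoD(2)[OF lim0 e(1)]
      proof eventually_elim
        case (elim k)
        then have "cball x (1 / real (Suc k)) \<subseteq> ball 0 (R n)"
          using e(2) by (meson less_imp_le subset_cball order_trans)
        then show ?case by (intro eq) auto
      qed
      from Lim_transform_eventually[OF elim(2) this] have "gn n x = g0 x"
        using elim(1) LIMSEQ_unique by blast
      moreover have "x \<in> ball 0 1" using x R1[of n] by auto
      ultimately show "g x = g0 x" using elim(3) x by (simp add: gn_def)
    qed
  qed
  then have "AE x in lborel. \<forall>n. x \<in> ball 0 (R n) \<longrightarrow> g x = g0 x"
    by (intro AE_all_countable[THEN iffD2] allI)
  then show ?thesis
  proof eventually_elim
    case (elim x)
    show ?case
    proof
      assume "x \<in> ball 0 1"
      then have "0 < 1 - cmod x" by simp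
      then obtain n where "1 / real (Suc n) < 1 - cmod x"
        using reals_Archimedean[of "1 - cmod x"] by (auto simp: inverse_eq_divide)
      then have "x \<in> ball 0 (R n)" by (simp add: R_def)
      then show "g x = g0 x" using elim by blast
    qed
  qed
qed

text \<open>A direction attaining |a| + |b| for v -> a v + b cnj v is one where both terms have the
  same argument, that is where v^2 is the quotient of the unit vectors of b and a. Only this half of
  the formula for the operator norm is needed to bound \<open>dnorm\<close> by the distortion
  inequalities.\<close>

lemma onorm_ge_wirtinger:
  "cmod ((X - \<i> * Y) / 2) + cmod ((X + \<i> * Y) / 2) \<le> onorm (\<lambda>v. Re v *\<^sub>R X + Im v *\<^sub>R Y)"
proof -
  define a b where "a = (X - \<i> * Y) / 2" and "b = (X + \<i> * Y) / 2"
  define T where "T v = Re v *\<^sub>R X + Im v *\<^sub>R Y" for v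
  have T: "T v = a * v + b * cnj v" for v
    unfolding T_def a_def b_def by (rule wirtinger)
  have bl: "bounded_linear T"
    unfolding T_def by (intro bounded_linear_add bounded_linear_scaleR_const bounded_linear_Re bounded_linear_Im)
  have "\<exists>v. cmod v = 1 \<and> cmod (T v) = cmod a + cmod b"
  proof (cases "a = 0 \<or> b = 0")
    case True
    then show ?thesis by (intro exI[of _ 1]) (auto simp: T)
  next
    case False
    define w where "w = (b / of_real (cmod b)) / (a / of_real (cmod a))"
    define v where "v = csqrt w"
    have v2: "v * v = w" using power2_csqrt[of w] by (simp add: v_def power2_eq_square)
    have "cmod w = 1" using False by (simp add: w_def norm_divide norm_mult)
    then have "cmod v * cmod v = 1" using v2 by (metis norm_mult)
    then have "(cmod v)\<^sup>2 = 1" by (simp add: power2_eq_square)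
    then have v1: "cmod v = 1" using norm_ge_zero[of v] unfolding power2_eq_1_iff by linarith
    have vc: "v * cnj v = 1" using v1 by (simp add: complex_norm_square[symmetric])
    have "a * w * of_real (cmod b) = b * of_real (cmod a)"
      using False by (simp add: w_def field_simps)
    then have "a * (v * v) * of_real (cmod b) * cnj v = b * of_real (cmod a) * cnj v"
      unfolding v2 by (rule arg_cong)
    also have "a * (v * v) * of_real (cmod b) * cnj v = a * v * of_real (cmod b) * (v * cnj v)"
      by (simp only: mult_ac)
    finally have *: "b * cnj v * of_real (cmod a) = a * v * of_real (cmod b)"
      by (simp add: vc mult_ac)
    have "T v * of_real (cmod a) = a * v * (of_real (cmod a) + of_real (cmod b))"
      unfolding T using * by (simp add: algebra_simps)
    then have "cmod (T v * of_real (cmod a)) = cmod (a * v * of_real (cmod a + cmod b))" by simp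
    then have "cmod (T v) * cmod a = cmod a * (cmod a + cmod b)"
      using v1 by (simp only: norm_mult norm_of_real) simp
    then have "cmod (T v) = cmod a + cmod b" using False by simp
    then show ?thesis using v1 by blast
  qed
  then obtain v where v: "cmod v = 1" "cmod (T v) = cmod a + cmod b" by blast
  then show ?thesis
    using onorm[OF bl, of v] by (simp add: a_def b_def T_def[abs_def])
qed

theorem theorem2:
  fixes K p L s \<epsilon> :: real
    and f g :: "complex \<Rightarrow> complex"
    and \<Omega>\<^sub>L A :: "complex set"
  assumes "K \<ge> 1" and "p \<ge> 1" and "L \<ge> 1"
    and "p_integrable_distortion p f"
    and "quasiconformal K (ball 0 1) (f ` ball 0 1) f"
    and "weak_starlike \<Omega>\<^sub>L" and "bi_lipschitz L g"
    and "f ` ball 0 1 = g ` \<Omega>\<^sub>L"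
    and "0 < s" and "s < 2" and "\<epsilon> > 0"
    and "\<And>z. z \<in> A \<Longrightarrow> \<exists>lam :: nat \<Rightarrow> complex.
           (\<forall>n. lam n \<noteq> 0) \<and> (\<lambda>n. cmod (lam n)) \<longlonglongrightarrow> 0 \<and>
           (\<forall>n. z + lam n \<in> closure (ball 0 1)) \<and>
           (\<forall>n. cmod (f z - f (z + lam n)) \<le> cmod (lam n) powr (2 * K + (2 - s + \<epsilon>) / p))"
  shows "hausdorff_dim A \<le> ereal s"
proof -
  obtain k where fd: "finite_distortion UNIV UNIV f" and k: "is_distortion UNIV f k" and kL: "Lp_loc p UNIV (\<lambda>z. real_of_ereal (k z))"
    using assms(4) by (auto simp: p_integrable_distortion_def)
  obtain finv where hom: "homeomorphism UNIV UNIV f finv"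
    using fd by (auto simp: finite_distortion_def op_homeomorphism_def)
  then have cf: "continuous_on UNIV f" by (simp add: homeomorphism_def)
  have W: "has_weak_deriv v UNIV f (weak_deriv v UNIV f)" if "v \<in> {1, \<i>}" for v
  proof -
    have "sobolev_loc 1 UNIV f" using fd by (simp add: finite_distortion_def)
    then have "\<exists>g. has_weak_deriv v UNIV f g" using that unfolding sobolev_loc_def by blast
    then show ?thesis unfolding weak_deriv_def by (rule someI_ex)
  qed
  have WD: "has_weak_deriv v (ball 0 1) f (weak_deriv v (ball 0 1) f)" if "v \<in> {1, \<i>}" for v
  proof -
    have "sobolev_loc 2 (ball 0 1) f" using assms(5) by (simp add: quasiconformal_def)
    then have "\<exists>g. has_weak_deriv v (ball 0 1) f g" using that unfolding sobolev_loc_def by blast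
    then show ?thesis unfolding weak_deriv_def by (rule someI_ex)
  qed
  obtain fx where fx: "locally_integrable fx" "AE x in lborel. weak_deriv 1 UNIV f x = fx x"
    "\<And>\<phi>. test_function UNIV \<phi> \<Longrightarrow> (\<integral>z. frechet_derivative \<phi> (at z) 1 *\<^sub>R f z \<partial>lborel) = - (\<integral>z. \<phi> z *\<^sub>R fx z \<partial>lborel)"
    by (rule weak_deriv_representative[OF cf W, of 1]) auto
  obtain fy where fy: "locally_integrable fy" "AE x in lborel. weak_deriv \<i> UNIV f x = fy x"
    "\<And>\<phi>. test_function UNIV \<phi> \<Longrightarrow> (\<integral>z. frechet_derivative \<phi> (at z) \<i> *\<^sub>R f z \<partial>lborel) = - (\<integral>z. \<phi> z *\<^sub>R fy z \<partial>lborel)"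
    by (rule weak_deriv_representative[OF cf W, of \<i>]) auto
  interpret sobolev_map f fx fy
    by unfold_locales (use cf fx fy in auto)
  have dnorm_le: "(dnorm x)\<^sup>2 \<le> (onorm (weak_D S f x))\<^sup>2" "weak_jacobian S f x = jac x"
    if "weak_deriv 1 S f x = fx x" "weak_deriv \<i> S f x = fy x" for S x
  proof -
    have "dnorm x \<le> onorm (weak_D S f x)"
      using onorm_ge_wirtinger[of "fx x" "fy x"] that
      by (simp add: dnorm_def dz_def dzbar_def weak_D_def[abs_def])
    then show "(dnorm x)\<^sup>2 \<le> (onorm (weak_D S f x))\<^sup>2" by (rule power_mono) simp
    show "weak_jacobian S f x = jac x"
      using that by (simp add: weak_jacobian_def weak_D_def jac_def)
  qed
  have distK: "AE x in lborel. x \<in> ball 0 1 \<longrightarrow> (dnorm x)\<^sup>2 \<le> K * jac x"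
  proof -
    have "AE x in lebesgue_on (ball 0 1). (onorm (weak_D (ball 0 1) f x))\<^sup>2 \<le> K * weak_jacobian (ball 0 1) f x"
      using assms(5) by (simp add: quasiconformal_def)
    then have "AE x in lborel. x \<in> ball 0 1 \<longrightarrow> (onorm (weak_D (ball 0 1) f x))\<^sup>2 \<le> K * weak_jacobian (ball 0 1) f x"
      by (simp add: AE_restrict_space_iff AE_completion_iff)
    moreover have "AE x in lborel. x \<in> ball 0 1 \<longrightarrow> weak_deriv 1 (ball 0 1) f x = fx x"
      by (rule weak_deriv_ball_unique[OF cf fx(1) _ fx(3) WD]) auto
    moreover have "AE x in lborel. x \<in> ball 0 1 \<longrightarrow> weak_deriv \<i> (ball 0 1) f x = fy x"
      by (rule weak_deriv_ball_unique[OF cf fy(1) _ fy(3) WD]) auto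
    ultimately show ?thesis
      by eventually_elim (use dnorm_le[of "ball 0 1"] in force)
  qed
  define kr where "kr z = real_of_ereal (k z)" for z
  have "kr \<in> borel_measurable lebesgue"
    using kL by (simp add: Lp_loc_def lebesgue_on_UNIV_eq kr_def[abs_def])
  then obtain k' where k' [measurable]: "k' \<in> borel_measurable lborel" and k'ae: "AE x in lborel. kr x = k' x"
    using completion_ex_borel_measurable_real by blast
  \<comment> \<open>A Borel version of the distortion that is nonnegative everywhere; it agrees
    almost everywhere with the original because that one is at least 1.\<close>
  define kk where "kk x = max 0 (k' x)" for x
  have kk [measurable]: "kk \<in> borel_measurable borel" using k' unfolding kk_def by simp
  have kk0: "0 \<le> kk x" for x by (simp add: kk_def)
  have db: "distortion_bound UNIV f k" using k by (simp add: is_distortion_def)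
  have kr0: "0 \<le> kr x" for x
  proof -
    have "1 \<le> k x" using db by (simp add: distortion_bound_def)
    then have "0 \<le> k x" by (cases "k x") auto
    then show ?thesis by (simp add: kr_def real_of_ereal_pos)
  qed
  have kkae: "AE x in lborel. kr x = kk x"
    using k'ae
  proof eventually_elim
    case (elim x)
    then show ?case using kr0[of x] by (simp add: kk_def)
  qed
  have dist: "AE x in lborel. (dnorm x)\<^sup>2 \<le> kk x * jac x"
  proof -
    have "AE x in lborel. k x < \<infinity>" "AE x in lborel. ereal ((onorm (weak_D UNIV f x))\<^sup>2) \<le> k x * ereal (weak_jacobian UNIV f x)"
      using db unfolding distortion_bound_def lebesgue_on_UNIV_eq AE_completion_iff by blast+
    then show ?thesis
      using fx(2) fy(2) kkae
    proof eventually_elim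
      case (elim x)
      have "1 \<le> k x" using db by (simp add: distortion_bound_def)
      then have "k x = ereal (kr x)"
        using elim(1) unfolding kr_def by (cases "k x") auto
      then have "(onorm (weak_D UNIV f x))\<^sup>2 \<le> kk x * weak_jacobian UNIV f x"
        using elim(2,5) by simp
      then show ?case using dnorm_le[OF elim(3,4)] by simp
    qed
  qed
  have fin: "(\<integral>\<^sup>+x. ennreal (kk x powr p) * indicator (ball 0 3) x \<partial>lborel) < \<infinity>"
  proof -
    have "set_integrable lebesgue (cball 0 3) (\<lambda>z. norm (kr z) powr p)"
      using kL by (simp add: Lp_loc_def kr_def)
    then have "(\<integral>\<^sup>+x. ennreal (norm (indicator (cball 0 3) x *\<^sub>R (norm (kr x) powr p))) \<partial>lebesgue) < \<infinity>"
      by (simp add: set_integrable_def integrable_iff_bounded)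
    moreover have "(\<integral>\<^sup>+x. ennreal (kk x powr p) * indicator (ball 0 3) x \<partial>lborel)
      \<le> (\<integral>\<^sup>+x. ennreal (norm (indicator (cball 0 3) x *\<^sub>R (norm (kr x) powr p))) \<partial>lebesgue)"
      unfolding nn_integral_completion
      by (rule nn_integral_mono_AE) (use kkae in eventually_elim, use kk0 in \<open>auto simp: indicator_def\<close>)
    ultimately show ?thesis by (rule le_less_trans[rotated])
  qed
  \<comment> \<open>K' spends half of \<epsilon>/p on the loss in the compression estimate. The
    other half remains in \<beta> and makes 2 - \<beta> p equal to s - \<epsilon>/2.\<close>
  define a K' \<beta> where "a = 2 * K + (2 - s + \<epsilon>) / p" and "K' = 2 * K + \<epsilon> / (2 * p)" and "\<beta> = a - K'"
  have K': "2 * K < K'" "K' < a"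
  proof -
    have p: "0 < p" using assms(2) by linarith
    show "2 * K < K'" using p assms(11) by (simp add: K'_def)
    have "\<epsilon> / 2 / p < (2 - s + \<epsilon>) / p" using p assms(10,11) by (intro divide_strict_right_mono) auto
    then show "K' < a" by (simp add: K'_def a_def)
  qed
  have \<beta>p: "2 - \<beta> * p = s - \<epsilon> / 2"
  proof -
    have "\<epsilon> / (2 * p) = \<epsilon> / 2 / p" by simp
    then have "\<beta> = ((2 - s + \<epsilon>) - \<epsilon> / 2) / p"
      unfolding \<beta>_def a_def K'_def diff_divide_distrib by linarith
    then have "\<beta> * p = (2 - s + \<epsilon>) - \<epsilon> / 2" using assms(2) by simp
    then show ?thesis by simp
  qed
  obtain C where C: "0 < C" "\<And>z. z \<in> cball 0 1 \<Longrightarrow> \<exists>\<tau>0>0. \<forall>w\<in>cball 0 1. 0 < cmod (z - w) \<and> cmod (z - w) < \<tau>0 \<and> cmod (f z - f w) \<le> cmod (z - w) powr a \<longrightarrow>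
      ennreal (C * cmod (z - w) powr (2 + K' - a)) \<le> (\<integral>\<^sup>+x. ennreal (kk x) * indicator (ball z (cmod (z - w))) x \<partial>lborel)"
    by (rule boundary_estimate[OF hom assms(1) distK K' kk kk0 dist assms(3,6,7,8)], rule that) blast+
  define C' where "C' = (C / (2 * pi)) powr (p - 1) * (C / 2)"
  have C': "0 < C'" using C by (simp add: C'_def)
  have lam: "\<exists>lam :: nat \<Rightarrow> complex. (\<forall>n. lam n \<noteq> 0) \<and> (\<lambda>n. cmod (lam n)) \<longlonglongrightarrow> 0 \<and>
      (\<forall>n. z + lam n \<in> cball 0 1) \<and> (\<forall>n. cmod (f z - f (z + lam n)) \<le> cmod (lam n) powr a)" if "z \<in> A" for z
    using assms(12)[OF that] by (simp add: a_def)
  \<comment> \<open>Every point of A is a limit of points z + lam n of the closed disk.\<close>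
  have Asub: "A \<subseteq> cball 0 1"
  proof
    fix z assume "z \<in> A"
    then obtain lam :: "nat \<Rightarrow> complex" where l: "(\<lambda>n. cmod (lam n)) \<longlonglongrightarrow> 0" "\<And>n. z + lam n \<in> cball 0 1"
      using lam by blast
    have lim: "(\<lambda>n. z + lam n) \<longlonglongrightarrow> z + 0"
      using l(1) by (intro tendsto_add tendsto_const) (simp add: tendsto_norm_zero_iff)
    have "z + 0 \<in> cball 0 1"
      by (rule closed_sequentially[OF closed_cball l(2) lim])
    then show "z \<in> cball 0 1" by simp
  qed
  have "hausdorff_measure s A = 0"
  proof (rule hausdorff_measure_zero_of_density[OF _ Asub assms(9) fin])
    show "(\<lambda>x. ennreal (kk x powr p)) \<in> borel_measurable borel" by measurable
    fix M \<delta> :: real and z' :: complex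
    assume z: "z' \<in> A" and M: "0 < M" and \<delta>: "0 < \<delta>"
    obtain lam :: "nat \<Rightarrow> complex" where l: "\<And>n. lam n \<noteq> 0" "(\<lambda>n. cmod (lam n)) \<longlonglongrightarrow> 0" "\<And>n. z' + lam n \<in> cball 0 1"
      "\<And>n. cmod (f z' - f (z' + lam n)) \<le> cmod (lam n) powr a"
      using lam[OF z] by blast
    obtain \<tau>0 where \<tau>0: "0 < \<tau>0" "\<And>w. w \<in> cball 0 1 \<Longrightarrow> 0 < cmod (z' - w) \<Longrightarrow> cmod (z' - w) < \<tau>0 \<Longrightarrow> cmod (f z' - f w) \<le> cmod (z' - w) powr a \<Longrightarrow>
      ennreal (C * cmod (z' - w) powr (2 + K' - a)) \<le> (\<integral>\<^sup>+x. ennreal (kk x) * indicator (ball z' (cmod (z' - w))) x \<partial>lborel)"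
      using C(2)[of z'] Asub z by (meson subsetD)
    \<comment> \<open>Below this radius C' r^(s - \<epsilon>/2) exceeds M r^s, however large M
      is.\<close>
    obtain \<tau>1 where \<tau>1: "0 < \<tau>1" "\<And>\<tau>. 0 < \<tau> \<Longrightarrow> \<tau> < \<tau>1 \<Longrightarrow> \<tau> powr s \<le> C' / M * \<tau> powr (s - \<epsilon> / 2)"
      using power_less_scaled_power_eventually[of "C' / M" "s - \<epsilon> / 2" s] C' M assms(11) by auto
    have "\<forall>\<^sub>F n in sequentially. cmod (lam n) < min \<delta> (min \<tau>0 \<tau>1)"
      using l(2) \<delta> \<tau>0(1) \<tau>1(1) by (intro order_tendstoD(2)) auto
    then obtain n where n: "cmod (lam n) < min \<delta> (min \<tau>0 \<tau>1)"
      by (auto simp: eventually_sequentially)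
    define r where "r = cmod (lam n)"
    have r: "0 < r" "r < \<delta>" "r < \<tau>0" "r < \<tau>1" using n l(1)[of n] by (auto simp: r_def)
    have zr: "cmod (z' - (z' + lam n)) = r" by (simp add: r_def)
    have "ennreal (C * r powr (2 - \<beta>)) \<le> (\<integral>\<^sup>+x. ennreal (kk x) * indicator (ball z' r) x \<partial>lborel)"
      using \<tau>0(2)[OF l(3)[of n]] l(4)[of n] r unfolding zr by (simp add: \<beta>_def r_def algebra_simps)
    from integral_powr_lower_bound[OF kk kk0 assms(2) C(1) r(1) this]
    have "ennreal (C' * r powr (s - \<epsilon> / 2)) \<le> (\<integral>\<^sup>+x. ennreal (kk x powr p) * indicator (ball z' r) x \<partial>lborel)"
      by (simp add: C'_def \<beta>p)
    moreover have "M * r powr s \<le> C' * r powr (s - \<epsilon> / 2)"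
      using \<tau>1(2)[OF r(1,4)] M by (simp add: field_simps)
    ultimately have "ennreal (M * r powr s) \<le> (\<integral>\<^sup>+x. ennreal (kk x powr p) * indicator (ball z' r) x \<partial>lborel)"
      by (meson ennreal_leI order_trans)
    then show "\<exists>r. 0 < r \<and> r < \<delta> \<and> ennreal (M * r powr s) \<le> (\<integral>\<^sup>+x. ennreal (kk x powr p) * indicator (ball z' r) x \<partial>lborel)"
      using r by blast
  qed
  then show ?thesis
    unfolding hausdorff_dim_def using assms(9) by (intro INF_lower) auto
qed

end
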